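(* Let $G$ be a locally finite connected graph. Then the following are equivalent: (i) $G$ is $2$-connected and contains neither $K^4$ nor $K_{2,3}$ as a minor; (ii) $|G|$ has a Hamilton circle $C$ and there exists a topological embedding of $|G|$ into a closed disk such that $C$ is mapped onto the boundary of the disk. Furthermore, if (i) and (ii) hold, then $|G|$ has a unique Hamilton circle.
   Context: All graphs are simple. For a locally finite connected graph $G$, an end is an equivalence class of rays of $G$, two rays being equivalent if no finite vertex set separates them. $|G|$ is the Freudenthal compactification of $G$: $G$ as a 1-complex together with its ends, where for every finite $S\subseteq V(G)$ and end $\omega$, the component $C$ of $G-S$ containing tails of all rays of $\omega$, together with the ends whose rays have tails in $C$ and the inner points of edges between $S$ and $C$, forms an open neighbourhood of $\omega$. A circle in $|G|$ is a homeomorphic image of $S^1$ in $|G|$; a Hamilton circle is a circle in $|G|$ containing all vertices of $G$. *)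

theory Defs
  imports "HOL-Analysis.Analysis"
begin

definition simple_graph :: "'a set \<Rightarrow> 'a set set \<Rightarrow> bool" where
  "simple_graph V E \<longleftrightarrow> (\<forall>e\<in>E. e \<subseteq> V \<and> card e = 2)"

definition locally_finite :: "'a set \<Rightarrow> 'a set set \<Rightarrow> bool" where
  "locally_finite V E \<longleftrightarrow> (\<forall>v\<in>V. finite {e\<in>E. v \<in> e})"

definition reach :: "'a set set \<Rightarrow> 'a set \<Rightarrow> 'a \<Rightarrow> 'a \<Rightarrow> bool" where
  "reach E W = (\<lambda>x y. x \<in> W \<and> y \<in> W \<and> {x, y} \<in> E)\<^sup>*\<^sup>*"

definition connected_on :: "'a set set \<Rightarrow> 'a set \<Rightarrow> bool" where
  "connected_on E W \<longleftrightarrow> W \<noteq> {} \<and> (\<forall>u\<in>W. \<forall>v\<in>W. reach E W u v)"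

definition graph_connected :: "'a set \<Rightarrow> 'a set set \<Rightarrow> bool" where
  "graph_connected V E \<longleftrightarrow> connected_on E V"

text \<open>2-connected (Diestel): more than two vertices and G - X connected for all X with |X| < 2.\<close>

definition two_connected :: "'a set \<Rightarrow> 'a set set \<Rightarrow> bool" where
  "two_connected V E \<longleftrightarrow> (infinite V \<or> card V > 2) \<and>
      graph_connected V E \<and> (\<forall>x\<in>V. connected_on E (V - {x}))"

definition has_minor :: "'a set \<Rightarrow> 'a set set \<Rightarrow> 'b set \<Rightarrow> 'b set set \<Rightarrow> bool" where
  "has_minor V E HV HE \<longleftrightarrow>
     (\<exists>B :: 'b \<Rightarrow> 'a set.
        (\<forall>x\<in>HV. B x \<subseteq> V \<and> connected_on E (B x)) \<and>
        (\<forall>x\<in>HV. \<forall>y\<in>HV. x \<noteq> y \<longrightarrow> B x \<inter> B y = {}) \<and>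
        (\<forall>x\<in>HV. \<forall>y\<in>HV. {x, y} \<in> HE \<longrightarrow> (\<exists>u\<in>B x. \<exists>w\<in>B y. {u, w} \<in> E)))"

definition K4_V :: "nat set" where "K4_V = {0..<4}"
definition K4_E :: "nat set set" where "K4_E = {{i, j} | i j. i < 4 \<and> j < 4 \<and> i \<noteq> j}"

definition K23_V :: "nat set" where "K23_V = {0..<5}"
definition K23_E :: "nat set set" where
  "K23_E = {{i, j} | i j. i < 2 \<and> 2 \<le> j \<and> j < 5}"

definition is_ray :: "'a set set \<Rightarrow> (nat \<Rightarrow> 'a) \<Rightarrow> bool" where
  "is_ray E r \<longleftrightarrow> inj r \<and> (\<forall>n. {r n, r (Suc n)} \<in> E)"

definition ray_equiv :: "'a set \<Rightarrow> 'a set set \<Rightarrow> (nat \<Rightarrow> 'a) \<Rightarrow> (nat \<Rightarrow> 'a) \<Rightarrow> bool" where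
  "ray_equiv V E r1 r2 \<longleftrightarrow> (\<forall>S. finite S \<longrightarrow>
     (\<exists>n. \<forall>k\<ge>n. r1 k \<notin> S \<and> r2 k \<notin> S \<and> reach E (V - S) (r1 k) (r2 k)))"

definition ends :: "'a set \<Rightarrow> 'a set set \<Rightarrow> (nat \<Rightarrow> 'a) set set" where
  "ends V E = {{r'. is_ray E r' \<and> ray_equiv V E r r'} | r. is_ray E r}"

definition end_comp :: "'a set \<Rightarrow> 'a set set \<Rightarrow> 'a set \<Rightarrow> (nat \<Rightarrow> 'a) set \<Rightarrow> 'a set" where
  "end_comp V E S \<omega> = {v. \<exists>r\<in>\<omega>. \<exists>n. (\<forall>k\<ge>n. r k \<notin> S) \<and> reach E (V - S) (r n) v}"

text \<open>Points of |G|: vertices, inner points of edges and ends. An inner point of the edge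
e is represented by its barycentric coordinates: a function p that is positive exactly on e,
zero elsewhere, with values summing to 1.\<close>

datatype 'a point = Vtx 'a | Inn "'a \<Rightarrow> real" | End "(nat \<Rightarrow> 'a) set"

definition inner_pts :: "'a set \<Rightarrow> ('a \<Rightarrow> real) set" where
  "inner_pts e = {p. (\<forall>x. x \<in> e \<longleftrightarrow> p x > 0) \<and> (\<forall>x. x \<notin> e \<longrightarrow> p x = 0) \<and> sum p e = 1}"

definition edge_intervals :: "'a set set \<Rightarrow> 'a point set set" where
  "edge_intervals E = {{Inn p | p. p \<in> inner_pts e \<and> a < p u \<and> p u < b} | e u a b. e \<in> E \<and> u \<in> e}"

definition vertex_stars :: "'a set \<Rightarrow> 'a set set \<Rightarrow> 'a point set set" where
  "vertex_stars V E = {insert (Vtx v) {Inn p | p e. e \<in> E \<and> v \<in> e \<and> p \<in> inner_pts e \<and> p v > 1 - \<epsilon>}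
                        | v \<epsilon>. v \<in> V \<and> \<epsilon> > (0::real)}"

text \<open>Basic open neighbourhoods of ends: the component C of G - S containing the end,
together with the ends living in C and the inner points of all edges of C and of all
edges between S and C (i.e. all edges meeting C).\<close>

definition end_nbhd :: "'a set \<Rightarrow> 'a set set \<Rightarrow> 'a set \<Rightarrow> (nat \<Rightarrow> 'a) set \<Rightarrow> 'a point set" where
  "end_nbhd V E S \<omega> =
     (let C = end_comp V E S \<omega> in
       Vtx ` C \<union> {Inn p | p e. e \<in> E \<and> e \<inter> C \<noteq> {} \<and> p \<in> inner_pts e}
       \<union> End ` {\<omega>' \<in> ends V E. end_comp V E S \<omega>' = C})"

definition end_nbhds :: "'a set \<Rightarrow> 'a set set \<Rightarrow> 'a point set set" where
  "end_nbhds V E = {end_nbhd V E S \<omega> | S \<omega>. finite S \<and> S \<subseteq> V \<and> \<omega> \<in> ends V E}"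

definition freudenthal :: "'a set \<Rightarrow> 'a set set \<Rightarrow> 'a point topology" where
  "freudenthal V E = topology_generated_by (edge_intervals E \<union> vertex_stars V E \<union> end_nbhds V E)"

definition is_circle :: "'b topology \<Rightarrow> 'b set \<Rightarrow> bool" where
  "is_circle X C \<longleftrightarrow> C \<subseteq> topspace X \<and>
     top_of_set (sphere (0::complex) 1) homeomorphic_space subtopology X C"

definition hamilton_circle :: "'a set \<Rightarrow> 'a set set \<Rightarrow> 'a point set \<Rightarrow> bool" where
  "hamilton_circle V E C \<longleftrightarrow> is_circle (freudenthal V E) C \<and> Vtx ` V \<subseteq> C"

end

theory Submission
  imports Defs
begin

text \<open>
  From (i) to (ii): an edge \<open>uv\<close> splits the graph into at most two sides. A side attached at two vertices
  \<open>a\<close>, \<open>b\<close> contains no two disjoint connected sets that both see \<open>a\<close> and \<open>b\<close> (together with the rest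
  of the graph they would give a \<open>K\<^bsub>2,3\<^esub>\<close> minor, or a \<open>K\<^sup>4\<close> minor at the very first step), so by Menger's
  theorem it has a cut vertex \<open>w\<close>, which splits it into a side at \<open>a\<close>, \<open>w\<close> and a side at \<open>w\<close>, \<open>b\<close>.
  Halving arcs of the unit circle along this binary tree places all vertices on the circle. By local
  finiteness both attachment vertices change infinitely often along every infinite branch, so the branches
  correspond to the ends and their arcs shrink to the ends' positions. Every edge joins the two attachment
  vertices of some side; it is drawn as an arc of the circle if that side is empty and as a chord otherwise.
  This gives a continuous injection of the compact space \<open>|G|\<close> into the disk. A Hamilton circle cannot
  use a chord \<open>ab\<close>, since its two vertices separate the graph; hence it is the boundary circle.

  From (ii) to (i): a circle minus a point is connected, which gives 2-connectedness. In the disk, two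
  disjoint connected subgraphs cannot contain interlacing pairs of boundary points (the Fashoda theorem
  after a Cayley transformation), whereas every cyclic arrangement of the branch sets of \<open>K\<^sup>4\<close> or
  \<open>K\<^bsub>2,3\<^esub>\<close> produces such pairs.
\<close>

section \<open>Connectivity and Menger's theorem for two paths\<close>

text \<open>The same tree serves three purposes. It orders the vertices cyclically. It yields
  compactness: a piece of \<open>|G|\<close> without finite subcover would be handed down an
  infinite branch to an end, and every neighbourhood of that end contains a late piece of the
  branch. It makes continuity at ends quantitative, since the arc of an unfinished side at depth n
  has length \<open>pi / 2 ^ n\<close>. Compactness is what turns the continuous injection into an
  embedding, the disk being Hausdorff. Sides may be infinite and only branch sets matter, so
  Menger's theorem is phrased with disjoint connected sets in place of paths. The root is an edge
  because no third route outside the first side need exist there, and the edge takes its place.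
  Excluding chords only puts a Hamilton circle inside the boundary circle; equality comes from the
  fact that no circle embeds in a proper part of itself. Conversely, a crossing argument in the
  half-plane needs a boundary point off both paths as the pole of the Cayley map, so the cyclic
  order has to be cut open at a place not known in advance.\<close>

lemma reach_refl [simp]: "reach E W x x"
  by (simp add: reach_def)

lemma reach_trans [trans]: "reach E W x y \<Longrightarrow> reach E W y z \<Longrightarrow> reach E W x z"
  unfolding reach_def by (rule rtranclp_trans)

lemma reach_edge: "x \<in> W \<Longrightarrow> y \<in> W \<Longrightarrow> {x, y} \<in> E \<Longrightarrow> reach E W x y"
  unfolding reach_def by (rule r_into_rtranclp) auto

lemma reach_sym: "reach E W x y \<Longrightarrow> reach E W y x"
  unfolding reach_def
proof (induction rule: rtranclp_induct)
  case (step y z)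
  then have "{z, y} \<in> E" by (simp add: insert_commute)
  with step show ?case by (intro converse_rtranclp_into_rtranclp[of _ z y x]) auto
qed simp

lemma reach_mono: "reach E W x y \<Longrightarrow> W \<subseteq> W' \<Longrightarrow> reach E W' x y"
  unfolding reach_def by (erule rtranclp_mono[THEN predicate2D, rotated]) auto

lemma reach_induct [consumes 1, case_names refl step]:
  assumes "reach E W x y" "P x"
    "\<And>y z. reach E W x y \<Longrightarrow> y \<in> W \<Longrightarrow> z \<in> W \<Longrightarrow> {y, z} \<in> E \<Longrightarrow> P y \<Longrightarrow> P z"
  shows "P y"
  using assms(1) unfolding reach_def
proof (induction rule: rtranclp_induct)
  case base show ?case by (rule assms(2))
next
  case (step y z) then show ?case using assms(3)[of y z] by (auto simp: reach_def)
qed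

lemma reach_in: "reach E W x y \<Longrightarrow> x \<in> W \<Longrightarrow> y \<in> W"
  by (induction rule: reach_induct) auto

text \<open>Along a walk either no exit from \<open>A\<close> has occurred yet or one has been
  recorded. The initial segment inside \<open>A\<close> is returned with the exit edge, so that
  separators can be recognised from the places where walks leave a side.\<close>

lemma reach_exit:
  assumes "reach E W x y" "x \<in> A" "y \<notin> A"
  shows "\<exists>p\<in>A \<inter> W. \<exists>q\<in>W - A. {p, q} \<in> E \<and> reach E (A \<inter> W) x p"
proof -
  have "(y \<in> A \<and> reach E (A \<inter> W) x y) \<or> (\<exists>p\<in>A \<inter> W. \<exists>q\<in>W - A. {p, q} \<in> E \<and> reach E (A \<inter> W) x p)"
    using assms(1)
  proof (induction rule: reach_induct)
    case refl then show ?case using assms(2) by simp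
  next
    case (step y z)
    show ?case
    proof (cases "y \<in> A \<and> reach E (A \<inter> W) x y \<and> z \<in> A")
      case True
      then have "reach E (A \<inter> W) y z" using step by (intro reach_edge) auto
      then show ?thesis using True by (blast intro: reach_trans)
    next
      case False
      then show ?thesis using step by blast
    qed
  qed
  with assms(3) show ?thesis by blast
qed

lemma reach_closed:
  assumes "reach E W x y" "x \<in> A" "\<And>p q. p \<in> A \<Longrightarrow> p \<in> W \<Longrightarrow> q \<in> W \<Longrightarrow> {p, q} \<in> E \<Longrightarrow> q \<in> A"
  shows "y \<in> A"
  using reach_exit[OF assms(1,2)] assms(3) by blast

lemma connected_onI:
  assumes "a \<in> W" "\<And>x. x \<in> W \<Longrightarrow> reach E W a x"
  shows "connected_on E W"
  using assms unfolding connected_on_def by (blast intro: reach_trans reach_sym)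

lemma connected_on_reach: "connected_on E W \<Longrightarrow> x \<in> W \<Longrightarrow> y \<in> W \<Longrightarrow> reach E W x y"
  by (simp add: connected_on_def)

lemma connected_on_singleton [simp]: "connected_on E {x}"
  by (simp add: connected_on_def)

lemma connected_on_Un:
  assumes "connected_on E A" "connected_on E B" "A \<inter> B \<noteq> {}"
  shows "connected_on E (A \<union> B)"
proof -
  obtain c where c: "c \<in> A" "c \<in> B" using assms by blast
  show ?thesis
  proof (rule connected_onI[of c])
    fix x assume "x \<in> A \<union> B"
    then show "reach E (A \<union> B) c x"
      using c assms by (auto intro: reach_mono connected_on_reach)
  qed (use c in auto)
qed

lemma connected_on_edge: "{p, q} \<in> E \<Longrightarrow> connected_on E {p, q}"
  by (rule connected_onI[of p]) (auto intro: reach_edge)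

lemma connected_on_Un_edge:
  assumes "connected_on E A" "connected_on E B" "p \<in> A" "q \<in> B" "{p, q} \<in> E"
  shows "connected_on E (A \<union> B)"
proof -
  have "connected_on E ((A \<union> {p, q}) \<union> B)"
    using assms by (intro connected_on_Un connected_on_edge) auto
  moreover have "(A \<union> {p, q}) \<union> B = A \<union> B" using assms by auto
  ultimately show ?thesis by simp
qed

lemma connected_on_component: "x \<in> W \<Longrightarrow> connected_on E {y. reach E W x y}"
proof (rule connected_onI[of x])
  fix y assume "y \<in> {y. reach E W x y}"
  then have "reach E W x y" by simp
  then show "reach E {y. reach E W x y} x y"
  proof (induction rule: reach_induct)
    case (step y z)
    then have "reach E W x z" by (blast intro: reach_trans reach_edge)
    then have "reach E {y. reach E W x y} y z" using step by (intro reach_edge) auto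
    with step show ?case by (blast intro: reach_trans)
  qed simp
qed simp

text \<open>The vertices of one walk suffice. This makes finite arguments available in infinite
  sides.\<close>

lemma reach_finite_support:
  assumes "reach E W x y" "x \<in> W"
  shows "\<exists>F. finite F \<and> F \<subseteq> W \<and> connected_on E F \<and> x \<in> F \<and> y \<in> F"
  using assms(1)
proof (induction rule: reach_induct)
  case refl then show ?case using assms(2) by (intro exI[of _ "{x}"]) auto
next
  case (step y z)
  then obtain F where F: "finite F" "F \<subseteq> W" "connected_on E F" "x \<in> F" "y \<in> F" by blast
  then have "connected_on E (F \<union> {z})" using step by (intro connected_on_Un_edge[of E F "{z}" y z]) auto
  then show ?case using F step by (intro exI[of _ "F \<union> {z}"]) auto
qed

text \<open>Two disjoint \<open>A\<close>-\<open>B\<close> paths, coarsened to connected sets, since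
  these serve directly as branch sets of minors. A single vertex of \<open>A \<inter> B\<close>
  counts as such a path.\<close>

definition linked :: "'a set set \<Rightarrow> 'a set \<Rightarrow> 'a set \<Rightarrow> 'a set \<Rightarrow> bool" where
  "linked E W A B \<longleftrightarrow> (\<exists>P Q. P \<subseteq> W \<and> Q \<subseteq> W \<and> P \<inter> Q = {} \<and> connected_on E P \<and> connected_on E Q \<and>
     P \<inter> A \<noteq> {} \<and> P \<inter> B \<noteq> {} \<and> Q \<inter> A \<noteq> {} \<and> Q \<inter> B \<noteq> {})"

lemma linkedI:
  assumes "P \<subseteq> W" "Q \<subseteq> W" "P \<inter> Q = {}" "connected_on E P" "connected_on E Q"
    "P \<inter> A \<noteq> {}" "P \<inter> B \<noteq> {}" "Q \<inter> A \<noteq> {}" "Q \<inter> B \<noteq> {}"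
  shows "linked E W A B"
  unfolding linked_def using assms by iprover

lemma linked_mono: "linked E W A B \<Longrightarrow> W \<subseteq> W' \<Longrightarrow> A \<subseteq> A' \<Longrightarrow> B \<subseteq> B' \<Longrightarrow> linked E W' A' B'"
proof -
  assume "linked E W A B" and s: "W \<subseteq> W'" "A \<subseteq> A'" "B \<subseteq> B'"
  then obtain P Q where PQ: "P \<subseteq> W" "Q \<subseteq> W" "P \<inter> Q = {}" "connected_on E P" "connected_on E Q"
    "P \<inter> A \<noteq> {}" "P \<inter> B \<noteq> {}" "Q \<inter> A \<noteq> {}" "Q \<inter> B \<noteq> {}" unfolding linked_def by (elim exE conjE)
  moreover have "P \<subseteq> W'" "Q \<subseteq> W'" using PQ(1,2) s(1) by auto
  moreover have "P \<inter> A' \<noteq> {}" "P \<inter> B' \<noteq> {}" using PQ(6,7) s(2,3) by auto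
  moreover have "Q \<inter> A' \<noteq> {}" "Q \<inter> B' \<noteq> {}" using PQ(8,9) s(2,3) by auto
  ultimately show ?thesis by (intro linkedI[of P W' Q])
qed

text \<open>The negation of \<open>w\<close> separating \<open>A\<close> from \<open>B\<close>, put
  positively so that it hands over the connecting walk.\<close>

definition not_cut :: "'a set set \<Rightarrow> 'a set \<Rightarrow> 'a set \<Rightarrow> 'a set \<Rightarrow> 'a \<Rightarrow> bool" where
  "not_cut E W A B w \<longleftrightarrow> (\<exists>a\<in>A - {w}. \<exists>b\<in>B - {w}. reach E (W - {w}) a b)"

lemma not_cut_sym: "not_cut E W A B w \<Longrightarrow> not_cut E W B A w"
  unfolding not_cut_def by (blast intro: reach_sym)

text \<open>The pair \<open>w\<close>, \<open>z\<close> separates \<open>A\<close> from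
  \<open>B\<close>. On the side of \<open>A\<close> a smaller instance asks for two links from
  \<open>A\<close> to \<open>{w, z}\<close>. A cut vertex there would also cut \<open>A\<close> from
  \<open>B\<close> in \<open>W\<close>, because every walk to \<open>B\<close> leaves that side
  through \<open>w\<close> or \<open>z\<close>. One link must then end in \<open>w\<close> and the
  other in \<open>z\<close>.\<close>

lemma menger2_side:
  assumes IH: "\<forall>W' A' B'. W' \<subset> W \<longrightarrow> A' \<subseteq> W' \<longrightarrow> B' \<subseteq> W' \<longrightarrow> W' \<noteq> {} \<longrightarrow>
      (\<forall>w\<in>W'. not_cut E W' A' B' w) \<longrightarrow> linked E W' A' B'"
    and AB: "A \<subseteq> W" "B \<subseteq> W" and nc: "\<forall>w\<in>W. not_cut E W A B w"
    and z: "z \<in> W" "z \<notin> A" "z \<notin> B" and w: "w \<in> W" "w \<noteq> z" "\<not> not_cut E (W - {z}) A B w"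
  shows "\<exists>P Q. P \<subseteq> {x. \<exists>a\<in>A - {w}. reach E (W - {w, z}) a x} \<union> {w, z} \<and>
      Q \<subseteq> {x. \<exists>a\<in>A - {w}. reach E (W - {w, z}) a x} \<union> {w, z} \<and> P \<inter> Q = {} \<and>
      connected_on E P \<and> connected_on E Q \<and> P \<inter> A \<noteq> {} \<and> Q \<inter> A \<noteq> {} \<and> w \<in> P \<and> z \<in> Q"
proof -
  define S where "S = {x. \<exists>a\<in>A - {w}. reach E (W - {w, z}) a x}"
  have eq: "W - {z} - {w} = W - {w, z}" by auto
  have SW: "S \<subseteq> W - {w, z}"
  proof
    fix x assume "x \<in> S"
    then obtain a where a: "a \<in> A - {w}" "reach E (W - {w, z}) a x" unfolding S_def by blast
    then show "x \<in> W - {w, z}" using reach_in[OF a(2)] a(1) AB z by auto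
  qed
  have AS: "A - {w} \<subseteq> S" unfolding S_def using reach_refl by fast
  have BS: "B \<inter> S = {}"
  proof (rule ccontr)
    assume "B \<inter> S \<noteq> {}"
    then obtain b a where "b \<in> B" "b \<in> S" "a \<in> A - {w}" "reach E (W - {w, z}) a b"
      unfolding S_def by blast
    then have "not_cut E (W - {z}) A B w" unfolding not_cut_def eq using SW by blast
    with w show False by blast
  qed
  have "linked E (S \<union> {w, z}) (A \<inter> (S \<union> {w,z})) {w, z}"
  proof (rule IH[THEN spec, THEN spec, THEN spec, THEN mp, THEN mp, THEN mp, THEN mp, THEN mp])
    \<comment> \<open>This vertex of \<open>B\<close> is missing from
      \<open>S \<union> {w, z}\<close>, so the induction hypothesis is applied to a proper
      subset.\<close>
    obtain b where "b \<in> B - {w}" using nc w unfolding not_cut_def by blast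
    then show "S \<union> {w, z} \<subset> W" using BS SW w z AB by blast
    show "\<forall>x\<in>S \<union> {w, z}. not_cut E (S \<union> {w, z}) (A \<inter> (S \<union> {w, z})) {w, z} x"
    proof
      fix x assume x: "x \<in> S \<union> {w, z}"
      then have "x \<in> W" using SW w z by auto
      then obtain a b where ab: "a \<in> A - {x}" "b \<in> B - {x}" "reach E (W - {x}) a b"
        using nc unfolding not_cut_def by blast
      show "not_cut E (S \<union> {w, z}) (A \<inter> (S \<union> {w, z})) {w, z} x"
      proof (cases "a = w")
        case True then show ?thesis using ab unfolding not_cut_def by (auto intro!: bexI[of _ a])
      next
        case False
        then have aS: "a \<in> S" using AS ab by auto
        then obtain p q where pq: "p \<in> S \<inter> (W - {x})" "q \<in> (W - {x}) - S" "{p, q} \<in> E"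
          "reach E (S \<inter> (W - {x})) a p" using reach_exit[OF ab(3), of S] BS ab by blast
        \<comment> \<open>Any other exit vertex would still be reached from \<open>A\<close> in
          \<open>W - {w, z}\<close> and hence belong to \<open>S\<close>.\<close>
        have q: "q \<in> {w, z}"
        proof (rule ccontr)
          assume n: "q \<notin> {w, z}"
          obtain a' where a': "a' \<in> A - {w}" "reach E (W - {w, z}) a' p" using pq unfolding S_def by blast
          have "reach E (W - {w, z}) p q" using pq n SW by (intro reach_edge) auto
          with a' have "q \<in> S" unfolding S_def by (blast intro: reach_trans)
          with pq show False by blast
        qed
        have "reach E (S \<union> {w, z} - {x}) a p" using pq(4) by (rule reach_mono) auto
        moreover have "reach E (S \<union> {w, z} - {x}) p q" using pq q by (intro reach_edge) auto
        ultimately have "reach E (S \<union> {w, z} - {x}) a q" by (rule reach_trans)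
        then show ?thesis unfolding not_cut_def using ab aS q pq by blast
      qed
    qed
  qed auto
  then obtain P Q where PQ: "P \<subseteq> S \<union> {w, z}" "Q \<subseteq> S \<union> {w, z}" "P \<inter> Q = {}"
    "connected_on E P" "connected_on E Q" "P \<inter> A \<noteq> {}" "P \<inter> {w, z} \<noteq> {}"
    "Q \<inter> A \<noteq> {}" "Q \<inter> {w, z} \<noteq> {}" unfolding linked_def by blast
  show ?thesis
  proof (cases "w \<in> P")
    case True
    then have "z \<in> Q" using PQ by auto
    with True PQ show ?thesis unfolding S_def[symmetric] by blast
  next
    case False
    then have "z \<in> P" "w \<in> Q" using PQ by auto
    then show ?thesis unfolding S_def[symmetric] using PQ
      by (rule_tac exI[of _ Q], rule_tac exI[of _ P]) (auto simp: Int_commute)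
  qed
qed

text \<open>Induction on the vertex set. A vertex \<open>z\<close> outside
  \<open>A \<union> B\<close> is deleted if no cut vertex arises. If some \<open>w\<close> becomes
  one, \<open>{w, z}\<close> separates, and the links obtained on the two sides are glued at
  \<open>w\<close> and at \<open>z\<close>. Without such a \<open>z\<close>, single vertices of
  \<open>A \<inter> B\<close> and single edges suffice.\<close>

lemma menger2_finite:
  assumes "finite W" "A \<subseteq> W" "B \<subseteq> W" "W \<noteq> {}" "\<forall>w\<in>W. not_cut E W A B w"
  shows "linked E W A B"
  using assms
proof (induction W arbitrary: A B rule: finite_psubset_induct)
  case (psubset W A B)
  note nc = psubset.prems(4)
  have IH: "\<forall>W' A' B'. W' \<subset> W \<longrightarrow> A' \<subseteq> W' \<longrightarrow> B' \<subseteq> W' \<longrightarrow> W' \<noteq> {} \<longrightarrow>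
      (\<forall>w\<in>W'. not_cut E W' A' B' w) \<longrightarrow> linked E W' A' B'"
    using psubset.IH by blast
  show ?case
  proof (cases "\<exists>z\<in>W. z \<notin> A \<and> z \<notin> B")
    case True
    then obtain z where z: "z \<in> W" "z \<notin> A" "z \<notin> B" by blast
    show ?thesis
    proof (cases "\<forall>w\<in>W - {z}. not_cut E (W - {z}) A B w")
      case True
      have "A \<noteq> {}" using nc z unfolding not_cut_def by blast
      then have "linked E (W - {z}) A B" using z psubset.prems True by (intro psubset.IH) auto
      then show ?thesis by (rule linked_mono) auto
    next
      case False
      then obtain w where w: "w \<in> W" "w \<noteq> z" "\<not> not_cut E (W - {z}) A B w" by blast
      define SA where "SA = {x. \<exists>a\<in>A - {w}. reach E (W - {w, z}) a x}"
      define SB where "SB = {x. \<exists>a\<in>B - {w}. reach E (W - {w, z}) a x}"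
      obtain P Q where PQ: "P \<subseteq> SA \<union> {w, z}" "Q \<subseteq> SA \<union> {w, z}" "P \<inter> Q = {}"
        "connected_on E P" "connected_on E Q" "P \<inter> A \<noteq> {}" "Q \<inter> A \<noteq> {}" "w \<in> P" "z \<in> Q"
        using menger2_side[OF IH psubset.prems(1,2) nc z w]
        unfolding SA_def[symmetric] by (elim exE conjE)
      have w': "\<not> not_cut E (W - {z}) B A w" using w(3) not_cut_sym[of E _ B A w] by blast
      have nc': "\<forall>w\<in>W. not_cut E W B A w" using nc not_cut_sym[of E W A B] by blast
      obtain P' Q' where PQ': "P' \<subseteq> SB \<union> {w, z}" "Q' \<subseteq> SB \<union> {w, z}" "P' \<inter> Q' = {}"
        "connected_on E P'" "connected_on E Q'" "P' \<inter> B \<noteq> {}" "Q' \<inter> B \<noteq> {}" "w \<in> P'" "z \<in> Q'"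
        using menger2_side[OF IH psubset.prems(2,1) nc' z(1,3,2) w(1,2) w']
        unfolding SB_def[symmetric] by (elim exE conjE)
      have eq: "W - {z} - {w} = W - {w, z}" by auto
      have dis: "SA \<inter> SB = {}"
      proof (rule ccontr)
        assume "SA \<inter> SB \<noteq> {}"
        then obtain x a b where "a \<in> A - {w}" "b \<in> B - {w}" "reach E (W - {w, z}) a x" "reach E (W - {w, z}) b x"
          unfolding SA_def SB_def by blast
        then have "not_cut E (W - {z}) A B w" unfolding not_cut_def eq by (blast intro: reach_trans reach_sym)
        with w show False by blast
      qed
      have SAW: "SA \<subseteq> W - {w, z}" "SB \<subseteq> W - {w, z}"
      proof -
        show "SA \<subseteq> W - {w, z}"
        proof
          fix x assume "x \<in> SA"
          then obtain a where a: "a \<in> A - {w}" "reach E (W - {w, z}) a x" unfolding SA_def by blast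
          then show "x \<in> W - {w, z}" using reach_in[OF a(2)] a(1) psubset.prems z by auto
        qed
        show "SB \<subseteq> W - {w, z}"
        proof
          fix x assume "x \<in> SB"
          then obtain a where a: "a \<in> B - {w}" "reach E (W - {w, z}) a x" unfolding SB_def by blast
          then show "x \<in> W - {w, z}" using reach_in[OF a(2)] a(1) psubset.prems z by auto
        qed
      qed
      show ?thesis
      proof (rule linkedI)
        show "connected_on E (P \<union> P')" using PQ(4,8) PQ'(4,8) by (intro connected_on_Un) auto
        show "connected_on E (Q \<union> Q')" using PQ(5,9) PQ'(5,9) by (intro connected_on_Un) auto
        show "P \<union> P' \<subseteq> W" using PQ(1) PQ'(1) SAW w(1) z(1) by auto
        show "Q \<union> Q' \<subseteq> W" using PQ(2) PQ'(2) SAW w(1) z(1) by auto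
        have nP: "z \<notin> P" "w \<notin> Q" "z \<notin> P'" "w \<notin> Q'" using PQ(3,8,9) PQ'(3,8,9) by auto
        have "P \<subseteq> insert w SA" "Q' \<subseteq> insert z SB" using PQ(1) PQ'(2) nP by auto
        then have "P \<inter> Q' = {}" using dis SAW w(2) by fast
        moreover have "P' \<subseteq> insert w SB" "Q \<subseteq> insert z SA" using PQ(2) PQ'(1) nP by auto
        then have "P' \<inter> Q = {}" using dis SAW w(2) by fast
        ultimately show "(P \<union> P') \<inter> (Q \<union> Q') = {}" using PQ(3) PQ'(3) by auto
      qed (use PQ(6,7) PQ'(6,7) in auto)
    qed
  next
    case False
    then have W: "W = A \<union> B" using psubset.prems by auto
    \<comment> \<open>Since \<open>W = A \<union> B\<close>, the first vertex outside
      \<open>A\<close> on a walk from \<open>A\<close> to \<open>B\<close> already lies in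
      \<open>B\<close>.\<close>
    have edge: "\<exists>p\<in>A - {w}. \<exists>q\<in>B - {w}. {p, q} \<in> E" if wW: "w \<in> W" and sub: "A \<inter> B \<subseteq> {w}" for w
    proof -
      obtain a b where ab: "a \<in> A - {w}" "b \<in> B - {w}" "reach E (W - {w}) a b"
        using nc[rule_format, OF wW] unfolding not_cut_def by blast
      moreover have "b \<notin> A" using ab(2) sub by blast
      ultimately show ?thesis using reach_exit[OF ab(3), of A] W by fast
    qed
    have pair: "linked E W A B" if "P \<subseteq> W" "Q \<subseteq> W" "P \<inter> Q = {}" "connected_on E P" "connected_on E Q"
       "P \<inter> A \<noteq> {}" "P \<inter> B \<noteq> {}" "Q \<inter> A \<noteq> {}" "Q \<inter> B \<noteq> {}" for P Q
      using that by (rule linkedI)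
    have match: "linked E W A B" if "p \<in> A" "q \<in> B" "p' \<in> A" "q' \<in> B" "{p, q} \<in> E" "{p', q'} \<in> E"
      "p \<noteq> p'" "q \<noteq> q'" "p \<noteq> q'" "q \<noteq> p'" for p q p' q'
      using that W by (intro pair[of "{p,q}" "{p',q'}"] connected_on_edge) auto
    show ?thesis
    proof (cases "A \<inter> B = {}")
      case True
      \<comment> \<open>Of an edge \<open>xy\<close>, an edge missing \<open>x\<close> and an edge
        missing \<open>y\<close>, some two are disjoint.\<close>
      obtain w0 where "w0 \<in> W" using psubset.prems by blast
      then obtain x y where xy: "x \<in> A" "y \<in> B" "{x, y} \<in> E" using edge True by blast
      obtain p q where pq: "p \<in> A - {x}" "q \<in> B - {x}" "{p, q} \<in> E" using edge[of x] True xy W by blast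
      obtain p' q' where pq': "p' \<in> A - {y}" "q' \<in> B - {y}" "{p', q'} \<in> E" using edge[of y] True xy W by blast
      show ?thesis
      proof (cases "q = y")
        case False then show ?thesis using match[of x y p q] xy pq True by blast
      next
        case q: True
        show ?thesis
        proof (cases "p' = x")
          case False then show ?thesis using match[of x y p' q'] xy pq' True by blast
        next
          case True then show ?thesis using match[of x q' p y] xy pq pq' q \<open>A \<inter> B = {}\<close> by blast
        qed
      qed
    next
      case False
      then obtain c where c: "c \<in> A" "c \<in> B" by blast
      show ?thesis
      proof (cases "A \<inter> B \<subseteq> {c}")
        case True
        then obtain p q where "p \<in> A - {c}" "q \<in> B - {c}" "{p, q} \<in> E" using edge[of c] c W by blast
        then show ?thesis using c W by (intro pair[of "{c}" "{p, q}"] connected_on_edge) auto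
      next
        case False
        then obtain d where "d \<in> A" "d \<in> B" "d \<noteq> c" by blast
        then show ?thesis using c W by (intro pair[of "{c}" "{d}"]) auto
      qed
    qed
  qed
qed

text \<open>Reduction to a finite subset: take a finite link \<open>F w0\<close> avoiding some
  \<open>w0\<close> and, for each of its vertices \<open>w\<close>, a finite link avoiding
  \<open>w\<close>. In the union every vertex is missed by one of these links, so none is a cut
  vertex.\<close>

lemma menger2:
  assumes "A \<subseteq> W" "B \<subseteq> W" "W \<noteq> {}" "\<forall>w\<in>W. not_cut E W A B w"
  shows "linked E W A B"
proof -
  have *: "\<exists>F. finite F \<and> F \<subseteq> W - {w} \<and> connected_on E F \<and> F \<inter> A \<noteq> {} \<and> F \<inter> B \<noteq> {}" if w: "w \<in> W" for w
  proof -
    obtain a b where ab: "a \<in> A - {w}" "b \<in> B - {w}" "reach E (W - {w}) a b"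
      using assms w unfolding not_cut_def by blast
    then obtain F where "finite F" "F \<subseteq> W - {w}" "connected_on E F" "a \<in> F" "b \<in> F"
      using reach_finite_support[OF ab(3)] assms(1) by blast
    then show ?thesis using ab by (intro exI[of _ F]) auto
  qed
  then obtain F where F: "\<And>w. w \<in> W \<Longrightarrow> finite (F w) \<and> F w \<subseteq> W - {w} \<and> connected_on E (F w) \<and> F w \<inter> A \<noteq> {} \<and> F w \<inter> B \<noteq> {}"
    by metis
  obtain w0 where w0: "w0 \<in> W" using assms by blast
  define W' where "W' = F w0 \<union> (\<Union>w\<in>F w0. F w)"
  have sub: "w \<in> W" if "w \<in> F w0" for w using F[OF w0] that by blast
  have fin: "finite W'" "W' \<subseteq> W" using F[OF w0] F sub unfolding W'_def by blast+
  have nc: "not_cut E W' (A \<inter> W') (B \<inter> W') w" if "w \<in> W'" for w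
  proof -
    have "\<exists>K. K \<subseteq> W' - {w} \<and> connected_on E K \<and> K \<inter> A \<noteq> {} \<and> K \<inter> B \<noteq> {}"
    proof (cases "w \<in> F w0")
      case True
      then show ?thesis using F[OF sub[OF True]] unfolding W'_def by (intro exI[of _ "F w"]) blast
    next
      case False
      then show ?thesis using F[OF w0] unfolding W'_def by (intro exI[of _ "F w0"]) blast
    qed
    then obtain K a b where K: "K \<subseteq> W' - {w}" "connected_on E K" "a \<in> K" "a \<in> A" "b \<in> K" "b \<in> B" by blast
    have "reach E (W' - {w}) a b" using K by (auto intro: reach_mono connected_on_reach)
    then show ?thesis unfolding not_cut_def using K by blast
  qed
  have "linked E W' (A \<inter> W') (B \<inter> W')"
    using nc fin F[OF w0] by (intro menger2_finite) (auto simp: W'_def)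
  then show ?thesis using fin(2) by (rule linked_mono) auto
qed

section \<open>Splitting sides at cut vertices\<close>

definition nb :: "'a set set \<Rightarrow> 'a \<Rightarrow> 'a set" where
  "nb E x = {y. {x, y} \<in> E}"

lemma nb_sym: "y \<in> nb E x \<longleftrightarrow> x \<in> nb E y"
  by (simp add: nb_def insert_commute)

lemma K23_minorI:
  assumes ab: "a \<in> V" "b \<in> V" "a \<noteq> b" and sub: "P \<subseteq> V - {a, b}" "Q \<subseteq> V - {a, b}" "R \<subseteq> V - {a, b}"
    and dis: "P \<inter> Q = {}" "P \<inter> R = {}" "Q \<inter> R = {}"
    and con: "connected_on E P" "connected_on E Q" "connected_on E R"
    and nbs: "P \<inter> nb E a \<noteq> {}" "P \<inter> nb E b \<noteq> {}" "Q \<inter> nb E a \<noteq> {}" "Q \<inter> nb E b \<noteq> {}"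
      "R \<inter> nb E a \<noteq> {}" "R \<inter> nb E b \<noteq> {}"
  shows "has_minor V E K23_V K23_E"
proof -
  have KV: "K23_V = {0, 1, 2, 3, 4}" by (auto simp: K23_V_def)
  have KE: "{x, y} \<in> K23_E \<longleftrightarrow> (x < 2 \<and> 2 \<le> y \<and> y < 5) \<or> (y < 2 \<and> 2 \<le> x \<and> x < 5)" for x y
    by (auto simp: K23_E_def doubleton_eq_iff)
  have nbs': "\<exists>u\<in>P. {a, u} \<in> E" "\<exists>u\<in>P. {b, u} \<in> E" "\<exists>u\<in>Q. {a, u} \<in> E" "\<exists>u\<in>Q. {b, u} \<in> E"
    "\<exists>u\<in>R. {a, u} \<in> E" "\<exists>u\<in>R. {b, u} \<in> E" using nbs by (auto simp: nb_def)
  have nbs'': "\<exists>u\<in>P. {u, a} \<in> E" "\<exists>u\<in>P. {u, b} \<in> E" "\<exists>u\<in>Q. {u, a} \<in> E" "\<exists>u\<in>Q. {u, b} \<in> E"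
    "\<exists>u\<in>R. {u, a} \<in> E" "\<exists>u\<in>R. {u, b} \<in> E" using nbs' by (simp_all add: insert_commute)
  have na: "a \<notin> P" "a \<notin> Q" "a \<notin> R" "b \<notin> P" "b \<notin> Q" "b \<notin> R" using sub by auto
  have subV: "P \<subseteq> V" "Q \<subseteq> V" "R \<subseteq> V" using sub by auto
  define B where "B = (\<lambda>i::nat. if i = 0 then {a} else if i = 1 then {b} else if i = 2 then P else if i = 3 then Q else R)"
  have B: "B 0 = {a}" "B 1 = {b}" "B 2 = P" "B 3 = Q" "B 4 = R" by (auto simp: B_def)
  show ?thesis unfolding has_minor_def
  proof (intro exI[of _ B] conjI)
    show "\<forall>x\<in>K23_V. B x \<subseteq> V \<and> connected_on E (B x)"
      unfolding KV using B ab con subV by auto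
    show "\<forall>x\<in>K23_V. \<forall>y\<in>K23_V. x \<noteq> y \<longrightarrow> B x \<inter> B y = {}"
      unfolding KV using B ab na dis by (simp add: Int_commute)
    show "\<forall>x\<in>K23_V. \<forall>y\<in>K23_V. {x, y} \<in> K23_E \<longrightarrow> (\<exists>u\<in>B x. \<exists>w\<in>B y. {u, w} \<in> E)"
      unfolding KV KE using B nbs' nbs'' by simp
  qed
qed

lemma K4_minorI:
  assumes ab: "a \<in> V" "b \<in> V" "a \<noteq> b" and sub: "P \<subseteq> V - {a, b}" "Q \<subseteq> V - {a, b}"
    and dis: "P \<inter> Q = {}" and con: "connected_on E P" "connected_on E Q"
    and nbs: "P \<inter> nb E a \<noteq> {}" "P \<inter> nb E b \<noteq> {}" "Q \<inter> nb E a \<noteq> {}" "Q \<inter> nb E b \<noteq> {}"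
    and ed: "{a, b} \<in> E" "\<exists>p\<in>P. \<exists>q\<in>Q. {p, q} \<in> E"
  shows "has_minor V E K4_V K4_E"
proof -
  have KV: "K4_V = {0, 1, 2, 3}" by (auto simp: K4_V_def)
  have nbs': "\<exists>u\<in>P. {a, u} \<in> E" "\<exists>u\<in>P. {b, u} \<in> E" "\<exists>u\<in>Q. {a, u} \<in> E" "\<exists>u\<in>Q. {b, u} \<in> E"
    using nbs by (auto simp: nb_def)
  have nbs'': "\<exists>u\<in>P. {u, a} \<in> E" "\<exists>u\<in>P. {u, b} \<in> E" "\<exists>u\<in>Q. {u, a} \<in> E" "\<exists>u\<in>Q. {u, b} \<in> E"
    using nbs' by (simp_all add: insert_commute)
  have ed': "{b, a} \<in> E" "\<exists>q\<in>Q. \<exists>p\<in>P. {q, p} \<in> E"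
    using ed by (metis insert_commute)+
  have na: "a \<notin> P" "a \<notin> Q" "b \<notin> P" "b \<notin> Q" using sub by auto
  have subV: "P \<subseteq> V" "Q \<subseteq> V" using sub by auto
  have KE: "{x, x} \<notin> K4_E" for x by (auto simp: K4_E_def doubleton_eq_iff)
  then have KE': "{x} \<notin> K4_E" for x by simp
  define B where "B = (\<lambda>i::nat. if i = 0 then {a} else if i = 1 then {b} else if i = 2 then P else Q)"
  have B: "B 0 = {a}" "B 1 = {b}" "B 2 = P" "B 3 = Q" by (auto simp: B_def)
  show ?thesis unfolding has_minor_def
  proof (intro exI[of _ B] conjI)
    show "\<forall>x\<in>K4_V. B x \<subseteq> V \<and> connected_on E (B x)"
      unfolding KV using B ab con subV by auto
    show "\<forall>x\<in>K4_V. \<forall>y\<in>K4_V. x \<noteq> y \<longrightarrow> B x \<inter> B y = {}"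
      unfolding KV using B ab na dis by (simp add: Int_commute)
    show "\<forall>x\<in>K4_V. \<forall>y\<in>K4_V. {x, y} \<in> K4_E \<longrightarrow> (\<exists>u\<in>B x. \<exists>w\<in>B y. {u, w} \<in> E)"
      unfolding KV using B nbs' nbs'' ed ed' by (simp add: KE')
  qed
qed

locale sgraph =
  fixes V :: "'a set" and E :: "'a set set"
  assumes simple: "simple_graph V E"
begin

lemma edge_in: assumes "{x, y} \<in> E" shows "x \<in> V" "y \<in> V" "x \<noteq> y"
  using assms simple unfolding simple_graph_def by (force simp: card_insert_if split: if_splits)+

lemma edge_obtain:
  assumes "e \<in> E" obtains x y where "e = {x, y}" "x \<noteq> y" "x \<in> V" "y \<in> V"
proof -
  have "card e = 2" "e \<subseteq> V" using assms simple by (auto simp: simple_graph_def)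
  then show thesis using that by (auto simp: card_2_iff)
qed

lemma nb_subset: "nb E x \<subseteq> V"
  using edge_in by (auto simp: nb_def)

end

locale outerplanar = sgraph V E for V :: "'a set" and E :: "'a set set" +
  assumes loc_fin: "locally_finite V E"
    and two_con: "two_connected V E"
    and no_K4: "\<not> has_minor V E K4_V K4_E" and no_K23: "\<not> has_minor V E K23_V K23_E"
begin

lemma finite_nb: "x \<in> V \<Longrightarrow> finite (nb E x)"
proof -
  assume "x \<in> V"
  then have "finite {e \<in> E. x \<in> e}" using loc_fin by (simp add: locally_finite_def)
  moreover have "finite e" if "e \<in> E" for e
    using simple that by (intro card_ge_0_finite) (simp add: simple_graph_def)
  ultimately have "finite (\<Union>{e \<in> E. x \<in> e})" by (intro finite_Union) auto
  moreover have "nb E x \<subseteq> \<Union>{e \<in> E. x \<in> e}" by (auto simp: nb_def)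
  ultimately show ?thesis by (rule finite_subset[rotated])
qed

text \<open>\<open>W\<close> is a union of components of the graph without \<open>a\<close> and
  \<open>b\<close>. The empty union is allowed and later marks a finished side.\<close>

definition sep :: "'a \<Rightarrow> 'a \<Rightarrow> 'a set \<Rightarrow> bool" where
  "sep a b W \<longleftrightarrow> a \<in> V \<and> b \<in> V \<and> a \<noteq> b \<and> W \<subseteq> V - {a, b} \<and> (\<forall>x\<in>W. nb E x \<subseteq> W \<union> {a, b})"

lemma sep_sym: "sep a b W \<Longrightarrow> sep b a W"
  by (auto simp: sep_def)

text \<open>The graph without \<open>b\<close> is connected, so \<open>x\<close> is joined there to
  \<open>a\<close>; a walk avoiding \<open>b\<close> can leave \<open>W\<close> only to
  \<open>a\<close>.\<close>

lemma sep_attach: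
  assumes "sep a b W" "x \<in> W"
  shows "\<exists>p\<in>W \<inter> nb E a. reach E W x p"
proof -
  have "connected_on E (V - {b})" using two_con assms by (auto simp: two_connected_def sep_def)
  then have "reach E (V - {b}) x a" using assms by (auto simp: sep_def intro: connected_on_reach)
  then obtain p q where pq: "p \<in> W \<inter> (V - {b})" "q \<in> (V - {b}) - W" "{p, q} \<in> E" "reach E (W \<inter> (V - {b})) x p"
    using reach_exit[of E "V - {b}" x a W] assms by (auto simp: sep_def)
  have "q \<in> W \<union> {a, b}" using pq assms by (auto simp: sep_def nb_def)
  then have "q = a" using pq by auto
  moreover have "reach E W x p" using pq(4) by (rule reach_mono) auto
  ultimately show ?thesis using pq by (intro bexI[of _ p]) (auto simp: nb_def insert_commute)
qed

lemma sep_reach: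
  assumes "sep a b W" "x \<in> W"
  shows "reach E (W \<union> {a}) x a"
proof -
  obtain p where p: "p \<in> W \<inter> nb E a" "reach E W x p" using sep_attach[OF assms] by blast
  have "reach E (W \<union> {a}) p a" using p by (intro reach_edge) (auto simp: nb_def insert_commute)
  moreover have "reach E (W \<union> {a}) x p" using p(2) by (rule reach_mono) auto
  ultimately show ?thesis by (blast intro: reach_trans)
qed

lemma sep_connected: "sep a b W \<Longrightarrow> connected_on E (W \<union> {a})"
  by (rule connected_onI[of a]) (use sep_reach[of a b W] reach_sym[of E "W \<union> {a}" _ a] in auto)

text \<open>The last condition provides the third branch set of a \<open>K\<^bsub>2,3\<^esub>\<close> minor after the next split;
  the alternative \<open>{a, b} \<in> E\<close> is needed at the root, where the rest of the graph may be empty.\<close>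

definition half :: "'a \<Rightarrow> 'a \<Rightarrow> 'a set \<Rightarrow> bool" where
  "half a b W \<longleftrightarrow> sep a b W \<and> (W = {} \<longrightarrow> {a, b} \<in> E) \<and> \<not> linked E W (nb E a) (nb E b) \<and>
     ({a, b} \<in> E \<or> (\<exists>R. R \<subseteq> V - W - {a, b} \<and> connected_on E R \<and> R \<inter> nb E a \<noteq> {} \<and> R \<inter> nb E b \<noteq> {}))"

lemma linked_sym: "linked E W A B \<Longrightarrow> linked E W B A"
proof -
  assume "linked E W A B"
  then obtain P Q where PQ: "P \<subseteq> W" "Q \<subseteq> W" "P \<inter> Q = {}" "connected_on E P" "connected_on E Q"
    "P \<inter> A \<noteq> {}" "P \<inter> B \<noteq> {}" "Q \<inter> A \<noteq> {}" "Q \<inter> B \<noteq> {}" unfolding linked_def by (elim exE conjE)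
  show ?thesis by (rule linkedI[of P W Q]) (fact PQ)+
qed

lemma half_sym: "half a b W \<Longrightarrow> half b a W"
  unfolding half_def using sep_sym[of a b W] linked_sym[of W "nb E b" "nb E a"] by (auto simp: insert_commute)

lemma half_sep: "half a b W \<Longrightarrow> sep a b W"
  by (simp add: half_def)

text \<open>Two disjoint links inside \<open>W\<close> and the route \<open>R\<close> outside it are
  three independent connections between \<open>a\<close> and \<open>b\<close>.\<close>

lemma not_linked_of_third:
  assumes s: "sep a b W" and R: "R \<subseteq> V - W - {a, b}" "connected_on E R" "R \<inter> nb E a \<noteq> {}" "R \<inter> nb E b \<noteq> {}"
  shows "\<not> linked E W (nb E a) (nb E b)"
proof
  assume "linked E W (nb E a) (nb E b)"
  then obtain P Q where PQ: "P \<subseteq> W" "Q \<subseteq> W" "P \<inter> Q = {}" "connected_on E P" "connected_on E Q"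
    "P \<inter> nb E a \<noteq> {}" "P \<inter> nb E b \<noteq> {}" "Q \<inter> nb E a \<noteq> {}" "Q \<inter> nb E b \<noteq> {}" unfolding linked_def by (elim exE conjE)
  have "has_minor V E K23_V K23_E"
  proof (rule K23_minorI[of a V b P Q R])
    show "P \<subseteq> V - {a, b}" "Q \<subseteq> V - {a, b}" "R \<subseteq> V - {a, b}" "a \<in> V" "b \<in> V" "a \<noteq> b"
      using PQ(1,2) R(1) s by (auto simp: sep_def)
    show "P \<inter> R = {}" "Q \<inter> R = {}" using PQ(1,2) R(1) by auto
  qed (fact PQ R)+
  with no_K23 show False by blast
qed

text \<open>The new side needs a connected set outside it that sees \<open>a\<close> and
  \<open>w\<close>. It is \<open>W2\<close> with \<open>b\<close>, which sees \<open>w\<close>; it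
  sees \<open>a\<close> through the edge \<open>ab\<close> or, failing that, after adding the old
  outside route \<open>R\<close>.\<close>

lemma half_child:
  assumes h: "half a b W" and W: "W = insert w (W1 \<union> W2)" "w \<notin> W1" "w \<notin> W2" "W1 \<inter> W2 = {}"
    and s1: "sep a w W1" and s2: "sep w b W2"
    and e1: "W1 = {} \<Longrightarrow> {a, w} \<in> E" and e2: "W2 = {} \<Longrightarrow> {w, b} \<in> E"
  shows "half a w W1"
proof -
  have ab: "a \<in> V" "b \<in> V" "a \<noteq> b" "a \<notin> W" "b \<notin> W" "W \<subseteq> V" using h by (auto simp: half_def sep_def)
  have c2: "connected_on E (W2 \<union> {b})" using s2 sep_sym sep_connected by blast
  have wR: "(W2 \<union> {b}) \<inter> nb E w \<noteq> {}"
  proof (cases "W2 = {}")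
    case True then show ?thesis using e2 by (auto simp: nb_def)
  next
    case False then show ?thesis using sep_attach[OF s2] by blast
  qed
  have "\<exists>R. R \<subseteq> V - W1 - {a, w} \<and> connected_on E R \<and> R \<inter> nb E a \<noteq> {} \<and> R \<inter> nb E w \<noteq> {}"
  proof (cases "{a, b} \<in> E")
    case True
    then show ?thesis using c2 wR ab W by (intro exI[of _ "W2 \<union> {b}"]) (auto simp: nb_def)
  next
    case False
    then obtain R where R: "R \<subseteq> V - W - {a, b}" "connected_on E R" "R \<inter> nb E a \<noteq> {}" "R \<inter> nb E b \<noteq> {}"
      using h unfolding half_def by blast
    obtain r where r: "r \<in> R" "{b, r} \<in> E" using R by (auto simp: nb_def)
    have "connected_on E ((W2 \<union> {b}) \<union> R)"
      by (rule connected_on_Un_edge[OF c2 R(2) _ r]) auto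
    then show ?thesis using R ab W wR
      by (intro exI[of _ "(W2 \<union> {b}) \<union> R"] conjI) (assumption | blast)+
  qed
  then obtain R where R: "R \<subseteq> V - W1 - {a, w}" "connected_on E R" "R \<inter> nb E a \<noteq> {}" "R \<inter> nb E w \<noteq> {}"
    by blast
  show ?thesis unfolding half_def using not_linked_of_third[OF s1 R] R s1 e1 by blast
qed

text \<open>Menger's theorem yields a vertex \<open>w\<close> separating the neighbours of
  \<open>a\<close> in \<open>W\<close> from those of \<open>b\<close>. \<open>W1\<close> collects
  what the neighbours of \<open>a\<close> still reach, so it misses all neighbours of
  \<open>b\<close>; the remainder \<open>W2\<close> misses all neighbours of \<open>a\<close>. Hence
  each part is attached only at \<open>w\<close> and at its own end.\<close>

lemma half_split:
  assumes h: "half a b W" and ne: "W \<noteq> {}"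
  obtains w W1 W2 where "W = insert w (W1 \<union> W2)" "w \<notin> W1" "w \<notin> W2" "W1 \<inter> W2 = {}"
    "half a w W1" "half w b W2"
proof -
  have s: "sep a b W" and nl: "\<not> linked E W (nb E a) (nb E b)" using h by (auto simp: half_def)
  have ab: "a \<in> V" "b \<in> V" "a \<noteq> b" "a \<notin> W" "b \<notin> W" "W \<subseteq> V" using s by (auto simp: sep_def)
  have "\<not> linked E W (nb E a \<inter> W) (nb E b \<inter> W)"
    using nl linked_mono[of E W "nb E a \<inter> W" "nb E b \<inter> W" W "nb E a" "nb E b"] by blast
  then obtain w where w: "w \<in> W" "\<not> not_cut E W (nb E a \<inter> W) (nb E b \<inter> W) w"
    using menger2[of "nb E a \<inter> W" W "nb E b \<inter> W" E] ne by blast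
  define W1 where "W1 = {x. \<exists>p\<in>nb E a \<inter> W - {w}. reach E (W - {w}) p x}"
  define W2 where "W2 = W - {w} - W1"
  have W1: "W1 \<subseteq> W - {w}"
  proof
    fix x assume "x \<in> W1"
    then obtain p where "p \<in> nb E a \<inter> W - {w}" and r: "reach E (W - {w}) p x" unfolding W1_def by blast
    then show "x \<in> W - {w}" using reach_in[OF r] by blast
  qed
  have Weq: "W = insert w (W1 \<union> W2)" using w W1 by (auto simp: W2_def)
  have dj: "w \<notin> W1" "w \<notin> W2" "W1 \<inter> W2 = {}" using W1 by (auto simp: W2_def)
  have nW: "nb E x \<subseteq> W \<union> {a, b}" if "x \<in> W" for x using s that by (auto simp: sep_def)
  have aW1: "nb E a \<inter> W - {w} \<subseteq> W1" unfolding W1_def using reach_refl by fast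
  have bW1: "nb E b \<inter> W1 = {}"
  proof (rule ccontr)
    assume "nb E b \<inter> W1 \<noteq> {}"
    then obtain x p where "x \<in> nb E b" "x \<in> W1" "p \<in> nb E a \<inter> W - {w}" "reach E (W - {w}) p x"
      unfolding W1_def by blast
    then have "not_cut E W (nb E a \<inter> W) (nb E b \<inter> W) w" unfolding not_cut_def using W1 by blast
    with w show False by blast
  qed
  have cl: "y \<in> W1" if "x \<in> W1" "y \<in> nb E x" "y \<in> W - {w}" for x y
  proof -
    obtain p where p: "p \<in> nb E a \<inter> W - {w}" "reach E (W - {w}) p x" using \<open>x \<in> W1\<close> unfolding W1_def by blast
    have "reach E (W - {w}) x y" using that W1 by (intro reach_edge) (auto simp: nb_def)
    with p show ?thesis unfolding W1_def by (blast intro: reach_trans)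
  qed
  have s1: "sep a w W1" unfolding sep_def
  proof (intro conjI ballI subsetI)
    fix x y assume x: "x \<in> W1" and y: "y \<in> nb E x"
    have "x \<in> W" using x W1 by blast
    then have "y \<in> W \<union> {a, b}" using nW[of x] y by blast
    moreover have "y \<noteq> b" using bW1 x y nb_sym[of b E x] by blast
    ultimately show "y \<in> W1 \<union> {a, w}" using cl[OF x y] by blast
  qed (use ab w W1 in auto)
  have s2: "sep w b W2" unfolding sep_def
  proof (intro conjI ballI subsetI)
    fix x y assume x: "x \<in> W2" and y: "y \<in> nb E x"
    then have xW: "x \<in> W" by (auto simp: W2_def)
    have xn: "x \<notin> W1" "x \<noteq> w" using x by (auto simp: W2_def)
    have "y \<in> W \<union> {a, b}" using nW[OF xW] y by blast
    moreover have "y \<noteq> a" using aW1 xW xn y nb_sym[of a E x] by blast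
    moreover have "y \<notin> W1" using cl[of y x] xn xW y nb_sym[of y E x] by blast
    ultimately show "y \<in> W2 \<union> {w, b}" by (auto simp: W2_def)
  qed (use ab w W1 in \<open>auto simp: W2_def\<close>)
  obtain x where x: "x \<in> W" using ne by blast
  \<comment> \<open>\<open>a\<close> has some neighbour in \<open>W\<close>; with \<open>W1\<close>
    empty it can only be \<open>w\<close>.\<close>
  have e1: "{a, w} \<in> E" if W1e: "W1 = {}"
  proof -
    obtain p where p: "p \<in> W \<inter> nb E a" using sep_attach[OF s x] by blast
    then have "p = w" using aW1 W1e by blast
    then show ?thesis using p by (auto simp: nb_def)
  qed
  have e2: "{w, b} \<in> E" if W2e: "W2 = {}"
  proof -
    obtain p where p: "p \<in> W \<inter> nb E b" using sep_attach[OF sep_sym[OF s] x] by blast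
    then have "p = w" using bW1 W2e by (auto simp: W2_def)
    then show ?thesis using p by (auto simp: nb_def insert_commute)
  qed
  have h1: "half a w W1" by (rule half_child[OF h Weq dj s1 s2 e1 e2])
  have "half b w W2"
    by (rule half_child[OF half_sym[OF h], of w W2 W1])
      (use Weq dj s1 s2 e1 e2 sep_sym in \<open>auto simp: insert_commute Un_commute\<close>)
  then have "half w b W2" by (rule half_sym)
  with that[OF Weq dj h1] show thesis by blast
qed

text \<open>\<open>W\<close> is one component of the graph without the ends of an edge
  \<open>uv\<close>. If other components exist, one of them is the third route. If not, of two
  disjoint links in the connected set \<open>W\<close> one can be grown until it is adjacent to the
  other, and with \<open>u\<close> and \<open>v\<close> they would form a \<open>K4\<close>. For
  \<open>R\<close> the component \<open>W\<close> is the third route.\<close>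

lemma half_root:
  obtains u v W R where "V = insert u (insert v (W \<union> R))" "W \<inter> R = {}" "half u v W" "half v u R"
proof -
  have V: "infinite V \<or> card V > 2" using two_con by (simp add: two_connected_def)
  have cV: "connected_on E V" using two_con by (simp add: two_connected_def graph_connected_def)
  obtain u where u: "u \<in> V" using cV by (auto simp: connected_on_def)
  have "V \<noteq> {u}" using V by auto
  then obtain x where x: "x \<in> V" "x \<noteq> u" using u by blast
  have "reach E V u x" using cV u x by (simp add: connected_on_reach)
  then obtain v where uv: "{u, v} \<in> E" using reach_exit[of E V u x "{u}"] x by auto
  have uvV: "u \<in> V" "v \<in> V" "u \<noteq> v" using edge_in[OF uv] by auto
  have "V \<noteq> {u, v}" using V uvV by (auto simp: card_insert_if)
  then obtain c where c: "c \<in> V - {u, v}" using uvV by blast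
  define W where "W = {y. reach E (V - {u, v}) c y}"
  define R where "R = V - {u, v} - W"
  have WV: "W \<subseteq> V - {u, v}"
  proof
    fix y assume "y \<in> W" then have "reach E (V - {u, v}) c y" by (simp add: W_def)
    then show "y \<in> V - {u, v}" using c by (rule reach_in)
  qed
  have conW: "connected_on E W" unfolding W_def by (rule connected_on_component[OF c])
  have clW: "y \<in> W" if "x \<in> W" "y \<in> nb E x" "y \<in> V - {u, v}" for x y
  proof -
    have "reach E (V - {u, v}) x y" using that WV by (intro reach_edge) (auto simp: nb_def)
    then show ?thesis using that(1) unfolding W_def by (auto intro: reach_trans)
  qed
  have nbV: "nb E x \<subseteq> V" for x using edge_in by (auto simp: nb_def)
  have sW: "sep u v W" unfolding sep_def using uvV WV clW nbV by blast
  have sR: "sep v u R" unfolding sep_def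
  proof (intro conjI ballI subsetI)
    fix x y assume x: "x \<in> R" and y: "y \<in> nb E x"
    have "y \<in> V" using nbV y by blast
    moreover have "y \<notin> W" using clW[of y x] x nb_sym[of y E x] y by (auto simp: R_def)
    ultimately show "y \<in> R \<union> {v, u}" by (auto simp: R_def)
  qed (use uvV in \<open>auto simp: R_def\<close>)
  have nlW: "\<not> linked E W (nb E u) (nb E v)"
  proof (cases "R = {}")
    case False
    then obtain d where d: "d \<in> R" by blast
    define Y where "Y = {y. reach E R d y}"
    have YR: "Y \<subseteq> R"
    proof
      fix y assume "y \<in> Y" then have "reach E R d y" by (simp add: Y_def)
      then show "y \<in> R" using d by (rule reach_in)
    qed
    obtain p where "p \<in> R \<inter> nb E v" "reach E R d p" using sep_attach[OF sR d] by blast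
    moreover obtain q where "q \<in> R \<inter> nb E u" "reach E R d q" using sep_attach[OF sep_sym[OF sR] d] by blast
    ultimately have "Y \<inter> nb E u \<noteq> {}" "Y \<inter> nb E v \<noteq> {}" unfolding Y_def by blast+
    moreover have "connected_on E Y" unfolding Y_def by (rule connected_on_component[OF d])
    moreover have "Y \<subseteq> V - W - {u, v}" using YR by (auto simp: R_def)
    ultimately show ?thesis using not_linked_of_third[OF sW] by blast
  next
    case True
    show ?thesis
    proof
      assume "linked E W (nb E u) (nb E v)"
      then obtain P Q where PQ: "P \<subseteq> W" "Q \<subseteq> W" "P \<inter> Q = {}" "connected_on E P" "connected_on E Q"
        "P \<inter> nb E u \<noteq> {}" "P \<inter> nb E v \<noteq> {}" "Q \<inter> nb E u \<noteq> {}" "Q \<inter> nb E v \<noteq> {}"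
        unfolding linked_def by (elim exE conjE)
      obtain p q where p: "p \<in> P" and q: "q \<in> Q" using PQ(4,5) by (auto simp: connected_on_def)
      have pWQ: "p \<in> W - Q" using p PQ(1,3) by auto
      define P' where "P' = {y. reach E (W - Q) p y}"
      have P'W: "P' \<subseteq> W - Q"
      proof
        fix y assume "y \<in> P'" then have "reach E (W - Q) p y" by (simp add: P'_def)
        then show "y \<in> W - Q" using pWQ by (rule reach_in)
      qed
      have PP': "P \<subseteq> P'"
      proof
        fix y assume "y \<in> P"
        then have "reach E P p y" using PQ(4) p by (simp add: connected_on_reach)
        then have "reach E (W - Q) p y" by (rule reach_mono) (use PQ in auto)
        then show "y \<in> P'" by (simp add: P'_def)
      qed
      have "reach E W p q" using conW p q PQ(1,2) by (intro connected_on_reach) auto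
      moreover have "q \<notin> P'" using q P'W by auto
      ultimately obtain s t where st: "s \<in> P' \<inter> W" "t \<in> W - P'" "{s, t} \<in> E"
        using reach_exit[of E W p q P'] p PP' by blast
      have "t \<in> Q"
      proof (rule ccontr)
        assume "t \<notin> Q"
        then have "reach E (W - Q) s t" using st P'W by (intro reach_edge) auto
        then have "t \<in> P'" using st(1) unfolding P'_def by (auto intro: reach_trans)
        with st show False by blast
      qed
      have "has_minor V E K4_V K4_E"
      proof (rule K4_minorI[of u V v P' Q])
        show "P' \<subseteq> V - {u, v}" "Q \<subseteq> V - {u, v}" "P' \<inter> Q = {}" using P'W PQ(2) WV by auto
        show "connected_on E P'" unfolding P'_def by (rule connected_on_component[OF pWQ])
        show "P' \<inter> nb E u \<noteq> {}" "P' \<inter> nb E v \<noteq> {}" using PP' PQ(6,7) by auto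
        show "\<exists>p\<in>P'. \<exists>q\<in>Q. {p, q} \<in> E" using st \<open>t \<in> Q\<close> by blast
      qed (fact uvV uv PQ)+
      with no_K4 show False by blast
    qed
  qed
  have cW: "c \<in> W" by (simp add: W_def)
  have "W \<inter> nb E u \<noteq> {}" "W \<inter> nb E v \<noteq> {}"
    using sep_attach[OF sW cW] sep_attach[OF sep_sym[OF sW] cW] by blast+
  then have nlR: "\<not> linked E R (nb E v) (nb E u)"
    using WV conW by (intro not_linked_of_third[OF sR, of W]) (auto simp: R_def)
  have "half u v W" "half v u R" using sW sR nlW nlR uv by (auto simp: half_def insert_commute)
  moreover have "V = insert u (insert v (W \<union> R))" "W \<inter> R = {}" using uvV WV by (auto simp: R_def)
  ultimately show thesis using that by blast
qed

end

section \<open>Ends and the topology of the Freudenthal compactification\<close>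

definition bary :: "'a \<Rightarrow> 'a \<Rightarrow> real \<Rightarrow> 'a \<Rightarrow> real" where
  "bary x y s = (\<lambda>z. if z = x then 1 - s else if z = y then s else 0)"

lemma inner_pts_le_1: "p \<in> inner_pts e \<Longrightarrow> finite e \<Longrightarrow> u \<in> e \<Longrightarrow> 0 < p u \<and> p u \<le> 1"
  unfolding inner_pts_def using member_le_sum[of u e p] by (force simp: less_imp_le)

lemma inner_pts_pair:
  assumes "x \<noteq> y"
  shows "p \<in> inner_pts {x, y} \<longleftrightarrow> (\<exists>s. 0 < s \<and> s < 1 \<and> p = bary x y s)"
proof
  assume p: "p \<in> inner_pts {x, y}"
  then have "p x + p y = 1" "p x > 0" "p y > 0" using assms by (auto simp: inner_pts_def)
  moreover from this have "p = bary x y (p y)" using p by (auto simp: inner_pts_def bary_def fun_eq_iff)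
  ultimately show "\<exists>s. 0 < s \<and> s < 1 \<and> p = bary x y s" by (intro exI[of _ "p y"]) auto
qed (use assms in \<open>auto simp: inner_pts_def bary_def split: if_splits\<close>)

lemma inner_pts_support: "p \<in> inner_pts e \<Longrightarrow> e = {z. p z > 0}"
  by (auto simp: inner_pts_def)

lemma inner_pts_unique: "p \<in> inner_pts e \<Longrightarrow> p \<in> inner_pts e' \<Longrightarrow> e = e'"
  using inner_pts_support by metis

lemma inner_pts_sum: "p \<in> inner_pts {x, y} \<Longrightarrow> x \<noteq> y \<Longrightarrow> p x + p y = 1"
  by (auto simp: inner_pts_def)

lemma inner_pts_eqI:
  assumes "p \<in> inner_pts {x, y}" "q \<in> inner_pts {x, y}" "x \<noteq> y" "p x = q x"
  shows "p = q"
  using assms unfolding inner_pts_pair[OF assms(3)] by (auto simp: bary_def)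

section \<open>Rays, ends and the components in which they lie\<close>

context sgraph
begin

lemma ray_in_V: "is_ray E r \<Longrightarrow> r k \<in> V"
  using edge_in unfolding is_ray_def by blast

lemma ray_leaves: "is_ray E r \<Longrightarrow> finite S \<Longrightarrow> \<exists>n. \<forall>k\<ge>n. r k \<notin> S"
proof -
  assume "is_ray E r" "finite S"
  then have "finite (r -` S)" by (auto simp: is_ray_def intro: finite_vimageI)
  then obtain n where "\<forall>k\<in>r -` S. k < n" using finite_nat_set_iff_bounded by blast
  then show ?thesis by (intro exI[of _ n]) (metis leD vimageI)
qed

lemma ray_tail_reach:
  assumes "is_ray E r" "\<forall>k\<ge>n. r k \<notin> S" "n \<le> k"
  shows "reach E (V - S) (r n) (r k)"
  using assms(3)
proof (induction k rule: dec_induct)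
  case (step k)
  have "reach E (V - S) (r k) (r (Suc k))"
    using assms step ray_in_V[OF assms(1)] by (intro reach_edge) (auto simp: is_ray_def)
  with step show ?case by (blast intro: reach_trans)
qed simp

lemma ray_equiv_refl: "is_ray E r \<Longrightarrow> ray_equiv V E r r"
  unfolding ray_equiv_def using ray_leaves by fastforce

lemma ray_equiv_sym: "ray_equiv V E r s \<Longrightarrow> ray_equiv V E s r"
  unfolding ray_equiv_def by (meson reach_sym)

lemma ray_equiv_trans:
  assumes "ray_equiv V E r s" "ray_equiv V E s t"
  shows "ray_equiv V E r t"
  unfolding ray_equiv_def
proof (intro allI impI)
  fix S :: "'a set" assume S: "finite S"
  obtain n where n: "\<forall>k\<ge>n. r k \<notin> S \<and> s k \<notin> S \<and> reach E (V - S) (r k) (s k)"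
    using assms(1) S unfolding ray_equiv_def by blast
  obtain m where m: "\<forall>k\<ge>m. s k \<notin> S \<and> t k \<notin> S \<and> reach E (V - S) (s k) (t k)"
    using assms(2) S unfolding ray_equiv_def by blast
  show "\<exists>n. \<forall>k\<ge>n. r k \<notin> S \<and> t k \<notin> S \<and> reach E (V - S) (r k) (t k)"
  proof (intro exI[of _ "max n m"] allI impI)
    fix k assume "max n m \<le> k"
    then show "r k \<notin> S \<and> t k \<notin> S \<and> reach E (V - S) (r k) (t k)"
      using n m by (meson max.boundedE reach_trans)
  qed
qed

lemma end_eq_class:
  assumes "\<omega> \<in> ends V E" "r \<in> \<omega>"
  shows "is_ray E r" "\<omega> = {r'. is_ray E r' \<and> ray_equiv V E r r'}"
proof -
  obtain r0 where r0: "is_ray E r0" "\<omega> = {r'. is_ray E r' \<and> ray_equiv V E r0 r'}"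
    using assms(1) by (auto simp: ends_def)
  then have r: "is_ray E r" "ray_equiv V E r0 r" using assms(2) by auto
  show "is_ray E r" by fact
  show "\<omega> = {r'. is_ray E r' \<and> ray_equiv V E r r'}"
    using r0 r ray_equiv_trans ray_equiv_sym by blast
qed

lemma end_obtain_ray:
  assumes "\<omega> \<in> ends V E" obtains r where "r \<in> \<omega>" "is_ray E r"
  using assms ray_equiv_refl by (auto simp: ends_def)

lemma ends_eqI:
  assumes "\<omega> \<in> ends V E" "\<omega>' \<in> ends V E" "r \<in> \<omega>" "r' \<in> \<omega>'" "ray_equiv V E r r'"
  shows "\<omega> = \<omega>'"
proof -
  have "r' \<in> \<omega>" using end_eq_class[OF assms(1,3)] end_eq_class(1)[OF assms(2,4)] assms(5) by blast
  then show ?thesis using end_eq_class(2)[OF assms(1)] end_eq_class(2)[OF assms(2,4)] by blast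
qed

text \<open>Independence of the ray and of its tail: two tails are joined outside \<open>S\<close>
  by going out along one ray, crossing over by equivalence far enough out, and coming back along the
  other.\<close>

lemma end_comp_eq:
  assumes "\<omega> \<in> ends V E" "r \<in> \<omega>" "\<forall>k\<ge>n. r k \<notin> S" "finite S"
  shows "end_comp V E S \<omega> = {v. reach E (V - S) (r n) v}"
proof
  show "{v. reach E (V - S) (r n) v} \<subseteq> end_comp V E S \<omega>"
    unfolding end_comp_def using assms(2,3) by blast
  show "end_comp V E S \<omega> \<subseteq> {v. reach E (V - S) (r n) v}"
  proof
    fix v assume "v \<in> end_comp V E S \<omega>"
    then obtain r' m where r': "r' \<in> \<omega>" "\<forall>k\<ge>m. r' k \<notin> S" "reach E (V - S) (r' m) v"
      unfolding end_comp_def by blast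
    have rr: "is_ray E r" "is_ray E r'" "ray_equiv V E r r'"
      using end_eq_class[OF assms(1,2)] end_eq_class(1)[OF assms(1) r'(1)] r'(1) by auto
    then obtain l where l: "\<forall>k\<ge>l. reach E (V - S) (r k) (r' k)"
      using assms(4) unfolding ray_equiv_def by blast
    define k where "k = max l (max n m)"
    have "reach E (V - S) (r n) (r k)" using rr assms(3) by (intro ray_tail_reach) (auto simp: k_def)
    also have "reach E (V - S) (r k) (r' k)" using l by (simp add: k_def)
    also have "reach E (V - S) (r' k) (r' m)"
      using rr r' by (intro reach_sym[OF ray_tail_reach]) (auto simp: k_def)
    also note r'(3)
    finally show "v \<in> {v. reach E (V - S) (r n) v}" by simp
  qed
qed

lemma end_comp_obtain:
  assumes "\<omega> \<in> ends V E" "finite S"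
  obtains r n where "r \<in> \<omega>" "is_ray E r" "\<forall>k\<ge>n. r k \<notin> S" "r n \<in> V - S" "end_comp V E S \<omega> = {v. reach E (V - S) (r n) v}"
proof -
  obtain r where r: "r \<in> \<omega>" "is_ray E r" using end_obtain_ray[OF assms(1)] .
  obtain n where n: "\<forall>k\<ge>n. r k \<notin> S" using ray_leaves[OF r(2) assms(2)] by blast
  show thesis using that[OF r n _ end_comp_eq[OF assms(1) r(1) n assms(2)]] ray_in_V[OF r(2)] n by auto
qed

text \<open>\<open>A\<close> is a union of components of the graph without \<open>S\<close>, and an
  end selects one such component. The negated inclusions record that this component is nonempty, so
  that the alternatives exclude each other.\<close>

lemma end_comp_dichotomy:
  assumes "\<omega> \<in> ends V E" "finite S" "A \<subseteq> V - S" "\<And>x. x \<in> A \<Longrightarrow> nb E x \<subseteq> A \<union> S"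
  shows "(end_comp V E S \<omega> \<subseteq> A \<and> \<not> end_comp V E S \<omega> \<subseteq> V - S - A) \<or>
    (end_comp V E S \<omega> \<subseteq> V - S - A \<and> \<not> end_comp V E S \<omega> \<subseteq> A)"
proof -
  obtain r n where rn: "r n \<in> V - S" "end_comp V E S \<omega> = {v. reach E (V - S) (r n) v}"
    by (rule end_comp_obtain[OF assms(1,2)])
  have rC: "r n \<in> end_comp V E S \<omega>" using rn by simp
  have sub: "end_comp V E S \<omega> \<subseteq> V - S"
  proof
    fix v assume "v \<in> end_comp V E S \<omega>"
    then have "reach E (V - S) (r n) v" using rn by simp
    then show "v \<in> V - S" using rn(1) by (rule reach_in)
  qed
  show ?thesis
  proof (cases "r n \<in> A")
    case True
    have "end_comp V E S \<omega> \<subseteq> A"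
    proof
      fix v assume "v \<in> end_comp V E S \<omega>"
      then have "reach E (V - S) (r n) v" using rn by simp
      then show "v \<in> A" by (rule reach_closed) (use True assms(4) in \<open>auto simp: nb_def\<close>)
    qed
    then show ?thesis using rC True by blast
  next
    case False
    have "end_comp V E S \<omega> \<subseteq> V - S - A"
    proof
      fix v assume v: "v \<in> end_comp V E S \<omega>"
      then have "reach E (V - S) v (r n)" using rn reach_sym[of E "V - S" "r n" v] by simp
      moreover have "v \<notin> A"
      proof
        assume "v \<in> A"
        with \<open>reach E (V - S) v (r n)\<close> have "r n \<in> A"
          by (rule reach_closed) (use assms(4) in \<open>auto simp: nb_def\<close>)
        with False show False by blast
      qed
      ultimately show "v \<in> V - S - A" using v sub by blast
    qed
    then show ?thesis using rC False by blast
  qed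
qed

section \<open>Open sets of the compactification and separations by finite vertex sets\<close>

abbreviation "X \<equiv> freudenthal V E"

lemma open_edge_interval:
  "e \<in> E \<Longrightarrow> u \<in> e \<Longrightarrow> openin X {Inn p | p. p \<in> inner_pts e \<and> a < p u \<and> p u < b}"
  unfolding freudenthal_def by (rule topology_generated_by_Basis) (auto simp: edge_intervals_def)

lemma open_star:
  "v \<in> V \<Longrightarrow> \<epsilon> > 0 \<Longrightarrow> openin X (insert (Vtx v) {Inn p | p e. e \<in> E \<and> v \<in> e \<and> p \<in> inner_pts e \<and> p v > 1 - \<epsilon>})"
  unfolding freudenthal_def by (rule topology_generated_by_Basis) (auto simp: vertex_stars_def)

lemma open_end_nbhd:
  "finite S \<Longrightarrow> S \<subseteq> V \<Longrightarrow> \<omega> \<in> ends V E \<Longrightarrow> openin X (end_nbhd V E S \<omega>)"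
  unfolding freudenthal_def by (rule topology_generated_by_Basis) (auto simp: end_nbhds_def)

lemma edge_finite: "e \<in> E \<Longrightarrow> finite e"
  by (metis edge_obtain finite.emptyI finite_insert)

lemma edge_le_1: "e \<in> E \<Longrightarrow> p \<in> inner_pts e \<Longrightarrow> u \<in> e \<Longrightarrow> 0 < p u \<and> p u \<le> 1"
  by (rule inner_pts_le_1[OF _ edge_finite])

lemma open_edge: "e \<in> E \<Longrightarrow> openin X (Inn ` inner_pts e)"
proof -
  assume e: "e \<in> E"
  then obtain u where u: "u \<in> e" using edge_obtain by blast
  have "Inn ` inner_pts e = {Inn p | p. p \<in> inner_pts e \<and> 0 < p u \<and> p u < 2}"
    using edge_le_1[OF e _ u] by fastforce
  then show ?thesis using open_edge_interval[OF e u, of 0 2] by simp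
qed

lemma End_in_nbhd: "\<omega> \<in> ends V E \<Longrightarrow> End \<omega> \<in> end_nbhd V E S \<omega>"
  by (auto simp: end_nbhd_def Let_def)

lemma end_comp_subset: "\<omega> \<in> ends V E \<Longrightarrow> finite S \<Longrightarrow> end_comp V E S \<omega> \<subseteq> V - S"
  using end_comp_dichotomy[of \<omega> S "V - S"] nb_subset by blast

lemma topspace_X: "topspace X = Vtx ` V \<union> Inn ` (\<Union>e\<in>E. inner_pts e) \<union> End ` ends V E"
proof
  have 1: "s \<subseteq> Vtx ` V \<union> Inn ` (\<Union>e\<in>E. inner_pts e) \<union> End ` ends V E"
    if "s \<in> edge_intervals E \<union> vertex_stars V E" for s
    using that by (auto simp: edge_intervals_def vertex_stars_def)
  have 2: "end_nbhd V E S \<omega> \<subseteq> Vtx ` V \<union> Inn ` (\<Union>e\<in>E. inner_pts e) \<union> End ` ends V E"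
    if "finite S" "\<omega> \<in> ends V E" for S \<omega>
    using end_comp_subset[OF that(2,1)] by (auto simp: end_nbhd_def Let_def)
  show "topspace X \<subseteq> Vtx ` V \<union> Inn ` (\<Union>e\<in>E. inner_pts e) \<union> End ` ends V E"
    unfolding freudenthal_def topology_generated_by_topspace 
  proof (rule Union_least)
    fix s assume "s \<in> edge_intervals E \<union> vertex_stars V E \<union> end_nbhds V E"
    then show "s \<subseteq> Vtx ` V \<union> Inn ` (\<Union>e\<in>E. inner_pts e) \<union> End ` ends V E"
      using 1[of s] 2 by (auto simp only: end_nbhds_def Un_iff mem_Collect_eq)
  qed
  have "Vtx v \<in> topspace X" if "v \<in> V" for v using openin_subset[OF open_star[OF that, of 1]] by auto
  moreover have "Inn p \<in> topspace X" if "e \<in> E" "p \<in> inner_pts e" for e p using openin_subset[OF open_edge[OF that(1)]] that by auto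
  moreover have "End \<omega> \<in> topspace X" if "\<omega> \<in> ends V E" for \<omega>
    using openin_subset[OF open_end_nbhd[OF _ _ that, of "{}"]] End_in_nbhd[OF that] by auto
  ultimately show "Vtx ` V \<union> Inn ` (\<Union>e\<in>E. inner_pts e) \<union> End ` ends V E \<subseteq> topspace X" by auto
qed

text \<open>The part of the compactification that belongs to a union \<open>A\<close> of components
  of the graph without \<open>S\<close>, edges to \<open>S\<close> included. A basic neighbourhood
  of an end is the case of a single component.\<close>

definition region :: "'a set \<Rightarrow> 'a set \<Rightarrow> 'a point set" where
  "region S A = Vtx ` A \<union> {Inn p | p e. e \<in> E \<and> e \<inter> A \<noteq> {} \<and> p \<in> inner_pts e} \<union>
     End ` {\<omega> \<in> ends V E. end_comp V E S \<omega> \<subseteq> A}"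

lemma region_open:
  assumes "finite S" "S \<subseteq> V" "A \<subseteq> V"
  shows "openin X (region S A)"
proof (subst openin_subopen, intro ballI)
  fix x assume x: "x \<in> region S A"
  then consider v where "x = Vtx v" "v \<in> A"
    | p e where "x = Inn p" "e \<in> E" "e \<inter> A \<noteq> {}" "p \<in> inner_pts e"
    | \<omega> where "x = End \<omega>" "\<omega> \<in> ends V E" "end_comp V E S \<omega> \<subseteq> A"
    unfolding region_def by blast
  then show "\<exists>T. openin X T \<and> x \<in> T \<and> T \<subseteq> region S A"
  proof cases
    case 1
    then have "v \<in> V" using assms by blast
    show ?thesis
    proof (intro exI conjI)
      \<comment> \<open>Radius 1 admits every inner point of every edge at \<open>v\<close>.\<close>
      show "openin X (insert (Vtx v) {Inn p | p e. e \<in> E \<and> v \<in> e \<and> p \<in> inner_pts e \<and> p v > 1 - 1})"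
        by (rule open_star) (use \<open>v \<in> V\<close> in auto)
    qed (use 1 in \<open>auto simp: region_def\<close>)
  next
    case 2
    then have "Inn ` inner_pts e \<subseteq> region S A" unfolding region_def by blast
    then show ?thesis using open_edge[OF 2(2)] 2 by (intro exI[of _ "Inn ` inner_pts e"]) auto
  next
    case 3
    have "end_nbhd V E S \<omega> \<subseteq> region S A"
      unfolding region_def end_nbhd_def Let_def using 3 by (intro Un_mono) blast+
    then show ?thesis using open_end_nbhd[OF assms(1,2) 3(2)] End_in_nbhd[OF 3(2)] 3(1) by blast
  qed
qed

text \<open>With the two disjointness lemmas that follow, this turns a vertex separation of the
  graph into a topological one: off \<open>S\<close> the space falls into open sets, namely two
  regions and the edges spanned by \<open>S\<close>.\<close>

lemma region_cover:
  assumes "finite S" "A \<subseteq> V - S" "\<And>x. x \<in> A \<Longrightarrow> nb E x \<subseteq> A \<union> S"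
  shows "topspace X \<subseteq> Vtx ` S \<union> region S A \<union> region S (V - S - A) \<union> {Inn p | p e. e \<in> E \<and> e \<subseteq> S \<and> p \<in> inner_pts e}"
proof
  fix x assume "x \<in> topspace X"
  then consider v where "x = Vtx v" "v \<in> V"
    | p e where "x = Inn p" "e \<in> E" "p \<in> inner_pts e"
    | \<omega> where "x = End \<omega>" "\<omega> \<in> ends V E"
    unfolding topspace_X by blast
  then show "x \<in> Vtx ` S \<union> region S A \<union> region S (V - S - A) \<union> {Inn p | p e. e \<in> E \<and> e \<subseteq> S \<and> p \<in> inner_pts e}"
  proof cases
    case 1 then show ?thesis by (auto simp: region_def)
  next
    case 2
    have "e \<subseteq> V" using 2 simple by (auto simp: simple_graph_def)
    then have "e \<subseteq> S \<or> e \<inter> A \<noteq> {} \<or> e \<inter> (V - S - A) \<noteq> {}" by blast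
    moreover have "Inn p \<in> region S B \<longleftrightarrow> (\<exists>e\<in>E. e \<inter> B \<noteq> {} \<and> p \<in> inner_pts e)" for B
      by (auto simp: region_def)
    ultimately show ?thesis using 2 by auto
  next
    case 3 then show ?thesis using end_comp_dichotomy[OF 3(2) assms] by (auto simp: region_def)
  qed
qed

lemma region_disjoint:
  assumes "finite S" "A \<subseteq> V - S" "\<And>x. x \<in> A \<Longrightarrow> nb E x \<subseteq> A \<union> S"
  shows "region S A \<inter> region S (V - S - A) = {}"
proof -
  have "\<not> (e \<inter> A \<noteq> {} \<and> e \<inter> (V - S - A) \<noteq> {})" if eE: "e \<in> E" for e
  proof -
    obtain x y where e: "e = {x, y}" using edge_obtain[OF eE] by metis
    have "y \<in> nb E x" "x \<in> nb E y" using eE e by (auto simp: nb_def insert_commute)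
    then show ?thesis using assms(2,3) e by blast
  qed
  moreover have "\<not> (end_comp V E S \<omega> \<subseteq> A \<and> end_comp V E S \<omega> \<subseteq> V - S - A)" if "\<omega> \<in> ends V E" for \<omega>
    using end_comp_dichotomy[OF that assms] by blast
  ultimately show ?thesis unfolding region_def using inner_pts_unique by blast
qed

lemma region_disjoint_edges:
  assumes "A \<inter> S = {}"
  shows "region S A \<inter> {Inn p | p e. e \<in> E \<and> e \<subseteq> S \<and> p \<in> inner_pts e} = {}"
  unfolding region_def using assms inner_pts_unique by blast

definition epath :: "'a \<Rightarrow> 'a \<Rightarrow> real \<Rightarrow> 'a point" where
  "epath x y t = (if t \<le> 0 then Vtx x else if t \<ge> 1 then Vtx y else Inn (bary x y t))"

text \<open>Continuity is checked on the generating sets: the preimage of each is empty or an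
  interval that is open relative to the unit interval.\<close>

lemma epath_continuous:
  assumes e: "{x, y} \<in> E"
  shows "continuous_map (top_of_set {0..1}) X (epath x y)"
  unfolding freudenthal_def
proof (rule continuous_on_generated_topo)
  have xy: "x \<noteq> y" "x \<in> V" "y \<in> V" using edge_in[OF e] by auto
  have inn: "bary x y t \<in> inner_pts {x, y}" if "0 < t" "t < 1" for t
    using inner_pts_pair[OF xy(1)] that by blast
  have inn': "bary x y t \<in> inner_pts e' \<longleftrightarrow> e' = {x, y}" if "0 < t" "t < 1" for t e'
    using inn[OF that] inner_pts_unique by blast
  have bxy: "bary x y t x = 1 - t" "bary x y t y = t" for t using xy by (auto simp: bary_def)
  show "epath x y ` topspace (top_of_set {0..1}) \<subseteq> \<Union> (edge_intervals E \<union> vertex_stars V E \<union> end_nbhds V E)"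
  proof -
    have "epath x y ` {0..1} \<subseteq> topspace X" unfolding topspace_X epath_def using xy e inn by force
    then show ?thesis by (simp add: freudenthal_def)
  qed
  fix U assume "U \<in> edge_intervals E \<union> vertex_stars V E \<union> end_nbhds V E"
  then have U: "U \<in> edge_intervals E \<or> U \<in> vertex_stars V E \<or> U \<in> end_nbhds V E" by simp
  consider e' u a b where "e' \<in> E" "u \<in> e'" "U = {Inn p | p. p \<in> inner_pts e' \<and> a < p u \<and> p u < b}"
    | v \<epsilon> where "v \<in> V" "\<epsilon> > 0" "U = insert (Vtx v) {Inn p | p e. e \<in> E \<and> v \<in> e \<and> p \<in> inner_pts e \<and> p v > 1 - \<epsilon>}"
    | S \<omega> where "U = end_nbhd V E S \<omega>"
    using U[unfolded edge_intervals_def vertex_stars_def end_nbhds_def mem_Collect_eq]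
    by (elim disjE exE conjE)
  then have "\<exists>T. open T \<and> epath x y -` U \<inter> {0..1} = {0..1} \<inter> T"
  proof cases
    case 1
    show ?thesis
    proof (cases "e' = {x, y}")
      case False
      then have "epath x y -` U \<inter> {0..1} = {0..1} \<inter> {}" using 1 inn' by (force simp: epath_def split: if_splits)
      then show ?thesis using open_empty by blast
    next
      case True
      \<comment> \<open>The coordinate at \<open>x\<close> is \<open>1 - t\<close>, so the bounds
        are reflected.\<close>
      define T where "T = (if u = x then {1 - b<..<1 - a} else {a<..<b}) \<inter> {0<..<1}"
      have "epath x y -` U \<inter> {0..1} = {0..1} \<inter> T"
        using 1 True bxy inn' xy by (auto simp: epath_def T_def split: if_splits)
      moreover have "open T" by (auto simp: T_def)
      ultimately show ?thesis by blast
    qed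
  next
    case star: 2
    \<comment> \<open>The cap at 1, and dually at 0, keeps out the opposite vertex when
      \<open>\<epsilon>\<close> exceeds 1.\<close>
    define T where "T = (if v = x then {..<min \<epsilon> 1} else if v = y then {max (1 - \<epsilon>) 0<..} else {})"
    have "epath x y t \<in> U \<longleftrightarrow> t \<in> T" if t: "0 \<le> t" "t \<le> 1" for t
    proof -
      consider "t = 0" | "t = 1" | "0 < t" "t < 1" using t by force
      then show ?thesis
      proof cases
        case 1 then show ?thesis using star xy by (auto simp: epath_def T_def)
      next
        case 2
        then show ?thesis using star xy by (auto simp: epath_def T_def)
      next
        case 3
        have "epath x y t \<in> U \<longleftrightarrow> v \<in> {x, y} \<and> bary x y t v > 1 - \<epsilon>"
          using star 3 inn'[OF 3] e by (auto simp: epath_def)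
        then show ?thesis using 3 bxy[of t] xy by (auto simp: T_def)
      qed
    qed
    then have "epath x y -` U \<inter> {0..1} = {0..1} \<inter> T" by auto
    moreover have "open T" by (auto simp: T_def)
    ultimately show ?thesis by blast
  next
    case 3
    define C where "C = end_comp V E S \<omega>"
    define T where "T = (if x \<in> C then (if y \<in> C then UNIV else {..<1}) else if y \<in> C then {0::real<..} else {})"
    have U: "U = Vtx ` C \<union> {Inn p | p e. e \<in> E \<and> e \<inter> C \<noteq> {} \<and> p \<in> inner_pts e} \<union> End ` {\<omega>' \<in> ends V E. end_comp V E S \<omega>' = C}"
      using 3 by (simp add: end_nbhd_def Let_def C_def)
    have "epath x y t \<in> U \<longleftrightarrow> t \<in> T" if t: "0 \<le> t" "t \<le> 1" for t
    proof -
      consider "t = 0" | "t = 1" | "0 < t" "t < 1" using t by force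
      then show ?thesis
      proof cases
        case 1 then show ?thesis by (auto simp: epath_def T_def U)
      next
        case 2 then show ?thesis by (auto simp: epath_def T_def U)
      next
        case 3
        have "epath x y t \<in> U \<longleftrightarrow> {x, y} \<inter> C \<noteq> {}"
          using 3 inn'[OF 3] e by (auto simp: epath_def U)
        then show ?thesis using 3 by (auto simp: T_def)
      qed
    qed
    then have "epath x y -` U \<inter> {0..1} = {0..1} \<inter> T" by auto
    moreover have "open T" by (auto simp: T_def)
    ultimately show ?thesis by blast
  qed
  then show "openin (top_of_set {0..1}) (epath x y -` U \<inter> topspace (top_of_set {0..1}))"
    by (simp add: openin_open)
qed

lemma epath_image:
  assumes "x \<noteq> y"
  shows "epath x y ` {0..1} = {Vtx x, Vtx y} \<union> Inn ` inner_pts {x, y}"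
proof -
  have "{0..1::real} = {0, 1} \<union> {0<..<1}" by auto
  then have "epath x y ` {0..1} = {epath x y 0, epath x y 1} \<union> epath x y ` {0<..<1}" by auto
  also have "epath x y ` {0<..<1} = Inn ` bary x y ` {0<..<1}"
    unfolding image_image by (intro image_cong) (auto simp: epath_def)
  also have "bary x y ` {0<..<1} = inner_pts {x, y}" using inner_pts_pair[OF assms] by auto
  finally show ?thesis by (simp add: epath_def)
qed

lemma compactin_edge:
  assumes "{x, y} \<in> E"
  shows "compactin X ({Vtx x, Vtx y} \<union> Inn ` inner_pts {x, y})"
proof -
  have "compactin X (epath x y ` {0..1})"
    by (rule image_compactin[OF _ epath_continuous[OF assms]]) (simp add: compactin_subtopology)
  then show ?thesis using epath_image edge_in[OF assms] by simp
qed

end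

section \<open>The tree of arcs\<close>

context outerplanar
begin

lemma chain_mono:
  assumes step: "\<And>n. W (Suc n) \<subseteq> W n \<and> ((a (Suc n) = a n \<and> b (Suc n) \<in> W n) \<or> (b (Suc n) = b n \<and> a (Suc n) \<in> W n))"
    and le: "n \<le> m"
  shows "W m \<subseteq> W n" "a m \<in> W n \<union> {a n}" "b m \<in> W n \<union> {b n}"
proof -
  have "W m \<subseteq> W n \<and> a m \<in> W n \<union> {a n} \<and> b m \<in> W n \<union> {b n}" using le
  proof (induction m rule: dec_induct)
    case (step m) then show ?case using assms(1)[of m] by auto
  qed auto
  then show "W m \<subseteq> W n" "a m \<in> W n \<union> {a n}" "b m \<in> W n \<union> {b n}" by auto
qed

text \<open>If \<open>a\<close> stayed constant, some neighbour \<open>c\<close> of \<open>a\<close> would lie in all \<open>W n\<close> by local finiteness, and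
  every \<open>b n\<close> would lie on one finite path that leaves \<open>W N\<close> from \<open>c\<close>.\<close>

lemma chain_not_const:
  assumes s: "\<And>n. sep (a n) (b n) (W n)" and ne: "\<And>n. W n \<noteq> {}"
    and step: "\<And>n. W (Suc n) \<subseteq> W n \<and> ((a (Suc n) = a n \<and> b (Suc n) \<in> W n) \<or> (b (Suc n) = b n \<and> a (Suc n) \<in> W n))"
  shows "\<exists>n\<ge>N. a n \<noteq> a N"
proof (rule ccontr)
  assume "\<not> (\<exists>n\<ge>N. a n \<noteq> a N)"
  then have const: "a n = a N" if "n \<ge> N" for n using that by blast
  have notin: "a n \<notin> W n" "b n \<notin> W n" "a n \<noteq> b n" for n using s[of n] by (auto simp: sep_def)
  note mono = chain_mono[of W a b, OF step]
  have bW: "b (Suc n) \<in> W n" if "n \<ge> N" for n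
    using step[of n] const[of n] const[of "Suc n"] notin[of n] that by auto
  have "\<exists>c\<in>nb E (a N). \<forall>n. c \<in> W n"
  proof (rule ccontr)
    assume "\<not> ?thesis"
    then have ex: "\<forall>c\<in>nb E (a N). \<exists>n. c \<notin> W n" by blast
    have "\<forall>\<^sub>F n in sequentially. \<forall>c\<in>nb E (a N). c \<notin> W n"
    proof (rule eventually_ball_finite)
      show "finite (nb E (a N))" using s[of N] by (intro finite_nb) (simp add: sep_def)
      show "\<forall>c\<in>nb E (a N). \<forall>\<^sub>F n in sequentially. c \<notin> W n"
      proof
        fix c assume "c \<in> nb E (a N)"
        then obtain n where "c \<notin> W n" using ex by blast
        then have "c \<notin> W m" if "m \<ge> n" for m using mono(1)[OF that] by blast
        then show "\<forall>\<^sub>F n in sequentially. c \<notin> W n" unfolding eventually_sequentially by blast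
      qed
    qed
    then obtain M where M: "\<And>n. n \<ge> M \<Longrightarrow> \<forall>c\<in>nb E (a N). c \<notin> W n" unfolding eventually_sequentially by blast
    define n where "n = max M N"
    obtain x where "x \<in> W n" using ne by blast
    then obtain p where "p \<in> W n \<inter> nb E (a n)" using sep_attach[OF s] by blast
    moreover have "a n = a N" by (rule const) (simp add: n_def)
    ultimately show False using M[of n] by (auto simp: n_def)
  qed
  then obtain c where c: "\<And>n. c \<in> W n" by blast
  have "reach E (W N \<union> {b N}) c (b N)" using sep_reach[OF sep_sym[OF s]] c by blast
  then obtain F where F: "finite F" "F \<subseteq> W N \<union> {b N}" "connected_on E F" "c \<in> F" "b N \<in> F"
    using reach_finite_support[of E "W N \<union> {b N}" c "b N"] c by blast
  have bF: "b n \<in> F" if n: "n \<ge> N" for n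
  proof -
    have "b N \<notin> W n" using mono(1)[OF n] notin[of N] by blast
    moreover have "reach E F c (b N)" using F by (simp add: connected_on_reach)
    ultimately obtain p q where pq: "p \<in> W n \<inter> F" "q \<in> F - W n" "{p, q} \<in> E"
      using reach_exit[of E F c "b N" "W n"] c by blast
    then have "q \<in> W n \<union> {a n, b n}" using s[of n] by (auto simp: sep_def nb_def)
    moreover have "a n \<notin> F" using const[OF n] notin[of N] F by auto
    ultimately show ?thesis using pq by blast
  qed
  \<comment> \<open>Every later \<open>b y\<close> lies in \<open>W x\<close>, whereas
    \<open>b x\<close> does not; so the values never repeat, contradicting the finiteness of
    \<open>F\<close>.\<close>
  have "inj_on b {N..}"
  proof (rule linorder_inj_onI)
    fix x y assume xy: "x < y" "x \<in> {N..}" "y \<in> {N..}"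
    then have "b (Suc (y - 1)) \<in> W (y - 1)" by (intro bW) auto
    moreover have "x \<le> y - 1" "Suc (y - 1) = y" using xy by auto
    ultimately have "b y \<in> W x" using mono(1)[of x "y - 1"] by auto
    then show "b x \<noteq> b y" using notin[of x] by auto
  qed auto
  then have "finite {N..}" using F(1) bF by (meson atLeast_iff finite_imageD finite_subset image_subsetI)
  then show False using infinite_Ici by blast
qed

text \<open>An attachment vertex once given up cannot return, so each vertex is eventually neither
  \<open>a n\<close> nor \<open>b n\<close>. A vertex \<open>c\<close> inside all \<open>W n\<close>
  is impossible too: a finite path from \<open>c\<close> to \<open>a 0\<close> would leave every
  \<open>W n\<close> through \<open>a n\<close> or \<open>b n\<close>, and these eventually avoid
  the path.\<close>

lemma chain_leaves:
  assumes s: "\<And>n. sep (a n) (b n) (W n)" and ne: "\<And>n. W n \<noteq> {}"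
    and step: "\<And>n. W (Suc n) \<subseteq> W n \<and> ((a (Suc n) = a n \<and> b (Suc n) \<in> W n) \<or> (b (Suc n) = b n \<and> a (Suc n) \<in> W n))"
    and fin: "finite S"
  shows "\<forall>\<^sub>F n in sequentially. (W n \<union> {a n, b n}) \<inter> S = {}"
proof -
  have notin: "a n \<notin> W n" "b n \<notin> W n" "a n \<noteq> b n" for n using s[of n] by (auto simp: sep_def)
  note mono = chain_mono[of W a b, OF step]
  have step': "\<And>n. W (Suc n) \<subseteq> W n \<and> ((b (Suc n) = b n \<and> a (Suc n) \<in> W n) \<or> (a (Suc n) = a n \<and> b (Suc n) \<in> W n))"
    using step by blast
  have ev: "\<forall>\<^sub>F n in sequentially. a n \<noteq> f"
    if ab: "\<And>n m. n \<le> m \<Longrightarrow> a m \<in> W n \<union> {a n}" "\<And>n. \<exists>m\<ge>n. a m \<noteq> a n" "\<And>n. a n \<notin> W n" for a :: "nat \<Rightarrow> 'a" and f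
  proof (cases "\<exists>m. a m = f")
    case True
    then obtain m where m: "a m = f" by blast
    obtain k where k: "k \<ge> m" "a k \<noteq> a m" using ab(2) by blast
    have "a k \<in> W m" using ab(1)[OF k(1)] k(2) by auto
    then have "a j \<noteq> f" if "j \<ge> k" for j
      using ab(1)[OF that] mono(1)[OF k(1)] ab(3)[of m] m by auto
    then show ?thesis unfolding eventually_sequentially by blast
  qed (simp add: eventually_mono)
  have eva: "\<forall>\<^sub>F n in sequentially. a n \<noteq> f" for f
    by (rule ev[OF mono(2) chain_not_const[of a b W, OF s ne step] notin(1)])
  have evb: "\<forall>\<^sub>F n in sequentially. b n \<noteq> f" for f
    by (rule ev[OF mono(3) chain_not_const[of b a W, OF sep_sym[OF s] ne step'] notin(2)])
  have evW: "\<forall>\<^sub>F n in sequentially. c \<notin> W n" for c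
  proof -
    have "\<exists>n. c \<notin> W n"
    proof (rule ccontr)
      assume "\<not> ?thesis"
      then have c: "c \<in> W n" for n by blast
      have "c \<in> V" "a 0 \<in> V" using c[of 0] s[of 0] by (auto simp: sep_def)
      then have "reach E V c (a 0)" using two_con by (simp add: two_connected_def graph_connected_def connected_on_reach)
      then obtain F where F: "finite F" "connected_on E F" "c \<in> F" "a 0 \<in> F"
        using reach_finite_support[of E V c "a 0"] \<open>c \<in> V\<close> by blast
      have "\<forall>\<^sub>F n in sequentially. \<forall>f\<in>F. a n \<noteq> f \<and> b n \<noteq> f"
        using F(1) eva evb by (intro eventually_ball_finite) (auto simp: eventually_conj_iff)
      then obtain n where n: "\<forall>f\<in>F. a n \<noteq> f \<and> b n \<noteq> f" using eventually_sequentially by auto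
      have "a 0 \<notin> W n" using mono(1)[of 0 n] notin[of 0] by blast
      moreover have "reach E F c (a 0)" using F by (simp add: connected_on_reach)
      ultimately obtain p q where pq: "p \<in> W n \<inter> F" "q \<in> F - W n" "{p, q} \<in> E"
        using reach_exit[of E F c "a 0" "W n"] c by blast
      then have "q \<in> W n \<union> {a n, b n}" using s[of n] by (auto simp: sep_def nb_def)
      then show False using pq n by blast
    qed
    then obtain n where "c \<notin> W n" by blast
    then have "c \<notin> W m" if "m \<ge> n" for m using mono(1)[OF that] by blast
    then show ?thesis unfolding eventually_sequentially by blast
  qed
  have "\<forall>\<^sub>F n in sequentially. \<forall>c\<in>S. c \<notin> W n \<and> a n \<noteq> c \<and> b n \<noteq> c"
    using fin evW eva evb by (intro eventually_ball_finite) (auto simp: eventually_conj_iff)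
  then show ?thesis by (rule eventually_mono) blast
qed

end

text \<open>\<open>Node \<alpha> \<beta> a b W\<close> stands for the arc of angles \<open>[\<alpha>, \<beta>]\<close>, whose end points carry the
  vertices \<open>a\<close> and \<open>b\<close>, and the set \<open>W\<close> of vertices that still have to be placed inside it.\<close>

datatype 'a node = Node (lo: real) (hi: real) (lv: 'a) (rv: 'a) (ws: "'a set")

text \<open>The splitting vertex and the two parts are fixed as functions, so that the tree is a
  plain recursion; a choice supplies them in the end.\<close>

locale arc_tree = outerplanar V E for V :: "'a set" and E :: "'a set set" +
  fixes u0 v0 :: 'a and W0 R0 :: "'a set"
    and cut :: "'a \<Rightarrow> 'a \<Rightarrow> 'a set \<Rightarrow> 'a" and lpart rpart :: "'a \<Rightarrow> 'a \<Rightarrow> 'a set \<Rightarrow> 'a set"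
  assumes V_root: "V = insert u0 (insert v0 (W0 \<union> R0))" and root_disj: "W0 \<inter> R0 = {}"
    and root_half: "half u0 v0 W0" "half v0 u0 R0"
    and parts: "\<And>a b W. half a b W \<Longrightarrow> W \<noteq> {} \<Longrightarrow>
      W = insert (cut a b W) (lpart a b W \<union> rpart a b W) \<and> cut a b W \<notin> lpart a b W \<and> cut a b W \<notin> rpart a b W \<and>
      lpart a b W \<inter> rpart a b W = {} \<and> half a (cut a b W) (lpart a b W) \<and> half (cut a b W) b (rpart a b W)"
begin

section \<open>Levels of the tree\<close>

abbreviation "cutv t \<equiv> cut (lv t) (rv t) (ws t)"
abbreviation "mid t \<equiv> (lo t + hi t) / 2"

definition lch :: "'a node \<Rightarrow> 'a node" where
  "lch t = Node (lo t) (mid t) (lv t) (cutv t) (lpart (lv t) (rv t) (ws t))"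
definition rch :: "'a node \<Rightarrow> 'a node" where
  "rch t = Node (mid t) (hi t) (cutv t) (rv t) (rpart (lv t) (rv t) (ws t))"
text \<open>A finished node is its own only child. Thus every level covers the whole circle and all
  vertices, and levels can be compared node by node.\<close>

definition ch :: "'a node \<Rightarrow> 'a node set" where
  "ch t = (if ws t = {} then {t} else {lch t, rch t})"

fun L :: "nat \<Rightarrow> 'a node set" where
  "L 0 = {Node 0 pi u0 v0 W0, Node pi (2 * pi) v0 u0 R0}"
| "L (Suc n) = (\<Union>t\<in>L n. ch t)"

lemma lch_simps [simp]: "lo (lch t) = lo t" "hi (lch t) = mid t" "lv (lch t) = lv t" "rv (lch t) = cutv t"
  "ws (lch t) = lpart (lv t) (rv t) (ws t)" by (simp_all add: lch_def)
lemma rch_simps [simp]: "lo (rch t) = mid t" "hi (rch t) = hi t" "lv (rch t) = cutv t" "rv (rch t) = rv t"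
  "ws (rch t) = rpart (lv t) (rv t) (ws t)" by (simp_all add: rch_def)

lemma root_facts: "u0 \<notin> W0" "v0 \<notin> W0" "u0 \<notin> R0" "v0 \<notin> R0" "u0 \<noteq> v0"
  using half_sep[OF root_half(1)] half_sep[OF root_half(2)] by (auto simp: sep_def)

lemma L_half: "t \<in> L n \<Longrightarrow> half (lv t) (rv t) (ws t)"
proof (induction n arbitrary: t)
  case 0 then show ?case using root_half by auto
next
  case (Suc n)
  then obtain s where s: "s \<in> L n" "t \<in> ch s" by auto
  show ?case using s Suc.IH[OF s(1)] parts[of "lv s" "rv s" "ws s"] by (auto simp: ch_def split: if_splits)
qed

lemma L_sep: "t \<in> L n \<Longrightarrow> sep (lv t) (rv t) (ws t)"
  using L_half half_sep by blast

lemma L_sepD: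
  assumes "t \<in> L n"
  shows "lv t \<in> V" "rv t \<in> V" "lv t \<noteq> rv t" "ws t \<subseteq> V" "lv t \<notin> ws t" "rv t \<notin> ws t"
    "x \<in> ws t \<Longrightarrow> nb E x \<subseteq> ws t \<union> {lv t, rv t}"
  using L_sep[OF assms] by (auto simp: sep_def)

lemma L_parts:
  assumes "t \<in> L n" "ws t \<noteq> {}"
  shows "ws t = insert (cutv t) (ws (lch t) \<union> ws (rch t))" "cutv t \<notin> ws (lch t)" "cutv t \<notin> ws (rch t)"
    "ws (lch t) \<inter> ws (rch t) = {}" "cutv t \<in> ws t"
  using parts[OF L_half[OF assms(1)] assms(2)] by auto

lemma L_bounds: "t \<in> L n \<Longrightarrow> 0 \<le> lo t \<and> lo t < hi t \<and> hi t \<le> 2 * pi \<and> hi t - lo t \<le> pi"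
proof (induction n arbitrary: t)
  case (Suc n)
  then obtain s where s: "s \<in> L n" "t \<in> ch s" by auto
  show ?case using s(2) Suc.IH[OF s(1)] by (auto simp: ch_def field_simps split: if_splits)
qed auto

text \<open>A node with vertices left to place has only ancestors of the same kind, so its arc has
  been halved at each level. Finished arcs keep their length.\<close>

lemma L_length: "t \<in> L n \<Longrightarrow> ws t \<noteq> {} \<Longrightarrow> hi t - lo t = pi / 2 ^ n"
proof (induction n arbitrary: t)
  case (Suc n)
  then obtain s where s: "s \<in> L n" "t \<in> ch s" by auto
  then have ne: "ws s \<noteq> {}" using Suc.prems(2) by (auto simp: ch_def split: if_splits)
  then have "hi t - lo t = (hi s - lo s) / 2" using s by (auto simp: ch_def field_simps)
  then show ?case using Suc.IH[OF s(1) ne] by simp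
qed auto

lemma finite_L: "finite (L n)"
  by (induction n) (auto simp: ch_def)

lemma L_child:
  assumes "s \<in> L n" "t \<in> ch s"
  shows "lo s \<le> lo t" "hi t \<le> hi s" "ws t \<subseteq> ws s" "lv t \<in> ws s \<union> {lv s}" "rv t \<in> ws s \<union> {rv s}"
proof -
  have "lo s \<le> lo t \<and> hi t \<le> hi s \<and> ws t \<subseteq> ws s \<and> lv t \<in> ws s \<union> {lv s} \<and> rv t \<in> ws s \<union> {rv s}"
  proof (cases "ws s = {}")
    case True then show ?thesis using assms by (auto simp: ch_def)
  next
    case False
    note p = L_parts[OF assms(1) False]
    have t: "t = lch s \<or> t = rch s" using assms False by (auto simp: ch_def)
    have sub: "ws (lch s) \<subseteq> ws s" "ws (rch s) \<subseteq> ws s" using p(1) by blast+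
    show ?thesis using t sub p(5) L_bounds[OF assms(1)] by auto
  qed
  then show "lo s \<le> lo t" "hi t \<le> hi s" "ws t \<subseteq> ws s" "lv t \<in> ws s \<union> {lv s}" "rv t \<in> ws s \<union> {rv s}" by auto
qed

lemma L_disjoint:
  "t \<in> L n \<Longrightarrow> t' \<in> L n \<Longrightarrow> t \<noteq> t' \<Longrightarrow> (hi t \<le> lo t' \<or> hi t' \<le> lo t) \<and> ws t \<inter> ws t' = {}"
proof (induction n arbitrary: t t')
  case 0 then show ?case using root_disj by auto
next
  case (Suc n)
  then obtain s s' where s: "s \<in> L n" "t \<in> ch s" "s' \<in> L n" "t' \<in> ch s'" by auto
  show ?case
  proof (cases "s = s'")
    case False
    then have d: "(hi s \<le> lo s' \<or> hi s' \<le> lo s)" "ws s \<inter> ws s' = {}" using Suc.IH[OF s(1,3)] by auto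
    have "ws t \<inter> ws t' = {}" using d(2) L_child(3)[OF s(1,2)] L_child(3)[OF s(3,4)] by blast
    then show ?thesis using d(1) L_child(1,2)[OF s(1,2)] L_child(1,2)[OF s(3,4)] by linarith
  next
    case True
    then have ne: "ws s \<noteq> {}" using s Suc.prems(3) by (auto simp: ch_def split: if_splits)
    have "(t = lch s \<and> t' = rch s) \<or> (t = rch s \<and> t' = lch s)"
      using s True ne Suc.prems(3) by (auto simp: ch_def)
    then show ?thesis using L_parts(4)[OF s(1) ne] by (auto simp: Int_commute)
  qed
qed

text \<open>A newly placed vertex comes out of the waiting set of its own node, which is disjoint
  from the other waiting sets and is passed on without that vertex.\<close>

lemma L_endpoints:
  "t \<in> L n \<Longrightarrow> t' \<in> L n \<Longrightarrow> lv t \<notin> ws t' \<and> rv t \<notin> ws t'"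
proof (induction n arbitrary: t t')
  case 0 then show ?case using root_facts by auto
next
  case (Suc n)
  then obtain s s' where s: "s \<in> L n" "t \<in> ch s" "s' \<in> L n" "t' \<in> ch s'" by auto
  show ?case
  proof (cases "s = s'")
    case False
    then have d: "ws s \<inter> ws s' = {}" using L_disjoint[OF s(1,3)] by auto
    have "lv t \<notin> ws s'" using d Suc.IH[OF s(1,3)] L_child(4)[OF s(1,2)] by auto
    moreover have "rv t \<notin> ws s'" using d Suc.IH[OF s(1,3)] L_child(5)[OF s(1,2)] by auto
    ultimately show ?thesis using L_child(3)[OF s(3,4)] by auto
  next
    case True
    show ?thesis
    proof (cases "ws s = {}")
      case True with \<open>s = s'\<close> show ?thesis using s by (auto simp: ch_def)
    next
      case False
      note p = L_parts[OF s(1) False]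
      have t: "t = lch s \<or> t = rch s" "t' = lch s \<or> t' = rch s" using s False True by (auto simp: ch_def)
      have "ws t' \<subseteq> ws s" "cutv s \<notin> ws t'" using t(2) p(1,2,3) by blast+
      then show ?thesis using t(1) L_sepD(5,6)[OF s(1)] by auto
    qed
  qed
qed

lemma L_cover: "V = (\<Union>t\<in>L n. insert (lv t) (ws t))"
proof (induction n)
  case 0 then show ?case using V_root by auto
next
  case (Suc n)
  have "(\<Union>t\<in>ch s. insert (lv t) (ws t)) = insert (lv s) (ws s)" if s: "s \<in> L n" for s
  proof (cases "ws s = {}")
    case False
    show ?thesis using L_parts(1)[OF s False] False by (auto simp: ch_def simp del: rch_simps(5) lch_simps(5))
  qed (simp add: ch_def)
  then have "(\<Union>t\<in>L (Suc n). insert (lv t) (ws t)) = (\<Union>s\<in>L n. insert (lv s) (ws s))" by simp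
  with Suc show ?case by simp
qed

text \<open>New left ends are cut vertices taken from pairwise disjoint waiting sets, and old ones
  are no longer waiting.\<close>

lemma L_lv_inj: "t \<in> L n \<Longrightarrow> t' \<in> L n \<Longrightarrow> lv t = lv t' \<Longrightarrow> t = t'"
proof (induction n arbitrary: t t')
  case 0 then show ?case using root_facts by auto
next
  case (Suc n)
  then obtain s s' where s: "s \<in> L n" "t \<in> ch s" "s' \<in> L n" "t' \<in> ch s'" by auto
  have A: "lv t = lv s \<and> t = (if ws s = {} then s else lch s) \<or> ws s \<noteq> {} \<and> t = rch s \<and> lv t = cutv s \<and> cutv s \<in> ws s"
    if "s \<in> L n" "t \<in> ch s" for s t
    using that L_parts(5)[OF that(1)] by (auto simp: ch_def split: if_splits)
  from A[OF s(1,2)] A[OF s(3,4)] show ?case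
  proof (elim disjE conjE)
    assume "lv t = lv s" "lv t' = lv s'" "t = (if ws s = {} then s else lch s)" "t' = (if ws s' = {} then s' else lch s')"
    moreover from this have "s = s'" using Suc.IH[OF s(1,3)] Suc.prems(3) by simp
    ultimately show ?thesis by simp
  next
    assume "lv t = lv s" "lv t' = cutv s'" "cutv s' \<in> ws s'"
    then show ?thesis using L_endpoints[OF s(1,3)] Suc.prems(3) by simp
  next
    assume "lv t' = lv s'" "lv t = cutv s" "cutv s \<in> ws s"
    then show ?thesis using L_endpoints[OF s(3,1)] Suc.prems(3) by simp
  next
    assume "t = rch s" "t' = rch s'" "lv t = cutv s" "cutv s \<in> ws s" "lv t' = cutv s'" "cutv s' \<in> ws s'"
    moreover from this have "s = s'" using L_disjoint[OF s(1,3)] Suc.prems(3) by auto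
    ultimately show ?thesis by simp
  qed
qed

lemma L_leaf_persist:
  assumes "t \<in> L n" "ws t = {}" "n \<le> m" shows "t \<in> L m"
  using assms(3,1,2)
proof (induction m rule: dec_induct)
  case (step m) then show ?case by (auto simp: ch_def intro!: bexI[of _ t])
qed simp

lemma L_lv_persist:
  assumes "t \<in> L n" "n \<le> m" shows "\<exists>t'\<in>L m. lv t' = lv t \<and> lo t' = lo t"
  using assms(2,1)
proof (induction m rule: dec_induct)
  case (step m)
  then obtain s where s: "s \<in> L m" "lv s = lv t" "lo s = lo t" by blast
  have "(if ws s = {} then s else lch s) \<in> ch s" by (auto simp: ch_def)
  then have "(if ws s = {} then s else lch s) \<in> L (Suc m)" using s(1) unfolding L.simps by blast
  then show ?case using s(2,3) by (intro bexI[of _ "if ws s = {} then s else lch s"]) (simp_all del: L.simps)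
qed auto

text \<open>The nodes of a level follow each other around the circle. The alternative with
  \<open>2 * pi\<close> closes the cycle and is the reason why positions of right ends are compared
  through \<open>cis\<close>.\<close>

lemma L_next: "t \<in> L n \<Longrightarrow> \<exists>t'\<in>L n. lv t' = rv t \<and> (lo t' = hi t \<or> (hi t = 2 * pi \<and> lo t' = 0))"
proof (induction n arbitrary: t)
  case (Suc n)
  then obtain s where s: "s \<in> L n" "t \<in> ch s" by auto
  obtain s' where s': "s' \<in> L n" "lv s' = rv s" "lo s' = hi s \<or> (hi s = 2 * pi \<and> lo s' = 0)"
    using Suc.IH[OF s(1)] by blast
  obtain s'' where s'': "s'' \<in> L (Suc n)" "lv s'' = rv s" "lo s'' = lo s'"
    using L_lv_persist[OF s'(1), of "Suc n"] s'(2) by auto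
  show ?case
  proof (cases "ws s \<noteq> {} \<and> t = lch s")
    case True
    then have "rch s \<in> L (Suc n)" using s by (auto simp: ch_def)
    then show ?thesis using True by (intro bexI[of _ "rch s"]) auto
  next
    case False
    then have "rv t = rv s" "hi t = hi s" using s by (auto simp: ch_def split: if_splits)
    then show ?thesis using s'' s' by metis
  qed
qed auto

lemma L_ancestor:
  assumes "t \<in> L m" "n \<le> m"
  shows "\<exists>s\<in>L n. lo s \<le> lo t \<and> hi t \<le> hi s \<and> ws t \<subseteq> ws s \<and> lv t \<in> ws s \<union> {lv s} \<and> rv t \<in> ws s \<union> {rv s}"
  using assms(2,1)
proof (induction m arbitrary: t rule: dec_induct)
  case (step m)
  then obtain r where r: "r \<in> L m" "t \<in> ch r" by auto
  obtain s where s: "s \<in> L n" "lo s \<le> lo r" "hi r \<le> hi s" "ws r \<subseteq> ws s" "lv r \<in> ws s \<union> {lv s}" "rv r \<in> ws s \<union> {rv s}"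
    using step.IH[OF r(1)] by blast
  note c = L_child[OF r]
  show ?case using s c by (intro bexI[of _ s]) auto
qed auto

text \<open>Left ends are used because every vertex eventually is one, at a single permanent angle;
  \<open>u0\<close> then gets 0 and not \<open>2 * pi\<close>.\<close>

definition pos :: "'a \<Rightarrow> real" where
  "pos v = (SOME \<theta>. \<exists>n. \<exists>t\<in>L n. lv t = v \<and> lo t = \<theta>)"

lemma lv_lo_unique:
  assumes "t \<in> L n" "t' \<in> L m" "lv t = lv t'"
  shows "lo t = lo t'"
proof -
  obtain s where s: "s \<in> L (max n m)" "lv s = lv t" "lo s = lo t" using L_lv_persist[OF assms(1), of "max n m"] by auto
  obtain s' where s': "s' \<in> L (max n m)" "lv s' = lv t'" "lo s' = lo t'" using L_lv_persist[OF assms(2), of "max n m"] by auto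
  have "s = s'" using L_lv_inj[OF s(1) s'(1)] s s' assms by simp
  then show ?thesis using s s' by simp
qed

lemma pos_lv: "t \<in> L n \<Longrightarrow> pos (lv t) = lo t"
  unfolding pos_def by (rule some_equality) (use lv_lo_unique in blast)+

lemma pos_rv: "t \<in> L n \<Longrightarrow> cis (pos (rv t)) = cis (hi t)"
proof -
  assume t: "t \<in> L n"
  then obtain t' where t': "t' \<in> L n" "lv t' = rv t" "lo t' = hi t \<or> (hi t = 2 * pi \<and> lo t' = 0)"
    using L_next by blast
  have "pos (rv t) = lo t'" using pos_lv[OF t'(1)] t'(2) by simp
  then show ?thesis using t'(3) by auto
qed

section \<open>Infinite branches\<close>

definition is_chain :: "(nat \<Rightarrow> 'a node) \<Rightarrow> bool" where
  "is_chain t \<longleftrightarrow> (\<forall>n. t n \<in> L n \<and> ws (t n) \<noteq> {} \<and> t (Suc n) \<in> ch (t n))"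

lemma is_chain_step:
  assumes "is_chain t"
  shows "ws (t (Suc n)) \<subseteq> ws (t n) \<and> ((lv (t (Suc n)) = lv (t n) \<and> rv (t (Suc n)) \<in> ws (t n)) \<or>
     (rv (t (Suc n)) = rv (t n) \<and> lv (t (Suc n)) \<in> ws (t n)))"
proof -
  have t: "t n \<in> L n" "ws (t n) \<noteq> {}" "t (Suc n) \<in> ch (t n)" using assms by (auto simp: is_chain_def)
  have "t (Suc n) = lch (t n) \<or> t (Suc n) = rch (t n)" using t by (auto simp: ch_def)
  then show ?thesis using L_child(3)[OF t(1,3)] L_parts(5)[OF t(1,2)] by auto
qed

lemma is_chain_sep: "is_chain t \<Longrightarrow> sep (lv (t n)) (rv (t n)) (ws (t n))"
  using L_sep by (auto simp: is_chain_def)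

lemma chain_avoids:
  assumes "is_chain t" "finite S"
  shows "\<forall>\<^sub>F n in sequentially. (ws (t n) \<union> {lv (t n), rv (t n)}) \<inter> S = {}"
  by (rule chain_leaves[of "\<lambda>n. lv (t n)" "\<lambda>n. rv (t n)" "\<lambda>n. ws (t n)",
        OF is_chain_sep[OF assms(1)] _ is_chain_step[OF assms(1)] assms(2)])
    (use assms in \<open>simp add: is_chain_def\<close>)

lemma chain_mono':
  assumes "is_chain t" "n \<le> m"
  shows "ws (t m) \<subseteq> ws (t n)" "lv (t m) \<in> ws (t n) \<union> {lv (t n)}" "rv (t m) \<in> ws (t n) \<union> {rv (t n)}"
    "lo (t n) \<le> lo (t m)" "hi (t m) \<le> hi (t n)"
proof -
  show "ws (t m) \<subseteq> ws (t n)" "lv (t m) \<in> ws (t n) \<union> {lv (t n)}" "rv (t m) \<in> ws (t n) \<union> {rv (t n)}"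
    using chain_mono[of "\<lambda>n. ws (t n)" "\<lambda>n. lv (t n)" "\<lambda>n. rv (t n)", OF is_chain_step[OF assms(1)] assms(2)] .
  have "lo (t n) \<le> lo (t m) \<and> hi (t m) \<le> hi (t n)" using assms(2)
  proof (induction m rule: dec_induct)
    case (step m)
    then show ?case using L_child(1,2)[of "t m" m "t (Suc m)"] assms(1) by (force simp: is_chain_def)
  qed auto
  then show "lo (t n) \<le> lo (t m)" "hi (t m) \<le> hi (t n)" by auto
qed

text \<open>The two attachment vertices of node \<open>n\<close> form a finite set, which deep nodes
  avoid. So a deep node, attachments included, lies in the interior of the given one.\<close>

lemma chain_inside:
  assumes "is_chain t"
  shows "\<exists>m\<ge>n. ws (t m) \<union> {lv (t m), rv (t m)} \<subseteq> ws (t n)"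
proof -
  have "\<forall>\<^sub>F m in sequentially. (ws (t m) \<union> {lv (t m), rv (t m)}) \<inter> {lv (t n), rv (t n)} = {}"
    by (rule chain_avoids[OF assms]) auto
  then obtain N where N: "\<And>m. m \<ge> N \<Longrightarrow> (ws (t m) \<union> {lv (t m), rv (t m)}) \<inter> {lv (t n), rv (t n)} = {}"
    unfolding eventually_sequentially by blast
  show ?thesis
  proof (intro exI[of _ "max N n"] conjI)
    show "ws (t (max N n)) \<union> {lv (t (max N n)), rv (t (max N n))} \<subseteq> ws (t n)"
      using N[of "max N n"] chain_mono'(1-3)[OF assms, of n "max N n"] by auto
  qed simp
qed

text \<open>A property held by exactly one node per level and inherited by parents traces out a
  branch. It is applied to containing an unplaced vertex and to containing an end.\<close>

lemma chain_of:
  assumes ex: "\<And>n. \<exists>t\<in>L n. Q t" and uniq: "\<And>n t t'. t \<in> L n \<Longrightarrow> t' \<in> L n \<Longrightarrow> Q t \<Longrightarrow> Q t' \<Longrightarrow> t = t'"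
    and mono: "\<And>n t t'. t \<in> L n \<Longrightarrow> t' \<in> ch t \<Longrightarrow> Q t' \<Longrightarrow> Q t" and ne: "\<And>t. Q t \<Longrightarrow> ws t \<noteq> {}"
  obtains t where "is_chain t" "\<And>n. Q (t n)"
proof -
  obtain t where t: "\<And>n. t n \<in> L n" "\<And>n. Q (t n)" using ex by metis
  have "t (Suc n) \<in> ch (t n)" for n
  proof -
    obtain s where s: "s \<in> L n" "t (Suc n) \<in> ch s" using t(1)[of "Suc n"] by auto
    have "s = t n" using uniq[OF s(1) t(1) mono[OF s t(2)] t(2)] .
    with s show ?thesis by simp
  qed
  then have "is_chain t" using t ne by (auto simp: is_chain_def)
  with t that show thesis by blast
qed

text \<open>A vertex never placed would wait along a whole branch, although branches leave the
  finite set \<open>{v}\<close>.\<close>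

lemma vertex_node: "v \<in> V \<Longrightarrow> \<exists>n. \<exists>t\<in>L n. lv t = v"
proof (rule ccontr)
  assume v: "v \<in> V" and n: "\<not> (\<exists>n. \<exists>t\<in>L n. lv t = v)"
  have ex: "\<exists>t\<in>L n. v \<in> ws t" for n using v n L_cover[of n] by auto
  obtain t where t: "is_chain t" "\<And>n. v \<in> ws (t n)"
    by (rule chain_of[of "\<lambda>t. v \<in> ws t"]) (use ex L_disjoint L_child(3) in blast)+
  then show False using chain_avoids[OF t(1), of "{v}"] by (auto simp: eventually_sequentially)
qed

lemma vertex_node_ge: "v \<in> V \<Longrightarrow> \<exists>N. \<forall>n\<ge>N. \<exists>t\<in>L n. lv t = v"
  using vertex_node L_lv_persist by metis

text \<open>No edge joins the interiors of the two children, as the cut vertex separates them. Only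
  the edge between both attachments of \<open>s\<close> has no child to go to.\<close>

lemma edge_descend:
  assumes s: "s \<in> L n" and e: "e \<in> E" "e \<subseteq> ws s \<union> {lv s, rv s}" "e \<noteq> {lv s, rv s}"
  shows "\<exists>t\<in>ch s. e \<subseteq> ws t \<union> {lv t, rv t}"
proof -
  obtain x y where xy: "e = {x, y}" "x \<noteq> y" using edge_obtain[OF e(1)] by metis
  have ne: "ws s \<noteq> {}" using e xy by auto
  note p = L_parts[OF s ne]
  have c: "lch s \<in> ch s" "rch s \<in> ch s" using ne by (auto simp: ch_def)
  then have cL: "lch s \<in> L (Suc n)" "rch s \<in> L (Suc n)" using s by auto
  have *: ?thesis if x: "x \<in> ws s" and y: "y \<in> nb E x" and exy: "e = {x, y}" for x y
  proof -
    consider "x \<in> ws (lch s)" | "x \<in> ws (rch s)" | "x = cutv s" using x p(1) by blast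
    then show ?thesis
    proof cases
      case 1
      then show ?thesis using L_sepD(7)[OF cL(1) 1] y exy c(1) by (intro bexI[of _ "lch s"]) auto
    next
      case 2
      then show ?thesis using L_sepD(7)[OF cL(2) 2] y exy c(2) by (intro bexI[of _ "rch s"]) auto
    next
      case 3
      have "y \<in> ws s \<union> {lv s, rv s}" using e exy by auto
      then have "y \<in> ws (lch s) \<union> {lv s, cutv s} \<or> y \<in> ws (rch s) \<union> {cutv s, rv s}" using p(1) by blast
      then show ?thesis using 3 exy c by (elim disjE) (intro bexI[of _ "lch s"] bexI[of _ "rch s"]; auto)+
    qed
  qed
  have "x \<in> ws s \<or> y \<in> ws s" using e xy by auto
  then show ?thesis using *[of x y] *[of y x] xy e(1) by (auto simp: nb_def insert_commute)
qed

lemma edge_root: "e \<in> E \<Longrightarrow> \<exists>t\<in>L 0. e \<subseteq> ws t \<union> {lv t, rv t}"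
proof -
  assume e: "e \<in> E"
  obtain x y where xy: "e = {x, y}" "x \<in> V" "y \<in> V" "x \<noteq> y" using edge_obtain[OF e] by metis
  have "y \<in> nb E x" "x \<in> nb E y" using e xy by (auto simp: nb_def insert_commute)
  moreover have "nb E z \<subseteq> W0 \<union> {u0, v0}" if "z \<in> W0" for z using root_half(1) that by (auto simp: half_def sep_def)
  moreover have "nb E z \<subseteq> R0 \<union> {v0, u0}" if "z \<in> R0" for z using root_half(2) that by (auto simp: half_def sep_def)
  moreover have "e = {u0, v0} \<or> x \<in> W0 \<or> x \<in> R0 \<or> y \<in> W0 \<or> y \<in> R0" using xy V_root by auto
  ultimately have "e \<subseteq> W0 \<union> {u0, v0} \<or> e \<subseteq> R0 \<union> {v0, u0}" using xy(1) by blast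
  then show ?thesis by auto
qed

text \<open>An edge is passed down the tree until it joins the two attachments of its node. This
  happens at the latest on a level where both of its ends are placed.\<close>

lemma edge_node: "e \<in> E \<Longrightarrow> \<exists>n. \<exists>t\<in>L n. e = {lv t, rv t}"
proof (rule ccontr)
  assume e: "e \<in> E" and no: "\<not> (\<exists>n. \<exists>t\<in>L n. e = {lv t, rv t})"
  have d: "\<exists>t\<in>L n. e \<subseteq> ws t \<union> {lv t, rv t}" for n
  proof (induction n)
    case 0
    show ?case by (rule edge_root[OF e])
  next
    case (Suc n)
    then obtain s where s: "s \<in> L n" "e \<subseteq> ws s \<union> {lv s, rv s}" by blast
    then show ?case using edge_descend[OF s(1) e s(2)] no by auto
  qed
  obtain x y where xy: "e = {x, y}" "x \<in> V" "y \<in> V" "x \<noteq> y" using edge_obtain[OF e] by metis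
  obtain N1 where N1: "\<forall>n\<ge>N1. \<exists>t\<in>L n. lv t = x" using vertex_node_ge xy by blast
  obtain N2 where N2: "\<forall>n\<ge>N2. \<exists>t\<in>L n. lv t = y" using vertex_node_ge xy by blast
  obtain t where t: "t \<in> L (max N1 N2)" "e \<subseteq> ws t \<union> {lv t, rv t}" using d by blast
  obtain t1 t2 where "t1 \<in> L (max N1 N2)" "lv t1 = x" "t2 \<in> L (max N1 N2)" "lv t2 = y" using N1 N2 by (meson max.cobounded1 max.cobounded2)
  then have "x \<notin> ws t" "y \<notin> ws t" using L_endpoints t(1) by blast+
  then have "e = {lv t, rv t}" using t(2) xy L_sepD(3)[OF t(1)] by auto
  then show False using no t(1) by blast
qed

end

section \<open>Compactness\<close>

context sgraph
begin

text \<open>Unlike \<open>end_comp\<close> this refers to no finite separator and is monotone in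
  \<open>W\<close>. All rays of the end are required, so any chosen one may be used.\<close>

definition lives :: "(nat \<Rightarrow> 'a) set \<Rightarrow> 'a set \<Rightarrow> bool" where
  "lives \<omega> W \<longleftrightarrow> (\<forall>r\<in>\<omega>. \<exists>n. \<forall>k\<ge>n. r k \<in> W)"

lemma lives_mono: "lives \<omega> W \<Longrightarrow> W \<subseteq> W' \<Longrightarrow> lives \<omega> W'"
  unfolding lives_def by (meson subsetD)

lemma lives_disjoint:
  assumes "\<omega> \<in> ends V E" "lives \<omega> W" "lives \<omega> W'"
  shows "W \<inter> W' \<noteq> {}"
proof -
  obtain r where r: "r \<in> \<omega>" using end_obtain_ray[OF assms(1)] by metis
  obtain n m where "\<forall>k\<ge>n. r k \<in> W" "\<forall>k\<ge>m. r k \<in> W'" using assms r unfolding lives_def by metis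
  then have "r (max n m) \<in> W \<inter> W'" by simp
  then show ?thesis by blast
qed

text \<open>The finite set \<open>S\<close> bounds \<open>W\<close>; equivalent rays are eventually
  joined outside \<open>S\<close>, and such a connection cannot leave \<open>W\<close>.\<close>

lemma lives_of_ray:
  assumes \<omega>: "\<omega> \<in> ends V E" "r \<in> \<omega>" and W: "\<And>x. x \<in> W \<Longrightarrow> nb E x \<subseteq> W \<union> S" "finite S"
    and r: "\<forall>k\<ge>n. r k \<in> W"
  shows "lives \<omega> W"
  unfolding lives_def
proof
  fix r' assume "r' \<in> \<omega>"
  then have "ray_equiv V E r r'" using end_eq_class[OF \<omega>] by blast
  then obtain m where m: "\<forall>k\<ge>m. reach E (V - S) (r k) (r' k)" using W(2) unfolding ray_equiv_def by blast
  show "\<exists>n. \<forall>k\<ge>n. r' k \<in> W"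
  proof (intro exI[of _ "max n m"] allI impI)
    fix k assume k: "max n m \<le> k"
    then have "reach E (V - S) (r k) (r' k)" using m by simp
    then show "r' k \<in> W" by (rule reach_closed) (use k r W(1) in \<open>auto simp: nb_def\<close>)
  qed
qed

lemma ray_stays:
  assumes "is_ray E r" "r n \<in> W" "\<And>x. x \<in> W \<Longrightarrow> nb E x \<subseteq> W \<union> S" "\<forall>k\<ge>n. r k \<notin> S" "n \<le> k"
  shows "r k \<in> W"
  using assms(5)
proof (induction k rule: dec_induct)
  case (step k)
  have "r (Suc k) \<in> nb E (r k)" using assms(1) by (auto simp: is_ray_def nb_def)
  moreover have "r (Suc k) \<notin> S" using assms(4) step by simp
  ultimately show ?case using assms(3)[OF step.IH] by blast
qed (rule assms(2))

section \<open>Graph distance and geodesic rays\<close>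

definition gdist :: "'a \<Rightarrow> 'a \<Rightarrow> nat" where
  "gdist x y = (LEAST n. (x, y) \<in> {(x, y). {x, y} \<in> E} ^^ n)"

text \<open>The walk has to enter \<open>W\<close> through \<open>S\<close>. The lengths of both
  parts are kept, to be compared with distances in \<open>chain_end\<close>.\<close>

lemma walk_through:
  assumes "(x, y) \<in> {(x, y). {x, y} \<in> E} ^^ n" "x \<notin> W" "y \<in> W" "\<And>z. z \<in> W \<Longrightarrow> nb E z \<subseteq> W \<union> S"
  shows "\<exists>s\<in>S. \<exists>i j. i + j = n \<and> (x, s) \<in> {(x, y). {x, y} \<in> E} ^^ i \<and> (s, y) \<in> {(x, y). {x, y} \<in> E} ^^ j"
  using assms(1,2)
proof (induction n arbitrary: x)
  case 0 then show ?case using assms(3) by auto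
next
  case (Suc n)
  show ?case
  proof (cases "x \<in> S")
    case True
    then show ?thesis using Suc.prems(1) by (intro bexI[of _ x] exI[of _ 0] exI[of _ "Suc n"]) auto
  next
    case False
    obtain z where z: "{x, z} \<in> E" "(z, y) \<in> {(x, y). {x, y} \<in> E} ^^ n" using relpow_Suc_D2[OF Suc.prems(1)] by auto
    have "z \<notin> W"
    proof
      assume "z \<in> W"
      then have "x \<in> W \<union> S" using assms(4)[of z] z(1) by (auto simp: nb_def insert_commute)
      with False Suc.prems show False by blast
    qed
    then obtain s i j where s: "s \<in> S" "i + j = n" "(z, s) \<in> {(x, y). {x, y} \<in> E} ^^ i" "(s, y) \<in> {(x, y). {x, y} \<in> E} ^^ j"
      using Suc.IH[OF z(2)] by blast
    have "(x, s) \<in> {(x, y). {x, y} \<in> E} ^^ (Suc i)" using relpow_Suc_I2[of x z _ s i] z(1) s(3) by auto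
    then show ?thesis using s by (intro bexI[of _ s] exI[of _ "Suc i"] exI[of _ j]) auto
  qed
qed

lemma gdist_le: "(x, y) \<in> {(x, y). {x, y} \<in> E} ^^ n \<Longrightarrow> gdist x y \<le> n"
  unfolding gdist_def by (rule Least_le)

context
  assumes con: "connected_on E V"
begin

lemma gdist_walk: "x \<in> V \<Longrightarrow> y \<in> V \<Longrightarrow> (x, y) \<in> {(x, y). {x, y} \<in> E} ^^ gdist x y"
proof -
  assume "x \<in> V" "y \<in> V"
  then have "reach E V x y" using con by (simp add: connected_on_reach)
  then have "\<exists>n. (x, y) \<in> {(x, y). {x, y} \<in> E} ^^ n"
  proof (induction rule: reach_induct)
    case refl show ?case by (rule exI[of _ 0]) simp
  next
    case (step y z)
    then obtain n where "(x, y) \<in> {(x, y). {x, y} \<in> E} ^^ n" by blast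
    then have "(x, z) \<in> {(x, y). {x, y} \<in> E} ^^ (Suc n)" using step by auto
    then show ?case by blast
  qed
  then show ?thesis unfolding gdist_def by (rule LeastI_ex)
qed

lemma gdist_triangle: "x \<in> V \<Longrightarrow> y \<in> V \<Longrightarrow> z \<in> V \<Longrightarrow> gdist x z \<le> gdist x y + gdist y z"
  using gdist_le[of x z "gdist x y + gdist y z"] gdist_walk[of x y] gdist_walk[of y z]
  by (auto simp: relpow_add)

lemma gdist_nb: "y \<in> nb E x \<Longrightarrow> gdist x y \<le> 1"
  using gdist_le[of x y 1] by (auto simp: nb_def)

lemma gdist_step:
  assumes "x \<in> V" "y \<in> V" "x \<noteq> y"
  shows "\<exists>z\<in>nb E x. gdist x y = Suc (gdist z y)"
proof -
  have w: "(x, y) \<in> {(x, y). {x, y} \<in> E} ^^ gdist x y" using gdist_walk assms by blast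
  obtain n where n: "gdist x y = Suc n" using w assms(3) by (cases "gdist x y") auto
  obtain z where z: "{x, z} \<in> E" "(z, y) \<in> {(x, y). {x, y} \<in> E} ^^ n" using w n relpow_Suc_D2[of x y n] by auto
  have zn: "z \<in> nb E x" using z by (simp add: nb_def)
  then have "z \<in> V" using nb_subset by blast
  have "gdist z y \<le> n" using gdist_le z by blast
  moreover have "gdist x y \<le> gdist x z + gdist z y" using gdist_triangle assms \<open>z \<in> V\<close> by blast
  ultimately have "gdist x y = Suc (gdist z y)" using n gdist_nb[OF zn] by linarith
  then show ?thesis using zn by blast
qed

lemma gdist_self [simp]: "gdist x x = 0"
  using gdist_le[of x x 0] by simp

text \<open>Koenig's lemma along geodesics: every prefix of the ray is a prefix of geodesics to infinitely many of the given vertices.\<close>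

lemma geodesic_ray:
  assumes fin: "\<And>x. x \<in> V \<Longrightarrow> finite (nb E x)" and xs: "\<And>n. xs n \<in> V"
    and sparse: "\<And>x. \<forall>\<^sub>F n in sequentially. xs n \<noteq> x" and \<rho>: "\<rho> \<in> V"
  obtains q where "is_ray E q" "\<And>k. gdist \<rho> (q k) = k" "\<And>k. q k \<in> V"
    "\<And>k. \<exists>\<^sub>F n in sequentially. gdist \<rho> (q k) + gdist (q k) (xs n) = gdist \<rho> (xs n)"
proof -
  define Q where "Q x \<longleftrightarrow> x \<in> V \<and> (\<exists>\<^sub>F n in sequentially. gdist \<rho> x + gdist x (xs n) = gdist \<rho> (xs n))" for x
  have step: "\<exists>y. Q y \<and> y \<in> nb E x \<and> gdist \<rho> y = Suc (gdist \<rho> x)" if x: "Q x" for x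
  proof -
    have xV: "x \<in> V" using x by (simp add: Q_def)
    have "\<exists>\<^sub>F n in sequentially. gdist \<rho> x + gdist x (xs n) = gdist \<rho> (xs n) \<and> xs n \<noteq> x"
      using x frequently_eventually_frequently[OF _ sparse] by (auto simp: Q_def)
    then have "\<exists>\<^sub>F n in sequentially. \<exists>y\<in>nb E x. gdist \<rho> y = Suc (gdist \<rho> x) \<and> gdist \<rho> y + gdist y (xs n) = gdist \<rho> (xs n)"
    proof (rule frequently_elim1)
      fix n assume n: "gdist \<rho> x + gdist x (xs n) = gdist \<rho> (xs n) \<and> xs n \<noteq> x"
      then obtain y where y: "y \<in> nb E x" "gdist x (xs n) = Suc (gdist y (xs n))" using gdist_step[OF xV xs] by metis
      then have yV: "y \<in> V" using nb_subset by blast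
      have "gdist \<rho> y \<le> gdist \<rho> x + gdist x y" "gdist \<rho> (xs n) \<le> gdist \<rho> y + gdist y (xs n)"
        using gdist_triangle \<rho> xV yV xs by blast+
      then show "\<exists>y\<in>nb E x. gdist \<rho> y = Suc (gdist \<rho> x) \<and> gdist \<rho> y + gdist y (xs n) = gdist \<rho> (xs n)"
        using y gdist_nb[OF y(1)] n by (intro bexI[of _ y]) auto
    qed
    \<comment> \<open>Local finiteness: one of the finitely many neighbours serves infinitely many
      of the targets.\<close>
    from frequently_bex_finite[OF fin[OF xV] this] obtain y where y: "y \<in> nb E x" "\<exists>\<^sub>F n in sequentially. gdist \<rho> y = Suc (gdist \<rho> x) \<and> gdist \<rho> y + gdist y (xs n) = gdist \<rho> (xs n)"
      by blast
    have "gdist \<rho> y = Suc (gdist \<rho> x)" using frequently_ex[OF y(2)] by blast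
    moreover have "\<exists>\<^sub>F n in sequentially. gdist \<rho> y + gdist y (xs n) = gdist \<rho> (xs n)" using y(2) by (rule frequently_elim1) auto
    ultimately show ?thesis using y(1) nb_subset unfolding Q_def by blast
  qed
  have Q0: "Q \<rho>" unfolding Q_def using \<rho> by simp
  have "\<exists>q. \<forall>n::nat. (Q (q n) \<and> (n = 0 \<longrightarrow> q n = \<rho>)) \<and> (q (Suc n) \<in> nb E (q n) \<and> gdist \<rho> (q (Suc n)) = Suc (gdist \<rho> (q n)))"
    by (rule dependent_nat_choice) (use Q0 step in auto)
  then obtain q where q: "\<And>n. Q (q n)" "q 0 = \<rho>" "\<And>n. q (Suc n) \<in> nb E (q n)" "\<And>n. gdist \<rho> (q (Suc n)) = Suc (gdist \<rho> (q n))"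
    by blast
  have d: "gdist \<rho> (q k) = k" for k by (induction k) (use q in auto)
  have "inj q" by (rule inj_on_inverseI[of _ "gdist \<rho>"]) (rule d)
  then have "is_ray E q" using q(3) by (auto simp: is_ray_def nb_def)
  with that d q(1) show thesis by (auto simp: Q_def)
qed

end

end

context arc_tree
begin

lemma node_connected:
  assumes "t \<in> L n" "ws t \<noteq> {}"
  shows "connected_on E (ws t \<union> {lv t, rv t})"
proof -
  have "connected_on E ((ws t \<union> {lv t}) \<union> (ws t \<union> {rv t}))"
    by (rule connected_on_Un[OF sep_connected[OF L_sep[OF assms(1)]] sep_connected[OF sep_sym[OF L_sep[OF assms(1)]]]])
      (use assms(2) in auto)
  moreover have "(ws t \<union> {lv t}) \<union> (ws t \<union> {rv t}) = ws t \<union> {lv t, rv t}" by auto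
  ultimately show ?thesis by simp
qed

text \<open>Once a ray has left the finitely many attachment vertices of level \<open>n\<close>, it
  can no longer change its node.\<close>

lemma end_node:
  assumes \<omega>: "\<omega> \<in> ends V E"
  shows "\<exists>t\<in>L n. lives \<omega> (ws t)"
proof -
  define S where "S = lv ` L n \<union> rv ` L n"
  have S: "finite S" unfolding S_def using finite_L by blast
  obtain r where r: "r \<in> \<omega>" "is_ray E r" using end_obtain_ray[OF \<omega>] .
  obtain N where N: "\<forall>k\<ge>N. r k \<notin> S" using ray_leaves[OF r(2) S] by blast
  have "r N \<in> (\<Union>t\<in>L n. insert (lv t) (ws t))" using ray_in_V[OF r(2)] L_cover[of n] by blast
  then obtain t where t: "t \<in> L n" "r N \<in> insert (lv t) (ws t)" by blast
  moreover have "r N \<noteq> lv t" using N t by (auto simp: S_def)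
  ultimately have tN: "r N \<in> ws t" by simp
  have lr: "lv t \<in> S" "rv t \<in> S" using t by (auto simp: S_def)
  have cl: "nb E x \<subseteq> ws t \<union> S" if "x \<in> ws t" for x using L_sepD(7)[OF t(1) that] lr by blast
  have stay: "\<forall>k\<ge>N. r k \<in> ws t" using ray_stays[OF r(2) tN cl N] by blast
  have "lives \<omega> (ws t)" by (rule lives_of_ray[OF \<omega> r(1) _ S stay]) (rule cl)
  with t show ?thesis by blast
qed

lemma end_node_unique:
  assumes "\<omega> \<in> ends V E" "t \<in> L n" "t' \<in> L n" "lives \<omega> (ws t)" "lives \<omega> (ws t')"
  shows "t = t'"
  using L_disjoint[OF assms(2,3)] lives_disjoint[OF assms(1,4,5)] by blast

lemma end_chain:
  assumes \<omega>: "\<omega> \<in> ends V E"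
  obtains t where "is_chain t" "\<And>n. lives \<omega> (ws (t n))"
proof (rule chain_of[of "\<lambda>t. lives \<omega> (ws t)"])
  show "\<exists>t\<in>L n. lives \<omega> (ws t)" for n by (rule end_node[OF \<omega>])
  show "t = t'" if "t \<in> L n" "t' \<in> L n" "lives \<omega> (ws t)" "lives \<omega> (ws t')" for n t t'
    by (rule end_node_unique[OF \<omega> that])
  show "lives \<omega> (ws t)" if "t \<in> L n" "t' \<in> ch t" "lives \<omega> (ws t')" for n t t'
    using that(3) L_child(3)[OF that(1,2)] by (rule lives_mono)
  show "ws t \<noteq> {}" if "lives \<omega> (ws t)" for t
    using lives_disjoint[OF \<omega> that that] by blast
qed (use that in blast)

text \<open>For finite \<open>S\<close>, a deep node of the branch with its two attachments is
  connected and misses \<open>S\<close>, and the rays of both ends have tails there.\<close>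

lemma chain_end_unique:
  assumes \<omega>: "\<omega> \<in> ends V E" "\<omega>' \<in> ends V E" and t: "is_chain t"
    and l: "\<And>n. lives \<omega> (ws (t n))" "\<And>n. lives \<omega>' (ws (t n))"
  shows "\<omega> = \<omega>'"
proof -
  obtain r where r: "r \<in> \<omega>" using end_obtain_ray[OF \<omega>(1)] by metis
  obtain r' where r': "r' \<in> \<omega>'" using end_obtain_ray[OF \<omega>(2)] by metis
  have "ray_equiv V E r r'" unfolding ray_equiv_def
  proof (intro allI impI)
    fix S :: "'a set" assume "finite S"
    then obtain n where n: "(ws (t n) \<union> {lv (t n), rv (t n)}) \<inter> S = {}"
      using chain_avoids[OF t, THEN eventually_happens] by auto
    obtain N where N: "\<forall>k\<ge>N. r k \<in> ws (t n)" using l(1) r unfolding lives_def by blast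
    obtain N' where N': "\<forall>k\<ge>N'. r' k \<in> ws (t n)" using l(2) r' unfolding lives_def by blast
    have tn: "t n \<in> L n" "ws (t n) \<noteq> {}" using t by (auto simp: is_chain_def)
    note c = node_connected[OF tn]
    have sub: "ws (t n) \<union> {lv (t n), rv (t n)} \<subseteq> V - S" using L_sepD(1,2,4)[OF tn(1)] n by blast
    show "\<exists>n. \<forall>k\<ge>n. r k \<notin> S \<and> r' k \<notin> S \<and> reach E (V - S) (r k) (r' k)"
    proof (intro exI[of _ "max N N'"] allI impI)
      fix k assume "max N N' \<le> k"
      then have k: "r k \<in> ws (t n)" "r' k \<in> ws (t n)" using N N' by auto
      then have "reach E (ws (t n) \<union> {lv (t n), rv (t n)}) (r k) (r' k)" by (intro connected_on_reach[OF c]) auto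
      then have "reach E (V - S) (r k) (r' k)" using sub by (rule reach_mono)
      then show "r k \<notin> S \<and> r' k \<notin> S \<and> reach E (V - S) (r k) (r' k)" using k n by blast
    qed
  qed
  then show ?thesis using ends_eqI[OF \<omega> r r'] by blast
qed

lemma V_connected: "connected_on E V"
  using two_con by (simp add: two_connected_def graph_connected_def)

text \<open>The end is that of a geodesic ray from \<open>\<rho>\<close> towards vertices
  \<open>xs n\<close> chosen inside the nodes. If \<open>q k\<close> is outside node
  \<open>m\<close>, a geodesic through \<open>q k\<close> to some \<open>xs n\<close> in that node
  later passes an attachment of the node, whose distance from \<open>\<rho>\<close> is then at least
  \<open>k\<close>. So all but finitely many \<open>q k\<close> lie in each node.\<close>

lemma chain_end:
  assumes t: "is_chain t"
  shows "\<exists>\<omega>\<in>ends V E. \<forall>n. lives \<omega> (ws (t n))"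
proof -
  have tn: "t n \<in> L n" "ws (t n) \<noteq> {}" for n using t by (auto simp: is_chain_def)
  define xs where "xs n = (SOME x. x \<in> ws (t n))" for n
  have xs: "xs n \<in> ws (t n)" for n unfolding xs_def some_in_eq by (rule tn(2))
  have xsV: "xs n \<in> V" for n using xs L_sepD(4)[OF tn(1)] by blast
  have sparse: "\<forall>\<^sub>F n in sequentially. xs n \<noteq> x" for x
    using chain_avoids[OF t finite.insertI[OF finite.emptyI], of x] by (rule eventually_mono) (use xs in auto)
  define \<rho> where "\<rho> = lv (t 0)"
  have \<rho>: "\<rho> \<in> V" using L_sepD(1)[OF tn(1)] by (simp add: \<rho>_def)
  obtain q where q: "is_ray E q" "\<And>k. gdist \<rho> (q k) = k" "\<And>k. q k \<in> V"
    "\<And>k. \<exists>\<^sub>F n in sequentially. gdist \<rho> (q k) + gdist (q k) (xs n) = gdist \<rho> (xs n)"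
    using geodesic_ray[OF V_connected finite_nb xsV sparse \<rho>] by blast
  have tail: "q k \<in> ws (t m)" if k: "k > gdist \<rho> (lv (t m))" "k > gdist \<rho> (rv (t m))" for k m
  proof (rule ccontr)
    assume nq: "q k \<notin> ws (t m)"
    have "\<exists>n\<ge>m. gdist \<rho> (q k) + gdist (q k) (xs n) = gdist \<rho> (xs n)" using q(4)[of k] by (simp add: frequently_sequentially)
    then obtain n where n: "n \<ge> m" "gdist \<rho> (q k) + gdist (q k) (xs n) = gdist \<rho> (xs n)" by blast
    have xn: "xs n \<in> ws (t m)" using xs chain_mono'(1)[OF t n(1)] by blast
    obtain s i j where s: "s \<in> {lv (t m), rv (t m)}" "i + j = gdist (q k) (xs n)"
      "(q k, s) \<in> {(x, y). {x, y} \<in> E} ^^ i" "(s, xs n) \<in> {(x, y). {x, y} \<in> E} ^^ j"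
      using walk_through[OF gdist_walk[OF V_connected q(3) xsV] nq xn L_sepD(7)[OF tn(1)]] by blast
    have sV: "s \<in> V" using s(1) L_sepD(1,2)[OF tn(1)] by auto
    have "gdist \<rho> (xs n) \<le> gdist \<rho> s + gdist s (xs n)" using gdist_triangle[OF V_connected \<rho> sV xsV] .
    moreover have "gdist s (xs n) \<le> j" using gdist_le s(4) by blast
    ultimately have "gdist \<rho> s \<ge> k" using n(2) s(2) q(2)[of k] by linarith
    then show False using s(1) k by auto
  qed
  define \<omega> where "\<omega> = {r'. is_ray E r' \<and> ray_equiv V E q r'}"
  have \<omega>: "\<omega> \<in> ends V E" "q \<in> \<omega>" using q(1) ray_equiv_refl by (auto simp: \<omega>_def ends_def)
  have "lives \<omega> (ws (t n))" for n
  proof (rule lives_of_ray[OF \<omega>, of _ "{lv (t n), rv (t n)}"])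
    show "nb E x \<subseteq> ws (t n) \<union> {lv (t n), rv (t n)}" if "x \<in> ws (t n)" for x using L_sepD(7)[OF tn(1) that] .
    show "\<forall>k\<ge>Suc (max (gdist \<rho> (lv (t n))) (gdist \<rho> (rv (t n)))). q k \<in> ws (t n)" using tail by auto
  qed auto
  with \<omega> show ?thesis by blast
qed

text \<open>The piece of the compactification that belongs to a node, attachments and the edge
  between them included. Along a branch these pieces are nested and shrink to an end.\<close>

definition blk :: "'a node \<Rightarrow> 'a point set" where
  "blk t = Vtx ` (ws t \<union> {lv t, rv t}) \<union> {Inn p | p e. e \<in> E \<and> e \<subseteq> ws t \<union> {lv t, rv t} \<and> p \<in> inner_pts e} \<union>
     End ` {\<omega> \<in> ends V E. lives \<omega> (ws t)}"

lemma blk_simps [simp]: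
  "Vtx v \<in> blk t \<longleftrightarrow> v \<in> ws t \<union> {lv t, rv t}"
  "Inn p \<in> blk t \<longleftrightarrow> (\<exists>e\<in>E. e \<subseteq> ws t \<union> {lv t, rv t} \<and> p \<in> inner_pts e)"
  "End \<omega> \<in> blk t \<longleftrightarrow> \<omega> \<in> ends V E \<and> lives \<omega> (ws t)"
  by (auto simp: blk_def)

lemma blk_root: "topspace X \<subseteq> (\<Union>t\<in>L 0. blk t)"
proof
  fix x assume "x \<in> topspace X"
  then consider v where "x = Vtx v" "v \<in> V" | p e where "x = Inn p" "e \<in> E" "p \<in> inner_pts e"
    | \<omega> where "x = End \<omega>" "\<omega> \<in> ends V E" unfolding topspace_X by blast
  then show "x \<in> (\<Union>t\<in>L 0. blk t)"
  proof cases
    case 1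
    then obtain t where "t \<in> L 0" "v \<in> insert (lv t) (ws t)" using L_cover[of 0] by blast
    then show ?thesis using 1 by (auto simp del: L.simps intro!: bexI[of _ t])
  next
    case 2
    obtain t where t: "t \<in> L 0" "e \<subseteq> ws t \<union> {lv t, rv t}" using edge_root[OF 2(2)] by blast
    have "x \<in> blk t" unfolding 2(1) blk_simps using 2 t by blast
    with t show ?thesis by blast
  next
    case 3
    obtain t where t: "t \<in> L 0" "lives \<omega> (ws t)" using end_node[OF 3(2)] by blast
    then have "x \<in> blk t" using 3 by simp
    with t show ?thesis by blast
  qed
qed

text \<open>The two attachments of an unfinished node go to different children, so the inner points
  of the edge joining them lie in no child; everything else is inherited.\<close>

lemma blk_child:
  assumes s: "s \<in> L n"
  shows "blk s \<subseteq> (\<Union>t\<in>ch s. blk t) \<union> {Inn p | p. {lv s, rv s} \<in> E \<and> p \<in> inner_pts {lv s, rv s}}"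
proof (cases "ws s = {}")
  case True then show ?thesis by (auto simp: ch_def)
next
  case False
  show ?thesis
  proof
    fix x assume x: "x \<in> blk s"
    show "x \<in> (\<Union>t\<in>ch s. blk t) \<union> {Inn p | p. {lv s, rv s} \<in> E \<and> p \<in> inner_pts {lv s, rv s}}"
    proof (cases x)
      case (Vtx v)
      have c: "ch s = {lch s, rch s}" using False by (simp add: ch_def)
      have "v \<in> ws s \<union> {lv s, rv s}" using x Vtx by simp
      then have "v \<in> ws (lch s) \<union> {lv (lch s), rv (lch s)} \<or> v \<in> ws (rch s) \<union> {lv (rch s), rv (rch s)}"
        using L_parts(1)[OF s False] by auto
      then have "Vtx v \<in> blk (lch s) \<or> Vtx v \<in> blk (rch s)" unfolding blk_simps .
      then show ?thesis unfolding c Vtx by blast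
    next
      case (Inn p)
      then obtain e where e: "e \<in> E" "e \<subseteq> ws s \<union> {lv s, rv s}" "p \<in> inner_pts e" using x by auto
      show ?thesis
      proof (cases "e = {lv s, rv s}")
        case True then show ?thesis using e Inn by auto
      next
        case False
        obtain t where t: "t \<in> ch s" "e \<subseteq> ws t \<union> {lv t, rv t}" using edge_descend[OF s e(1,2) False] by blast
        then have "Inn p \<in> blk t" unfolding blk_simps using e by blast
        then show ?thesis using t Inn by blast
      qed
    next
      case (End \<omega>)
      then have \<omega>: "\<omega> \<in> ends V E" "lives \<omega> (ws s)" using x by auto
      obtain t where t: "t \<in> L (Suc n)" "lives \<omega> (ws t)" using end_node[OF \<omega>(1)] by blast
      then obtain s' where s': "s' \<in> L n" "t \<in> ch s'" by auto
      have "lives \<omega> (ws s')" using t(2) L_child(3)[OF s'] by (rule lives_mono)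
      then have "s' = s" using end_node_unique[OF \<omega>(1) s'(1) s _ \<omega>(2)] by blast
      then show ?thesis using s' t \<omega> End by auto
    qed
  qed
qed

lemma blk_mono:
  assumes "is_chain t" "n \<le> m"
  shows "blk (t m) \<subseteq> blk (t n)"
proof
  note c = chain_mono'(1-3)[OF assms]
  have sub: "ws (t m) \<union> {lv (t m), rv (t m)} \<subseteq> ws (t n) \<union> {lv (t n), rv (t n)}" using c by blast
  fix x assume x: "x \<in> blk (t m)"
  show "x \<in> blk (t n)"
  proof (cases x)
    case (Vtx v) then show ?thesis using x sub by auto
  next
    case (Inn p)
    then obtain e where e: "e \<in> E" "e \<subseteq> ws (t m) \<union> {lv (t m), rv (t m)}" "p \<in> inner_pts e" using x by auto
    show ?thesis unfolding Inn blk_simps using e sub by blast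
  next
    case (End \<omega>) then show ?thesis using x lives_mono[OF _ c(1)] by auto
  qed
qed

text \<open>Among the generating sets only the neighbourhoods of ends contain an end. For one given
  by \<open>S\<close>, a deep node misses \<open>S\<close> and is connected, hence lies in the
  component of the end. Nestedness of the blocks handles finite intersections.\<close>

lemma blk_small:
  assumes t: "is_chain t" and \<omega>: "\<omega> \<in> ends V E" "\<And>n. lives \<omega> (ws (t n))"
    and U: "generate_topology_on (edge_intervals E \<union> vertex_stars V E \<union> end_nbhds V E) U"
  shows "End \<omega> \<in> U \<longrightarrow> (\<exists>n. blk (t n) \<subseteq> U)"
  using U
proof induction
  case (Int a b)
  show ?case
  proof
    assume "End \<omega> \<in> a \<inter> b"
    then obtain n m where nm: "blk (t n) \<subseteq> a" "blk (t m) \<subseteq> b" using Int by blast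
    have "blk (t (max n m)) \<subseteq> a \<inter> b" using nm blk_mono[OF t, of n "max n m"] blk_mono[OF t, of m "max n m"] by auto
    then show "\<exists>n. blk (t n) \<subseteq> a \<inter> b" by blast
  qed
next
  case (UN K) then show ?case by blast
next
  case (Basis s)
  show ?case
  proof
    assume \<omega>s: "End \<omega> \<in> s"
    then have "s \<in> end_nbhds V E" using Basis by (auto simp: edge_intervals_def vertex_stars_def)
    then obtain S \<omega>0 where S: "finite S" "\<omega>0 \<in> ends V E" "s = end_nbhd V E S \<omega>0" by (auto simp: end_nbhds_def)
    define C where "C = end_comp V E S \<omega>"
    have C: "end_comp V E S \<omega>0 = C" using \<omega>s S by (auto simp: end_nbhd_def Let_def C_def)
    obtain n where n: "(ws (t n) \<union> {lv (t n), rv (t n)}) \<inter> S = {}"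
      using eventually_happens[OF chain_avoids[OF t S(1)]] by auto
    have tn: "t n \<in> L n" "ws (t n) \<noteq> {}" using t by (auto simp: is_chain_def)
    define B where "B = ws (t n) \<union> {lv (t n), rv (t n)}"
    have B: "B \<subseteq> V - S" "connected_on E B" using L_sepD(1,2,4)[OF tn(1)] n node_connected[OF tn] by (auto simp: B_def)
    have comp: "end_comp V E S \<omega>' = {v. reach E (V - S) (lv (t n)) v}" if \<omega>': "\<omega>' \<in> ends V E" "lives \<omega>' (ws (t n))" for \<omega>'
    proof -
      obtain r where r: "r \<in> \<omega>'" using end_obtain_ray[OF \<omega>'(1)] by metis
      obtain N where N: "\<forall>k\<ge>N. r k \<in> ws (t n)" using \<omega>'(2) r unfolding lives_def by blast
      then have "\<forall>k\<ge>N. r k \<notin> S" using n by blast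
      then have c: "end_comp V E S \<omega>' = {v. reach E (V - S) (r N) v}" by (rule end_comp_eq[OF \<omega>'(1) r _ S(1)])
      have "r N \<in> B" "lv (t n) \<in> B" using N by (auto simp: B_def)
      then have "reach E B (r N) (lv (t n))" using B(2) by (simp add: connected_on_reach)
      then have rr: "reach E (V - S) (r N) (lv (t n))" using B(1) by (rule reach_mono)
      show ?thesis unfolding c using reach_trans[OF rr] reach_trans[OF reach_sym[OF rr]] by auto
    qed
    have CB: "B \<subseteq> C"
    proof
      fix x assume x: "x \<in> B"
      have "lv (t n) \<in> B" by (simp add: B_def)
      then have "reach E B (lv (t n)) x" using x B(2) by (simp add: connected_on_reach)
      then have "reach E (V - S) (lv (t n)) x" using B(1) by (rule reach_mono)
      then show "x \<in> C" unfolding C_def comp[OF \<omega>(1) \<omega>(2)] by simp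
    qed
    have "blk (t n) \<subseteq> s"
    proof
      fix x assume x: "x \<in> blk (t n)"
      show "x \<in> s"
      proof (cases x)
        case (Vtx v)
        then have "v \<in> B" using x by (simp add: B_def)
        then show ?thesis unfolding S(3) end_nbhd_def Let_def C using CB Vtx by blast
      next
        case (Inn p)
        then obtain e where e: "e \<in> E" "e \<subseteq> B" "p \<in> inner_pts e" using x by (auto simp: B_def)
        obtain a b where "e = {a, b}" by (rule edge_obtain[OF e(1)])
        then have "e \<inter> C \<noteq> {}" using e(2) CB by auto
        then show ?thesis unfolding S(3) end_nbhd_def Let_def C using Inn e by blast
      next
        case (End \<omega>')
        then have \<omega>': "\<omega>' \<in> ends V E" "lives \<omega>' (ws (t n))" using x by auto
        have "end_comp V E S \<omega>' = C" unfolding C_def comp[OF \<omega>'] comp[OF \<omega>(1) \<omega>(2)] ..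
        then show ?thesis unfolding S(3) end_nbhd_def Let_def C using End \<omega>' by blast
      qed
    qed
    then show "\<exists>n. blk (t n) \<subseteq> s" by blast
  qed
qed auto

text \<open>Bisection along the tree. A node whose block has no finite subcover has such a child,
  because at most one edge is lost and an edge is compact. Finished nodes are single edges, so the
  bad nodes form an infinite branch; the member of the cover that contains its end contains a whole
  late block.\<close>

lemma compact_X: "compact_space X"
  unfolding compact_space_alt
proof (intro allI impI, elim conjE)
  fix \<U> assume op: "\<forall>U\<in>\<U>. openin X U" and cov: "topspace X \<subseteq> \<Union>\<U>"
  define fc where "fc K \<longleftrightarrow> (\<exists>\<F>. finite \<F> \<and> \<F> \<subseteq> \<U> \<and> K \<subseteq> \<Union>\<F>)" for K
  have fc_mono: "fc K" if K: "fc K'" "K \<subseteq> K'" for K K' using K unfolding fc_def by (meson subset_trans)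
  have fc_Un: "fc (K \<union> K')" if KK: "fc K" "fc K'" for K K'
  proof -
    obtain F F' where "finite F" "F \<subseteq> \<U>" "K \<subseteq> \<Union>F" "finite F'" "F' \<subseteq> \<U>" "K' \<subseteq> \<Union>F'" using KK unfolding fc_def by metis
    then show ?thesis unfolding fc_def by (intro exI[of _ "F \<union> F'"]) auto
  qed
  have fc_edge: "fc ({Vtx x, Vtx y} \<union> Inn ` inner_pts {x, y})" if e: "{x, y} \<in> E" for x y
  proof -
    have c: "compactin X ({Vtx x, Vtx y} \<union> Inn ` inner_pts {x, y})" by (rule compactin_edge[OF e])
    then have "{Vtx x, Vtx y} \<union> Inn ` inner_pts {x, y} \<subseteq> \<Union>\<U>" using subset_trans[OF compactin_subset_topspace[OF c] cov] by simp
    then show ?thesis using c op unfolding fc_def compactin_def by (elim conjE allE[of _ \<U>] impE) blast+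
  qed
  have fc_edge': "fc {Inn p | p. {x, y} \<in> E \<and> p \<in> inner_pts {x, y}}" for x y
  proof (cases "{x, y} \<in> E")
    case True then show ?thesis by (intro fc_mono[OF fc_edge[OF True]]) auto
  next
    case False then show ?thesis unfolding fc_def by (intro exI[of _ "{}"]) auto
  qed
  have fc_leaf: "fc (blk t)" if t: "t \<in> L n" "ws t = {}" for t n
  proof -
    have lr: "{lv t, rv t} \<in> E" using L_half[OF t(1)] t(2) by (simp add: half_def)
    have "blk t \<subseteq> {Vtx (lv t), Vtx (rv t)} \<union> Inn ` inner_pts {lv t, rv t}"
    proof
      fix x assume x: "x \<in> blk t"
      show "x \<in> {Vtx (lv t), Vtx (rv t)} \<union> Inn ` inner_pts {lv t, rv t}"
      proof (cases x)
        case (Vtx v) then show ?thesis using x t(2) by auto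
      next
        case (Inn p)
        then obtain e where e: "e \<in> E" "e \<subseteq> {lv t, rv t}" "p \<in> inner_pts e" using x t(2) by auto
        obtain a b where "e = {a, b}" "a \<noteq> b" using edge_obtain[OF e(1)] by metis
        then have "e = {lv t, rv t}" using e(2) by auto
        then show ?thesis using e Inn by auto
      next
        case (End \<omega>) then show ?thesis using x t(2) lives_disjoint[of \<omega> "{}" "{}"] by auto
      qed
    qed
    then show ?thesis using fc_edge[OF lr] fc_mono by blast
  qed
  have "fc (topspace X)"
  proof (rule ccontr)
    assume bad: "\<not> fc (topspace X)"
    have root: "\<exists>t. t \<in> L 0 \<and> \<not> fc (blk t)"
    proof (rule ccontr)
      assume "\<nexists>t. t \<in> L 0 \<and> \<not> fc (blk t)"
      then have "fc (blk (Node 0 pi u0 v0 W0) \<union> blk (Node pi (2 * pi) v0 u0 R0))" by (intro fc_Un) auto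
      then have "fc (topspace X)" by (rule fc_mono) (use blk_root in auto)
      with bad show False by blast
    qed
    have step: "\<exists>t'. (t' \<in> L (Suc n) \<and> \<not> fc (blk t')) \<and> t' \<in> ch t" if t: "t \<in> L n \<and> \<not> fc (blk t)" for t n
    proof (rule ccontr)
      assume "\<not> ?thesis"
      then have all: "fc (blk t')" if "t' \<in> ch t" for t' using that t by auto
      have "fc (\<Union>t'\<in>ch t. blk t')"
      proof (cases "ws t = {}")
        case True then show ?thesis using all by (simp add: ch_def)
      next
        case False then show ?thesis using all by (simp add: ch_def fc_Un)
      qed
      then have "fc ((\<Union>t'\<in>ch t. blk t') \<union> {Inn p | p. {lv t, rv t} \<in> E \<and> p \<in> inner_pts {lv t, rv t}})"
        using fc_edge' by (rule fc_Un)
      then have "fc (blk t)" by (rule fc_mono) (use blk_child t in blast)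
      with t show False by blast
    qed
    have "\<exists>t. \<forall>n. (t n \<in> L n \<and> \<not> fc (blk (t n))) \<and> t (Suc n) \<in> ch (t n)"
      by (rule dependent_nat_choice) (use root step in blast)+
    then obtain t where t: "\<And>n. t n \<in> L n" "\<And>n. \<not> fc (blk (t n))" "\<And>n. t (Suc n) \<in> ch (t n)" by blast
    have chn: "is_chain t" unfolding is_chain_def using t fc_leaf by blast
    obtain \<omega> where \<omega>: "\<omega> \<in> ends V E" "\<And>n. lives \<omega> (ws (t n))" using chain_end[OF chn] by blast
    have "End \<omega> \<in> topspace X" using \<omega> by (auto simp: topspace_X)
    then obtain U where U: "U \<in> \<U>" "End \<omega> \<in> U" using cov by blast
    then have "generate_topology_on (edge_intervals E \<union> vertex_stars V E \<union> end_nbhds V E) U"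
      using op openin_topology_generated_by unfolding freudenthal_def by blast
    then obtain n where "blk (t n) \<subseteq> U" using blk_small[OF chn \<omega>] U by blast
    then have "fc (blk (t n))" unfolding fc_def using U by (intro exI[of _ "{U}"]) auto
    with t show False by blast
  qed
  then show "\<exists>\<F>. finite \<F> \<and> \<F> \<subseteq> \<U> \<and> topspace X \<subseteq> \<Union> \<F>" unfolding fc_def .
qed

end

section \<open>The map into the disk\<close>

lemma norm_cis_diff: "cmod (cis a - cis b) \<le> \<bar>a - b\<bar>"
proof -
  have "cis a - cis b = cis b * (cis (a - b) - 1)" by (simp add: cis_mult algebra_simps)
  then have "cmod (cis a - cis b) = cmod (exp (\<i> * of_real (a - b)) - 1)"
    by (simp add: norm_mult cis_conv_exp)
  also have "\<dots> = 2 * \<bar>sin ((a - b) / 2)\<bar>" by (rule dist_exp_i_1)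
  also have "\<dots> \<le> 2 * \<bar>(a - b) / 2\<bar>" using abs_sin_x_le_abs_x[of "(a - b) / 2"] by linarith
  finally show ?thesis by simp
qed

lemma cis_inj_0_2pi:
  assumes "cis a = cis b" "0 \<le> a" "a < 2 * pi" "0 \<le> b" "b < 2 * pi"
  shows "a = b"
proof -
  have "sin a = sin b \<and> cos a = cos b" using assms(1) by (simp add: complex_eq_iff)
  then obtain n :: int where n: "a = b + 2 * pi * of_int n" using sin_cos_eq_iff[of a b] by blast
  then have "2 * pi * of_int n < 2 * pi * 1" "2 * pi * (-1) < 2 * pi * of_int n" using assms(2-5) by linarith+
  moreover have "0 < 2 * pi" by simp
  ultimately have "of_int n < (1::real)" "(-1::real) < of_int n"
    by (simp_all only: mult_less_cancel_left_pos)
  then have "n = 0" by linarith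
  then show ?thesis using n by simp
qed

lemma norm_chord_less_1:
  assumes "cis a \<noteq> cis b" "0 < s" "s < 1"
  shows "cmod (of_real s * cis a + of_real (1 - s) * cis b) < 1"
proof -
  have one: "(cos x)\<^sup>2 + (sin x)\<^sup>2 = 1" for x :: real by simp
  have "(cos a - cos b)\<^sup>2 + (sin a - sin b)\<^sup>2 \<noteq> 0"
    using assms(1) by (simp add: complex_eq_iff sum_power2_eq_zero_iff)
  then have "(cos a - cos b)\<^sup>2 + (sin a - sin b)\<^sup>2 > 0" by (metis sum_power2_ge_zero order_less_le)
  \<comment> \<open>By this identity the squared norm on a chord drops below 1 by
    \<open>s * (1 - s)\<close> times the squared length of the chord.\<close>
  moreover have "(s * x + (1 - s) * y)\<^sup>2 + (s * z + (1 - s) * w)\<^sup>2 =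
      s * (x\<^sup>2 + z\<^sup>2) + (1 - s) * (y\<^sup>2 + w\<^sup>2) - s * (1 - s) * ((x - y)\<^sup>2 + (z - w)\<^sup>2)" for x y z w :: real
    by (simp add: power2_eq_square algebra_simps)
  then have "(cmod (of_real s * cis a + of_real (1 - s) * cis b))\<^sup>2 =
      1 - s * (1 - s) * ((cos a - cos b)\<^sup>2 + (sin a - sin b)\<^sup>2)"
    by (simp add: cmod_power2 one)
  ultimately have "(cmod (of_real s * cis a + of_real (1 - s) * cis b))\<^sup>2 < 1\<^sup>2"
    using assms(2,3) by simp
  then show ?thesis by (rule power_less_imp_less_base) simp
qed

text \<open>The affine functional vanishing on the line through two points of the circle takes at a third point
  of the circle the value given by the product of the two sines; its sign tells the two arcs apart.\<close>

lemma chords_disjoint: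
  assumes ab: "0 \<le> a" "a < b" "b \<le> 2 * pi" and cd: "0 \<le> c" "c \<le> 2 * pi" "0 \<le> d" "d \<le> 2 * pi"
    and side: "(a \<le> c \<and> c \<le> b \<and> a \<le> d \<and> d \<le> b) \<or> (c \<le> a \<and> d \<le> a) \<or> (b \<le> c \<and> b \<le> d)"
    and eq: "of_real s * cis a + of_real (1 - s) * cis b = of_real s' * cis c + of_real (1 - s') * cis d"
    and s': "0 < s'" "s' < 1"
  shows "cis c \<in> {cis a, cis b}" "cis d \<in> {cis a, cis b}"
proof -
  define g where "g x = sin ((x - a) / 2) * sin ((b - x) / 2)" for x
  \<comment> \<open>The line through \<open>cis a\<close> and \<open>cis b\<close> has normal
    direction \<open>cis m\<close> and signed distance \<open>h\<close> from the origin.\<close>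
  define m where "m = (a + b) / 2"
  define h where "h = cos ((b - a) / 2)"
  have g: "Re (cis x * cis (- m)) - h = 2 * g x" for x
  proof -
    have "x - m = (x - a) / 2 - (b - x) / 2" by (simp add: m_def field_simps)
    then have "Re (cis x * cis (- m)) = cos ((x - a) / 2 - (b - x) / 2)" by (simp add: cis_mult)
    moreover have "h = cos ((x - a) / 2 + (b - x) / 2)" by (simp add: h_def field_simps)
    ultimately show ?thesis by (simp add: g_def cos_add cos_diff)
  qed
  have lin: "Re ((of_real r * cis x + of_real (1 - r) * cis y) * cis (- m)) - h = r * (2 * g x) + (1 - r) * (2 * g y)" for r x y
  proof -
    have "Re ((of_real r * cis x + of_real (1 - r) * cis y) * cis (- m)) =
      r * Re (cis x * cis (- m)) + (1 - r) * Re (cis y * cis (- m))" by (simp add: algebra_simps)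
    also have "\<dots> - h = r * (Re (cis x * cis (- m)) - h) + (1 - r) * (Re (cis y * cis (- m)) - h)" by (simp add: algebra_simps)
    finally show ?thesis unfolding g .
  qed
  have "g a = 0" "g b = 0" by (auto simp: g_def)
  moreover have "s * (2 * g a) + (1 - s) * (2 * g b) = s' * (2 * g c) + (1 - s') * (2 * g d)"
    unfolding lin[symmetric] eq ..
  ultimately have zero: "s' * g c + (1 - s') * g d = 0" by simp
  have pos: "g x \<ge> 0" if "a \<le> x" "x \<le> b" for x
    unfolding g_def using that ab by (intro mult_nonneg_nonneg sin_ge_zero) auto
  have neg1: "g x \<le> 0" if "0 \<le> x" "x \<le> a" for x
  proof -
    have "sin ((a - x) / 2) \<ge> 0" "sin ((b - x) / 2) \<ge> 0" using that ab by (intro sin_ge_zero; simp)+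
    moreover have "sin ((x - a) / 2) = - sin ((a - x) / 2)" by (metis minus_diff_eq minus_divide_left sin_minus)
    ultimately show ?thesis unfolding g_def by (simp add: mult_nonneg_nonneg)
  qed
  have neg2: "g x \<le> 0" if "b \<le> x" "x \<le> 2 * pi" for x
  proof -
    have "sin ((x - a) / 2) \<ge> 0" "sin ((x - b) / 2) \<ge> 0" using that ab by (intro sin_ge_zero; simp)+
    moreover have "sin ((b - x) / 2) = - sin ((x - b) / 2)" by (metis minus_diff_eq minus_divide_left sin_minus)
    ultimately show ?thesis unfolding g_def by (simp add: mult_nonneg_nonneg)
  qed
  have sgn: "(g c \<ge> 0 \<and> g d \<ge> 0) \<or> (g c \<le> 0 \<and> g d \<le> 0)"
    using side pos neg1 neg2 cd by blast
  have "s' * g c = 0 \<and> (1 - s') * g d = 0"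
  proof (cases "g c \<ge> 0 \<and> g d \<ge> 0")
    case True
    then have "s' * g c \<ge> 0" "(1 - s') * g d \<ge> 0" using s' by auto
    then show ?thesis using zero by linarith
  next
    case False
    then have "s' * g c \<le> 0" "(1 - s') * g d \<le> 0" using s' sgn by (auto simp: mult_le_0_iff)
    then show ?thesis using zero by linarith
  qed
  then have gz: "g c = 0" "g d = 0" using s' by auto
  have sin0: "cis x = cis y" if "sin ((x - y) / 2) = 0" for x y
  proof -
    have "2 * ((x - y) / 2) = x - y" by simp
    then have "cos (x - y) = 1" "sin (x - y) = 0"
      using that cos_double_sin[of "(x - y) / 2"] sin_double[of "(x - y) / 2"]
      by (simp_all del: times_divide_eq_right)
    then have "cis (x - y) = 1" by (simp add: complex_eq_iff)
    then show ?thesis using cis_divide[of x y] by (metis cis_neq_zero divide_eq_1_iff)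
  qed
  have key: "cis x \<in> {cis a, cis b}" if "g x = 0" for x
    using that sin0[of x a] sin0[of b x] by (auto simp: g_def)
  show "cis c \<in> {cis a, cis b}" "cis d \<in> {cis a, cis b}" using key gz by blast+
qed

section \<open>Angles of vertices and ends, and the drawing of edges\<close>

context arc_tree
begin

lemma chain_strict:
  assumes t: "is_chain t" and "n \<le> m"
  shows "(lv (t m) = lv (t n) \<or> lo (t n) < lo (t m)) \<and> (rv (t m) = rv (t n) \<or> hi (t m) < hi (t n))"
  using assms(2)
proof (induction m rule: dec_induct)
  case (step m)
  have tm: "t m \<in> L m" "ws (t m) \<noteq> {}" "t (Suc m) \<in> ch (t m)" using t by (auto simp: is_chain_def)
  note b = L_bounds[OF tm(1)] chain_mono'(4,5)[OF t step(1)]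
  from tm have "t (Suc m) = lch (t m) \<or> t (Suc m) = rch (t m)" by (auto simp: ch_def)
  then show ?case using step.IH b by (auto simp: field_simps)
qed auto

text \<open>Nested intervals give a common point. The inequalities are strict because both
  attachments, and with them both bounds, change again further down; thus no end is placed on a
  vertex.\<close>

lemma chain_point:
  assumes t: "is_chain t"
  shows "\<exists>\<theta>. \<forall>n. lo (t n) < \<theta> \<and> \<theta> < hi (t n)"
proof -
  have lohi: "lo (t n) \<le> hi (t m)" for n m
  proof -
    have "t (max n m) \<in> L (max n m)" using t by (auto simp: is_chain_def)
    then show ?thesis using L_bounds[of "t (max n m)" "max n m"] chain_mono'(4)[OF t, of n "max n m"]
      chain_mono'(5)[OF t, of m "max n m"] by simp
  qed
  define \<theta> where "\<theta> = (SUP n. lo (t n))"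
  have bdd: "bdd_above (range (\<lambda>n. lo (t n)))" using lohi by (intro bdd_aboveI2[where M = "hi (t 0)"]) auto
  have le: "lo (t n) \<le> \<theta>" for n unfolding \<theta>_def by (rule cSUP_upper[OF _ bdd]) simp
  have ge: "\<theta> \<le> hi (t n)" for n unfolding \<theta>_def by (rule cSUP_least) (use lohi in auto)
  have "lo (t n) < \<theta> \<and> \<theta> < hi (t n)" for n
  proof -
    obtain m where m: "m \<ge> n" "ws (t m) \<union> {lv (t m), rv (t m)} \<subseteq> ws (t n)" using chain_inside[OF t] by blast
    have "t n \<in> L n" using t by (auto simp: is_chain_def)
    then have "lv (t m) \<noteq> lv (t n)" "rv (t m) \<noteq> rv (t n)" using m(2) L_sepD(5,6)[of "t n" n] by auto
    then show ?thesis using chain_strict[OF t m(1)] le[of m] ge[of m] by linarith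
  qed
  then show ?thesis by blast
qed

definition epos :: "(nat \<Rightarrow> 'a) set \<Rightarrow> real" where
  "epos \<omega> = (SOME \<theta>. \<forall>n. \<forall>t\<in>L n. lives \<omega> (ws t) \<longrightarrow> lo t < \<theta> \<and> \<theta> < hi t)"

lemma epos:
  assumes "\<omega> \<in> ends V E" "t \<in> L n" "lives \<omega> (ws t)"
  shows "lo t < epos \<omega>" "epos \<omega> < hi t"
proof -
  obtain c where c: "is_chain c" "\<And>n. lives \<omega> (ws (c n))" using end_chain[OF assms(1)] by blast
  obtain \<theta> where \<theta>: "\<forall>n. lo (c n) < \<theta> \<and> \<theta> < hi (c n)" using chain_point[OF c(1)] by blast
  have "\<forall>n. \<forall>t\<in>L n. lives \<omega> (ws t) \<longrightarrow> lo t < \<theta> \<and> \<theta> < hi t"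
  proof (intro allI ballI impI)
    fix n t assume t: "t \<in> L n" "lives \<omega> (ws t)"
    have "c n \<in> L n" using c by (auto simp: is_chain_def)
    then have "t = c n" using end_node_unique[OF assms(1) t(1) _ t(2) c(2)] by blast
    then show "lo t < \<theta> \<and> \<theta> < hi t" using \<theta> by simp
  qed
  then have "\<forall>n. \<forall>t\<in>L n. lives \<omega> (ws t) \<longrightarrow> lo t < epos \<omega> \<and> epos \<omega> < hi t" unfolding epos_def by (rule someI)
  then show "lo t < epos \<omega>" "epos \<omega> < hi t" using assms by blast+
qed

lemma node_angle_unique:
  assumes "t \<in> L n" "t' \<in> L n" "lo t \<le> \<theta>" "\<theta> < hi t" "lo t' \<le> \<theta>" "\<theta> < hi t'"
  shows "t = t'"
proof (rule ccontr)
  assume "t \<noteq> t'"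
  then have "hi t \<le> lo t' \<or> hi t' \<le> lo t" using L_disjoint[OF assms(1,2)] by blast
  then show False using assms(3-6) by linarith
qed

lemma node_lo_inj: "t \<in> L n \<Longrightarrow> t' \<in> L n \<Longrightarrow> lo t = lo t' \<Longrightarrow> t = t'"
  using node_angle_unique[of t n t' "lo t"] L_bounds[of t n] L_bounds[of t' n] by auto

text \<open>\<open>x\<close> is still waiting on level \<open>n\<close> and is placed on level
  \<open>m\<close>, so \<open>n \<le> m\<close>; the ancestor of \<open>t'\<close> on level
  \<open>n\<close> has \<open>x\<close> in its waiting set and must be \<open>t\<close>.\<close>

lemma node_inside:
  assumes t: "t \<in> L n" and t': "t' \<in> L m" and x: "x \<in> {lv t', rv t'}" "x \<in> ws t"
  shows "lo t \<le> lo t' \<and> hi t' \<le> hi t"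
proof -
  have nm: "n \<le> m"
  proof (rule ccontr)
    assume "\<not> n \<le> m"
    moreover obtain s where s: "s \<in> L m" "lv s = x" using x L_next[OF t'] t' by auto
    ultimately obtain s' where "s' \<in> L n" "lv s' = x" using L_lv_persist[OF s(1), of n] by auto
    then show False using L_endpoints[OF _ t, of s'] x by auto
  qed
  obtain s where s: "s \<in> L n" "lo s \<le> lo t'" "hi t' \<le> hi s" "ws t' \<subseteq> ws s" "lv t' \<in> ws s \<union> {lv s}" "rv t' \<in> ws s \<union> {rv s}"
    using L_ancestor[OF t' nm] by blast
  have "x \<in> ws s" using x s(5,6) L_endpoints[OF s(1) t] by auto
  then have "s = t" using L_disjoint[OF s(1) t] x by blast
  then show ?thesis using s by simp
qed

lemma pos_ws:
  assumes t: "t \<in> L n" and v: "v \<in> ws t"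
  shows "lo t < pos v" "pos v < hi t"
proof -
  have "v \<in> V" using L_sepD(4)[OF t] v by blast
  then obtain m0 where m0: "\<forall>m\<ge>m0. \<exists>t'\<in>L m. lv t' = v" using vertex_node_ge by blast
  define m where "m = max m0 n"
  obtain t' where t': "t' \<in> L m" "lv t' = v" using m0[rule_format, of m] by (auto simp: m_def)
  have b: "lo t \<le> lo t'" "hi t' \<le> hi t" using node_inside[OF t t'(1), of v] t'(2) v by auto
  have p: "pos v = lo t'" using pos_lv[OF t'(1)] t'(2) by simp
  show "pos v < hi t" using p b L_bounds[OF t'(1)] by linarith
  have "lo t \<noteq> lo t'"
  proof
    assume eq: "lo t = lo t'"
    obtain t'' where t'': "t'' \<in> L m" "lv t'' = lv t" "lo t'' = lo t" using L_lv_persist[OF t, of m] by (auto simp: m_def)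
    have "t'' = t'" using node_lo_inj[OF t''(1) t'(1)] t''(3) eq by simp
    then show False using t'' t' v L_sepD(5)[OF t] by simp
  qed
  then show "lo t < pos v" using b p by linarith
qed

lemma pos_bounds: "v \<in> V \<Longrightarrow> 0 \<le> pos v \<and> pos v < 2 * pi"
proof -
  assume "v \<in> V"
  then obtain n t where t: "t \<in> L n" "lv t = v" using vertex_node by blast
  show ?thesis using pos_lv[OF t(1)] t(2) L_bounds[OF t(1)] by auto
qed

lemma pos_inj: "v \<in> V \<Longrightarrow> w \<in> V \<Longrightarrow> pos v = pos w \<Longrightarrow> v = w"
proof -
  assume vw: "v \<in> V" "w \<in> V" "pos v = pos w"
  obtain N where N: "\<forall>n\<ge>N. \<exists>t\<in>L n. lv t = v" using vertex_node_ge[OF vw(1)] by blast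
  obtain M where M: "\<forall>n\<ge>M. \<exists>t\<in>L n. lv t = w" using vertex_node_ge[OF vw(2)] by blast
  obtain t where t: "t \<in> L (max N M)" "lv t = v" using N by (meson max.cobounded1)
  obtain t' where t': "t' \<in> L (max N M)" "lv t' = w" using M by (meson max.cobounded2)
  have "t = t'" using node_lo_inj[OF t(1) t'(1)] pos_lv[OF t(1)] pos_lv[OF t'(1)] t t' vw(3) by simp
  then show ?thesis using t t' by simp
qed

lemma cis_pos_inj: "v \<in> V \<Longrightarrow> w \<in> V \<Longrightarrow> cis (pos v) = cis (pos w) \<Longrightarrow> v = w"
  using cis_inj_0_2pi pos_bounds pos_inj by metis

lemma cis_lo_hi: "t \<in> L n \<Longrightarrow> cis (lo t) \<noteq> cis (hi t)"
  using cis_pos_inj[of "lv t" "rv t"] L_sepD(1-3)[of t n] pos_lv[of t n] pos_rv[of t n] by auto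

text \<open>Two different finished arcs with the same pair of vertices follow each other in both
  directions and fill the circle, leaving only two vertices.\<close>

lemma leaf_unique:
  assumes "t \<in> L n" "t' \<in> L m" "ws t = {}" "ws t' = {}" "{lv t, rv t} = {lv t', rv t'}"
  shows "t = t'"
proof (rule ccontr)
  assume ne: "t \<noteq> t'"
  define N where "N = max n m"
  have t: "t \<in> L N" "t' \<in> L N" using L_leaf_persist[OF assms(1,3), of N] L_leaf_persist[OF assms(2,4), of N] by (auto simp: N_def)
  have "lv t \<noteq> lv t'" using ne L_lv_inj[OF t] by blast
  then have lr: "lv t = rv t'" "rv t = lv t'" using assms(5) by (auto simp: doubleton_eq_iff)
  have 1: "lo t' = hi t \<or> (hi t = 2 * pi \<and> lo t' = 0)"
    using L_next[OF t(1)] L_lv_inj[OF _ t(2)] lr by metis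
  have 2: "lo t = hi t' \<or> (hi t' = 2 * pi \<and> lo t = 0)"
    using L_next[OF t(2)] L_lv_inj[OF _ t(1)] lr by metis
  note b = L_bounds[OF t(1)] L_bounds[OF t(2)]
  have d: "hi t \<le> lo t' \<or> hi t' \<le> lo t" using L_disjoint[OF t ne] by blast
  have "s = t \<or> s = t'" if s: "s \<in> L N" for s
  proof (rule ccontr)
    assume "\<not> ?thesis"
    then have "hi s \<le> lo t \<or> hi t \<le> lo s" "hi s \<le> lo t' \<or> hi t' \<le> lo s"
      using L_disjoint[OF s t(1)] L_disjoint[OF s t(2)] by blast+
    then show False using b d 1 2 L_bounds[OF s] by linarith
  qed
  then have "L N = {t, t'}" using t by blast
  then have "V = {lv t, lv t'}" using L_cover[of N] assms(3,4) by auto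
  then have "finite V" "card V \<le> 2" by (auto simp: card_insert_if)
  then show False using two_con by (simp add: two_connected_def)
qed

text \<open>The edge \<open>u0 v0\<close> belongs to both root nodes; an empty side is preferred, so that the edge is drawn
  on the circle.\<close>

definition nd :: "'a set \<Rightarrow> 'a node" where
  "nd e = (if \<exists>t n. t \<in> L n \<and> ws t = {} \<and> e = {lv t, rv t} then SOME t. \<exists>n. t \<in> L n \<and> ws t = {} \<and> e = {lv t, rv t}
     else SOME t. \<exists>n. t \<in> L n \<and> e = {lv t, rv t})"

lemma nd_leaf: "t \<in> L n \<Longrightarrow> ws t = {} \<Longrightarrow> nd {lv t, rv t} = t"
proof -
  assume t: "t \<in> L n" "ws t = {}"
  then have ex: "\<exists>t' n. t' \<in> L n \<and> ws t' = {} \<and> {lv t, rv t} = {lv t', rv t'}" by blast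
  then have "\<exists>n. nd {lv t, rv t} \<in> L n \<and> ws (nd {lv t, rv t}) = {} \<and> {lv t, rv t} = {lv (nd {lv t, rv t}), rv (nd {lv t, rv t})}"
    unfolding nd_def by (simp only: if_True) (rule someI_ex)
  then show ?thesis using leaf_unique t by metis
qed

lemma nd_node: "e \<in> E \<Longrightarrow> \<exists>n. nd e \<in> L n \<and> e = {lv (nd e), rv (nd e)}"
proof -
  assume e: "e \<in> E"
  show ?thesis
  proof (cases "\<exists>t n. t \<in> L n \<and> ws t = {} \<and> e = {lv t, rv t}")
    case True
    then obtain t n where "t \<in> L n" "ws t = {}" "e = {lv t, rv t}" by blast
    then show ?thesis using nd_leaf by metis
  next
    case False
    have "\<exists>t n. t \<in> L n \<and> e = {lv t, rv t}" using edge_node[OF e] by blast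
    then show ?thesis unfolding nd_def using False by (simp only: if_False) (rule someI_ex)
  qed
qed

text \<open>\<open>s\<close> is the barycentric coordinate at the left vertex, so the curve runs
  backwards: \<open>s = 1\<close> is the left end.\<close>

definition ec :: "'a node \<Rightarrow> real \<Rightarrow> complex" where
  "ec t s = (if ws t = {} then cis (s * lo t + (1 - s) * hi t)
     else of_real s * cis (lo t) + of_real (1 - s) * cis (hi t))"

lemma ec_ends [simp]: "ec t 1 = cis (lo t)" "ec t 0 = cis (hi t)"
  by (auto simp: ec_def)

text \<open>The constant bounds the length of an arc, at most \<open>pi\<close>, and of a chord, at
  most 2. As it is the same for all edges, one star of uniform radius gives continuity at a
  vertex.\<close>

lemma ec_lipschitz:
  assumes "t \<in> L n"
  shows "cmod (ec t s - ec t s') \<le> 4 * \<bar>s - s'\<bar>"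
proof (cases "ws t = {}")
  case True
  have "cmod (ec t s - ec t s') \<le> \<bar>(s * lo t + (1 - s) * hi t) - (s' * lo t + (1 - s') * hi t)\<bar>"
    unfolding ec_def using True norm_cis_diff by simp
  also have "\<dots> = \<bar>s - s'\<bar> * \<bar>lo t - hi t\<bar>" unfolding abs_mult[symmetric] by (simp add: algebra_simps)
  also have "\<dots> \<le> \<bar>s - s'\<bar> * 4" using L_bounds[OF assms] pi_less_4 by (intro mult_left_mono) auto
  finally show ?thesis by simp
next
  case False
  have "ec t s - ec t s' = of_real (s - s') * (cis (lo t) - cis (hi t))"
    using False by (simp add: ec_def algebra_simps)
  then have "cmod (ec t s - ec t s') = \<bar>s - s'\<bar> * cmod (cis (lo t) - cis (hi t))"
    by (simp only: norm_mult norm_of_real)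
  also have "\<dots> \<le> \<bar>s - s'\<bar> * 2"
    using norm_triangle_ineq4[of "cis (lo t)" "cis (hi t)"] by (intro mult_left_mono) auto
  also have "\<dots> \<le> 4 * \<bar>s - s'\<bar>" by simp
  finally show ?thesis .
qed

lemma ec_near:
  assumes "t \<in> L n" "0 \<le> s" "s \<le> 1" "a \<le> lo t" "hi t \<le> b"
  shows "cmod (ec t s - cis a) \<le> b - a"
proof (cases "ws t = {}")
  case True
  have "s * lo t + (1 - s) * hi t \<le> s * hi t + (1 - s) * hi t" "s * lo t + (1 - s) * lo t \<le> s * lo t + (1 - s) * hi t"
    using assms(2,3) L_bounds[OF assms(1)] by (auto intro!: mult_left_mono)
  then have "lo t \<le> s * lo t + (1 - s) * hi t" "s * lo t + (1 - s) * hi t \<le> hi t" by (auto simp: algebra_simps)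
  then show ?thesis using True norm_cis_diff[of "s * lo t + (1 - s) * hi t" a] assms(4,5) by (simp add: ec_def)
next
  case False
  have "ec t s - cis a = of_real s * (cis (lo t) - cis a) + of_real (1 - s) * (cis (hi t) - cis a)"
    using False by (simp add: ec_def algebra_simps)
  also have "cmod \<dots> \<le> s * cmod (cis (lo t) - cis a) + (1 - s) * cmod (cis (hi t) - cis a)"
    using assms(2,3) by (intro order_trans[OF norm_triangle_ineq]) (simp add: norm_mult del: of_real_diff)
  also have "\<dots> \<le> s * (b - a) + (1 - s) * (b - a)"
    using assms L_bounds[OF assms(1)] norm_cis_diff[of "lo t" a] norm_cis_diff[of "hi t" a]
    by (intro add_mono mult_left_mono) auto
  finally show ?thesis by (simp add: algebra_simps)
qed

fun emb :: "'a point \<Rightarrow> complex" where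
  "emb (Vtx v) = cis (pos v)"
| "emb (Inn p) = ec (nd {z. p z > 0}) (p (lv (nd {z. p z > 0})))"
| "emb (End \<omega>) = cis (epos \<omega>)"

lemma emb_Inn: "p \<in> inner_pts e \<Longrightarrow> emb (Inn p) = ec (nd e) (p (lv (nd e)))"
  using inner_pts_support[of p e] by simp

declare emb.simps(2) [simp del]

lemma emb_lv: "t \<in> L n \<Longrightarrow> emb (Vtx (lv t)) = cis (lo t)"
  and emb_rv: "t \<in> L n \<Longrightarrow> emb (Vtx (rv t)) = cis (hi t)"
  using pos_lv pos_rv by auto

text \<open>Removing the two attachments of \<open>t\<close> leaves the component of the end inside
  \<open>ws t\<close>. Its vertices, ends and edges are all drawn over the arc of \<open>t\<close>:
  an edge meeting \<open>ws t\<close> belongs to a node whose arc lies within that of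
  \<open>t\<close>.\<close>

lemma emb_end_nbhd:
  assumes \<omega>: "\<omega> \<in> ends V E" and t: "t \<in> L n" "lives \<omega> (ws t)" and y: "y \<in> end_nbhd V E {lv t, rv t} \<omega>"
  shows "cmod (emb y - cis (lo t)) \<le> hi t - lo t"
proof -
  define S where "S = {lv t, rv t}"
  define C where "C = end_comp V E S \<omega>"
  have S: "finite S" by (simp add: S_def)
  have cl: "nb E x \<subseteq> ws t \<union> S" if "x \<in> ws t" for x using L_sepD(7)[OF t(1) that] by (simp add: S_def)
  have tS: "ws t \<subseteq> V - S" using L_sepD(4-6)[OF t(1)] by (auto simp: S_def)
  have CW: "C \<subseteq> ws t"
  proof -
    obtain r where r: "r \<in> \<omega>" using end_obtain_ray[OF \<omega>] by metis
    obtain N where N: "\<forall>k\<ge>N. r k \<in> ws t" using t(2) r unfolding lives_def by blast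
    then have "\<forall>k\<ge>N. r k \<notin> S" using tS by blast
    then have "r N \<in> C" unfolding C_def using end_comp_eq[OF \<omega> r _ S] by simp
    then show ?thesis using end_comp_dichotomy[OF \<omega> S tS cl] N unfolding C_def by blast
  qed
  have "y \<in> Vtx ` C \<union> {Inn p | p e. e \<in> E \<and> e \<inter> C \<noteq> {} \<and> p \<in> inner_pts e} \<union> End ` {\<omega>' \<in> ends V E. end_comp V E S \<omega>' = C}"
    using y by (simp add: end_nbhd_def Let_def C_def S_def)
  then consider v where "y = Vtx v" "v \<in> C" | p e where "y = Inn p" "e \<in> E" "e \<inter> C \<noteq> {}" "p \<in> inner_pts e"
    | \<omega>' where "y = End \<omega>'" "\<omega>' \<in> ends V E" "end_comp V E S \<omega>' = C" by blast
  then show ?thesis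
  proof cases
    case 1
    then have "v \<in> ws t" using CW by blast
    then show ?thesis using 1 pos_ws[OF t(1), of v] norm_cis_diff[of "pos v" "lo t"] by simp
  next
    case 2
    obtain m where m: "nd e \<in> L m" "e = {lv (nd e), rv (nd e)}" using nd_node[OF 2(2)] by blast
    obtain x where x: "x \<in> e" "x \<in> ws t" using 2(3) CW by blast
    then have b: "lo t \<le> lo (nd e)" "hi (nd e) \<le> hi t" using node_inside[OF t(1) m(1), of x] m(2) by auto
    have "lv (nd e) \<in> e" using m(2) by blast
    then have "0 < p (lv (nd e)) \<and> p (lv (nd e)) \<le> 1" by (rule edge_le_1[OF 2(2,4)])
    then show ?thesis unfolding 2(1) emb_Inn[OF 2(4)] using ec_near[OF m(1) _ _ b] by auto
  next
    case 3
    obtain r k where r: "r \<in> \<omega>'" "is_ray E r" "\<forall>j\<ge>k. r j \<notin> S" "end_comp V E S \<omega>' = {v. reach E (V - S) (r k) v}"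
      by (rule end_comp_obtain[OF 3(2) S])
    have "r k \<in> C" using r(4) 3(3) by auto
    then have rk: "r k \<in> ws t" using CW by blast
    have stay: "\<forall>j\<ge>k. r j \<in> ws t" using ray_stays[OF r(2) rk cl r(3)] by blast
    have "lives \<omega>' (ws t)" by (rule lives_of_ray[OF 3(2) r(1) _ S stay]) (rule cl)
    then show ?thesis using epos[OF 3(2) t(1)] norm_cis_diff[of "epos \<omega>'" "lo t"] 3(1) by simp
  qed
qed

lemma emb_cont_at:
  assumes x: "x \<in> topspace X" and \<epsilon>: "\<epsilon> > 0"
  shows "\<exists>U. openin X U \<and> x \<in> U \<and> (\<forall>y\<in>U. dist (emb y) (emb x) < \<epsilon>)"
proof -
  consider v where "x = Vtx v" "v \<in> V" | p e where "x = Inn p" "e \<in> E" "p \<in> inner_pts e"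
    | \<omega> where "x = End \<omega>" "\<omega> \<in> ends V E" using x unfolding topspace_X by blast
  then show ?thesis
  proof cases
    case 1
    \<comment> \<open>A fifth of \<open>\<epsilon>\<close> leaves room for the Lipschitz constant
      4.\<close>
    define U where "U = insert (Vtx v) {Inn p | p e. e \<in> E \<and> v \<in> e \<and> p \<in> inner_pts e \<and> p v > 1 - \<epsilon> / 5}"
    have "openin X U" unfolding U_def by (rule open_star) (use 1 \<epsilon> in auto)
    moreover have "dist (emb y) (emb x) < \<epsilon>" if y: "y \<in> U" for y
    proof -
      consider "y = Vtx v" | p e where "y = Inn p" "e \<in> E" "v \<in> e" "p \<in> inner_pts e" "p v > 1 - \<epsilon> / 5"
        using y unfolding U_def by blast
      then show ?thesis
      proof cases
        case a: 1
        then show ?thesis using 1 \<epsilon> by simp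
      next
        case 2
        obtain m where m: "nd e \<in> L m" "e = {lv (nd e), rv (nd e)}" using nd_node[OF 2(2)] by blast
        have p1: "p v \<le> 1" using edge_le_1[OF 2(2,4,3)] by simp
        have ps: "p (lv (nd e)) + p (rv (nd e)) = 1" using inner_pts_sum[of p "lv (nd e)" "rv (nd e)"] 2(4) m L_sepD(3)[OF m(1)] by simp
        have "\<exists>s0. emb (Vtx v) = ec (nd e) s0 \<and> \<bar>p (lv (nd e)) - s0\<bar> = 1 - p v"
        proof (cases "v = lv (nd e)")
          case True then show ?thesis using emb_lv[OF m(1)] p1 by (intro exI[of _ 1]) auto
        next
          case False
          then have "v = rv (nd e)" using 2(3) m(2) by blast
          then show ?thesis using emb_rv[OF m(1)] p1 ps by (intro exI[of _ 0]) auto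
        qed
        then obtain s0 where s0: "emb (Vtx v) = ec (nd e) s0" "\<bar>p (lv (nd e)) - s0\<bar> = 1 - p v" by blast
        have "dist (emb y) (emb x) \<le> 4 * (1 - p v)"
          unfolding 1(1) 2(1) emb_Inn[OF 2(4)] s0(1) dist_norm using ec_lipschitz[OF m(1), of "p (lv (nd e))" s0] s0(2) by simp
        also have "\<dots> < 4 * (\<epsilon> / 5)" using 2(5) by simp
        also have "\<dots> < \<epsilon>" using \<epsilon> by simp
        finally show ?thesis .
      qed
    qed
    ultimately show ?thesis using 1(1) unfolding U_def by blast
  next
    case 2
    obtain m where m: "nd e \<in> L m" "e = {lv (nd e), rv (nd e)}" using nd_node[OF 2(2)] by blast
    define u where "u = lv (nd e)"
    have u: "u \<in> e" using m(2) by (auto simp: u_def)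
    define U where "U = {Inn q | q. q \<in> inner_pts e \<and> p u - \<epsilon> / 5 < q u \<and> q u < p u + \<epsilon> / 5}"
    have "openin X U" unfolding U_def by (rule open_edge_interval[OF 2(2) u])
    moreover have "x \<in> U" unfolding U_def using 2 \<epsilon> by auto
    moreover have "dist (emb y) (emb x) < \<epsilon>" if y: "y \<in> U" for y
    proof -
      obtain q where q: "y = Inn q" "q \<in> inner_pts e" "p u - \<epsilon> / 5 < q u" "q u < p u + \<epsilon> / 5" using y unfolding U_def by blast
      have "dist (emb y) (emb x) \<le> 4 * \<bar>q u - p u\<bar>"
        unfolding q(1) 2(1) emb_Inn[OF 2(3)] emb_Inn[OF q(2)] dist_norm u_def by (rule ec_lipschitz[OF m(1)])
      also have "\<bar>q u - p u\<bar> \<le> \<epsilon> / 5" using q(3,4) by linarith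
      finally show ?thesis using \<epsilon> by simp
    qed
    ultimately show ?thesis by blast
  next
    case 3
    \<comment> \<open>An unfinished node of this depth has an arc shorter than
      \<open>\<epsilon> / 2\<close>.\<close>
    obtain n where n: "(1 / 2) ^ n < \<epsilon> / (2 * pi)" using real_arch_pow_inv[of "\<epsilon> / (2 * pi)" "1 / 2"] \<epsilon> by auto
    obtain t where t: "t \<in> L n" "lives \<omega> (ws t)" using end_node[OF 3(2)] by blast
    have ne: "ws t \<noteq> {}" using lives_disjoint[OF 3(2) t(2) t(2)] by blast
    have len: "2 * (hi t - lo t) < \<epsilon>"
    proof -
      have "2 * (hi t - lo t) = 2 * pi * (1 / 2) ^ n" using L_length[OF t(1) ne] by (simp add: power_one_over)
      also have "\<dots> < 2 * pi * (\<epsilon> / (2 * pi))" by (rule mult_strict_left_mono[OF n]) simp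
      finally show ?thesis by simp
    qed
    define U where "U = end_nbhd V E {lv t, rv t} \<omega>"
    have "openin X U" unfolding U_def by (rule open_end_nbhd) (use 3 L_sepD(1,2)[OF t(1)] in auto)
    moreover have xU: "x \<in> U" unfolding U_def 3(1) by (rule End_in_nbhd[OF 3(2)])
    moreover have "dist (emb y) (emb x) < \<epsilon>" if y: "y \<in> U" for y
    proof -
      have "cmod (emb y - cis (lo t)) \<le> hi t - lo t" "cmod (emb x - cis (lo t)) \<le> hi t - lo t"
        using emb_end_nbhd[OF 3(2) t] y xU unfolding U_def by blast+
      then show ?thesis using len dist_triangle_le[of "emb y" "cis (lo t)" "emb x" "2 * (hi t - lo t)"]
        by (simp add: dist_norm norm_minus_commute)
    qed
    ultimately show ?thesis by blast
  qed
qed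

lemma emb_norm: "x \<in> topspace X \<Longrightarrow> cmod (emb x) \<le> 1"
proof (cases x)
  case (Inn p)
  assume "x \<in> topspace X"
  then obtain e where e: "e \<in> E" "p \<in> inner_pts e" using Inn unfolding topspace_X by blast
  obtain m where m: "nd e \<in> L m" "e = {lv (nd e), rv (nd e)}" using nd_node[OF e(1)] by blast
  define s where "s = p (lv (nd e))"
  have "lv (nd e) \<in> e" using m(2) by blast
  then have s: "0 < s \<and> s \<le> 1" unfolding s_def by (rule edge_le_1[OF e])
  have "cmod (of_real s * cis a + of_real (1 - s) * cis b) \<le> 1" for a b
    using norm_triangle_ineq[of "of_real s * cis a" "of_real (1 - s) * cis b"] s by (simp add: norm_mult del: of_real_diff)
  then show ?thesis unfolding Inn emb_Inn[OF e(2)] s_def[symmetric] ec_def by auto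
qed auto

lemma emb_continuous: "continuous_map X (top_of_set (cball 0 1)) emb"
proof -
  have "continuous_map X euclidean emb" unfolding continuous_map_def
  proof (intro conjI allI impI)
    fix U :: "complex set" assume "openin euclidean U"
    then have U: "open U" by simp
    show "openin X {x \<in> topspace X. emb x \<in> U}"
    proof (subst openin_subopen, intro ballI)
      fix x assume x: "x \<in> {x \<in> topspace X. emb x \<in> U}"
      then obtain \<epsilon> where \<epsilon>: "\<epsilon> > 0" "\<forall>z. dist z (emb x) < \<epsilon> \<longrightarrow> z \<in> U" using U unfolding open_dist by blast
      obtain T where T: "openin X T" "x \<in> T" "\<forall>y\<in>T. dist (emb y) (emb x) < \<epsilon>" using emb_cont_at[OF _ \<epsilon>(1)] x by blast
      then show "\<exists>T. openin X T \<and> x \<in> T \<and> T \<subseteq> {x \<in> topspace X. emb x \<in> U}"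
        using \<epsilon>(2) openin_subset[OF T(1)] by (intro exI[of _ T]) auto
    qed
  qed auto
  then show ?thesis using emb_norm by (auto simp: continuous_map_in_subtopology)
qed

end


section \<open>The Hamilton circle and its uniqueness\<close>

lemma cis_eq_near:
  assumes "cis a = cis b" "\<bar>a - b\<bar> < 2 * pi"
  shows "a = b"
proof (cases "a \<ge> b")
  case True
  have "cis (a - b) = cis 0" using assms(1) by (simp add: cis_divide[symmetric])
  then have "a - b = 0" by (rule cis_inj_0_2pi) (use True assms(2) in auto)
  then show ?thesis by simp
next
  case False
  have "cis (b - a) = cis 0" using assms(1) by (simp add: cis_divide[symmetric])
  then have "b - a = 0" by (rule cis_inj_0_2pi) (use False assms(2) in auto)
  then show ?thesis by simp
qed

lemma circle_cis:
  assumes "z \<in> sphere (0::complex) 1"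
  obtains \<theta> where "\<alpha> \<le> \<theta>" "\<theta> < \<alpha> + 2 * pi" "z = cis \<theta>"
proof -
  define w where "w = z / cis \<alpha>"
  have "cmod w = 1" using assms by (simp add: w_def norm_divide)
  then have w: "w = cis (Arg2pi w)" "0 \<le> Arg2pi w" "Arg2pi w < 2 * pi" using Arg2pi[of w] by (auto simp: is_Arg_def cis_conv_exp)
  have "z = w * cis \<alpha>" by (simp add: w_def)
  then have "z = cis (\<alpha> + Arg2pi w)" using w(1) by (metis cis_mult add.commute)
  then show thesis using that[of "\<alpha> + Arg2pi w"] w by auto
qed

lemma continuous_on_cis': "continuous_on S cis"
  by (intro continuous_intros)

lemma circle_minus_two:
  assumes "z \<in> sphere (0::complex) 1" "w \<in> sphere 0 1" "z \<noteq> w"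
  shows "\<exists>A B. connected A \<and> connected B \<and> sphere 0 1 - {z, w} = A \<union> B"
proof -
  obtain a where a: "z = cis a" by (rule circle_cis[OF assms(1), of 0])
  obtain b where b: "a \<le> b" "b < a + 2 * pi" "w = cis b" by (rule circle_cis[OF assms(2), of a])
  have ab: "a < b" using a b assms(3) by (cases "a = b") auto
  show ?thesis
  proof (intro exI conjI)
    show "connected (cis ` {a<..<b})" "connected (cis ` {b<..<a + 2 * pi})"
      by (intro connected_continuous_image continuous_on_cis' connected_Ioo)+
    show "sphere 0 1 - {z, w} = cis ` {a<..<b} \<union> cis ` {b<..<a + 2 * pi}"
    proof
      show "sphere 0 1 - {z, w} \<subseteq> cis ` {a<..<b} \<union> cis ` {b<..<a + 2 * pi}"
      proof
        fix x assume x: "x \<in> sphere 0 1 - {z, w}"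
        then obtain t where t: "a \<le> t" "t < a + 2 * pi" "x = cis t" using circle_cis[of x a] by blast
        have "t \<noteq> a" "t \<noteq> b" using x t(3) a b(3) by auto
        then have "t \<in> {a<..<b} \<or> t \<in> {b<..<a + 2 * pi}" using t by auto
        then show "x \<in> cis ` {a<..<b} \<union> cis ` {b<..<a + 2 * pi}" using t(3) by blast
      qed
      have "cis t \<noteq> z \<and> cis t \<noteq> w" if "t \<in> {a<..<b} \<union> {b<..<a + 2 * pi}" for t
      proof -
        have "\<bar>t - a\<bar> < 2 * pi" "\<bar>t - b\<bar> < 2 * pi" "t \<noteq> a" "t \<noteq> b" using that b ab by auto
        then show ?thesis using cis_eq_near a b(3) by blast
      qed
      moreover have "cis t \<in> sphere 0 1" for t by simp
      ultimately show "cis ` {a<..<b} \<union> cis ` {b<..<a + 2 * pi} \<subseteq> sphere 0 1 - {z, w}" by blast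
    qed
  qed
qed

lemma circle_minus_one:
  assumes "z \<in> sphere (0::complex) 1"
  shows "connected (sphere 0 1 - {z})"
proof -
  obtain a where a: "z = cis a" by (rule circle_cis[OF assms, of 0])
  have "sphere 0 1 - {z} = cis ` {a<..<a + 2 * pi}"
  proof
    show "sphere 0 1 - {z} \<subseteq> cis ` {a<..<a + 2 * pi}"
    proof
      fix x assume x: "x \<in> sphere 0 1 - {z}"
      then obtain t where t: "a \<le> t" "t < a + 2 * pi" "x = cis t" using circle_cis[of x a] by blast
      have "t \<noteq> a" using x t(3) a by auto
      then show "x \<in> cis ` {a<..<a + 2 * pi}" using t by auto
    qed
    have "cis t \<noteq> z" if t: "t \<in> {a<..<a + 2 * pi}" for t
    proof
      assume "cis t = z"
      then have "t = a" using cis_eq_near[of t a] a t by auto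
      then show False using t by simp
    qed
    moreover have "cis t \<in> sphere 0 1" for t by simp
    ultimately show "cis ` {a<..<a + 2 * pi} \<subseteq> sphere 0 1 - {z}" by blast
  qed
  moreover have "connected (cis ` {a<..<a + 2 * pi})"
    by (intro connected_continuous_image continuous_on_cis' connected_Ioo)
  ultimately show ?thesis by simp
qed

lemma is_circle_obtain:
  assumes "is_circle Y D"
  obtains h where "continuous_map (top_of_set (sphere (0::complex) 1)) Y h" "inj_on h (sphere 0 1)" "h ` sphere 0 1 = D"
proof -
  obtain h where h: "homeomorphic_map (top_of_set (sphere (0::complex) 1)) (subtopology Y D) h"
    using assms unfolding is_circle_def homeomorphic_space by blast
  have "D \<subseteq> topspace Y" using assms by (simp add: is_circle_def)
  then have "h ` sphere 0 1 = D" using homeomorphic_imp_surjective_map[OF h] by (simp add: Int_absorb1)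
  moreover have "inj_on h (sphere 0 1)" using homeomorphic_imp_injective_map[OF h] by simp
  moreover have "continuous_map (top_of_set (sphere (0::complex) 1)) Y h"
    using homeomorphic_imp_continuous_map[OF h] by (simp add: continuous_map_in_subtopology)
  ultimately show thesis using that by blast
qed

lemma connectedin_circle_image:
  assumes "continuous_map (top_of_set (sphere (0::complex) 1)) Y h" "connected A" "A \<subseteq> sphere 0 1"
  shows "connectedin Y (h ` A)"
  by (rule connectedin_continuous_map_image[OF assms(1)]) (use assms in \<open>simp add: connectedin_subtopology\<close>)

lemma is_circle_minus_one:
  assumes "is_circle Y D" "a \<in> D"
  shows "connectedin Y (D - {a})"
proof -
  obtain h where h: "continuous_map (top_of_set (sphere (0::complex) 1)) Y h" "inj_on h (sphere 0 1)" "h ` sphere 0 1 = D"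
    by (rule is_circle_obtain[OF assms(1)])
  obtain z where z: "z \<in> sphere 0 1" "h z = a" using h(3) assms(2) by blast
  have "connectedin Y (h ` (sphere 0 1 - {z}))"
    by (rule connectedin_circle_image[OF h(1) circle_minus_one[OF z(1)]]) auto
  moreover have "h ` (sphere 0 1 - {z}) = D - {a}"
    using inj_on_image_set_diff[OF h(2), of "sphere 0 1" "{z}"] z h(3) by auto
  ultimately show ?thesis by simp
qed

lemma is_circle_minus_two:
  assumes "is_circle Y D" "a \<in> D" "b \<in> D" "a \<noteq> b"
  obtains D1 D2 where "connectedin Y D1" "connectedin Y D2" "D - {a, b} = D1 \<union> D2"
proof -
  obtain h where h: "continuous_map (top_of_set (sphere (0::complex) 1)) Y h" "inj_on h (sphere 0 1)" "h ` sphere 0 1 = D"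
    by (rule is_circle_obtain[OF assms(1)])
  obtain z w where z: "z \<in> sphere 0 1" "h z = a" "w \<in> sphere 0 1" "h w = b" using h(3) assms(2,3) by blast
  then have "z \<noteq> w" using assms(4) by auto
  then obtain A B where AB: "connected A" "connected B" "sphere 0 1 - {z, w} = A \<union> B"
    using circle_minus_two[OF z(1,3)] by blast
  have sub: "A \<subseteq> sphere 0 1" "B \<subseteq> sphere 0 1" using AB(3) by blast+
  have "h ` (sphere 0 1 - {z, w}) = D - {a, b}"
    using inj_on_image_set_diff[OF h(2), of "sphere 0 1" "{z, w}"] z h(3) by auto
  then have "D - {a, b} = h ` A \<union> h ` B" unfolding AB(3) by (simp add: image_Un)
  then show thesis
    using that connectedin_circle_image[OF h(1) AB(1) sub(1)] connectedin_circle_image[OF h(1) AB(2) sub(2)] by blast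
qed

text \<open>Of three points take the one whose value lies between the others. Removing it leaves the
  circle connected, while the image then omits an intermediate value.\<close>

lemma circle_not_in_real:
  fixes G :: "complex \<Rightarrow> real"
  assumes "continuous_on (sphere 0 1) G" "inj_on G (sphere 0 1)"
  shows False
proof -
  have *: False if xyz: "x \<in> sphere 0 1" "y \<in> sphere 0 1" "z \<in> sphere 0 1" "G x < G y" "G y < G z" for x y z
  proof -
    have "connected (G ` (sphere 0 1 - {y}))"
      by (intro connected_continuous_image circle_minus_one[OF xyz(2)] continuous_on_subset[OF assms(1)]) auto
    moreover have "G x \<in> G ` (sphere 0 1 - {y})" "G z \<in> G ` (sphere 0 1 - {y})" using xyz by auto
    ultimately have "G y \<in> G ` (sphere 0 1 - {y})" using xyz(4,5) connectedD_interval[of _ "G x" "G z" "G y"] by auto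
    then obtain u where "u \<in> sphere 0 1 - {y}" "G y = G u" by blast
    then show False using inj_onD[OF assms(2), of u y] xyz(2) by simp
  qed
  have m: "1 \<in> sphere (0::complex) 1" "- 1 \<in> sphere (0::complex) 1" "\<i> \<in> sphere (0::complex) 1" by auto
  have "(1::complex) \<noteq> - 1" "\<i> \<noteq> 1" "\<i> \<noteq> - 1" by (simp_all add: complex_eq_iff)
  then have "G 1 \<noteq> G (- 1)" "G \<i> \<noteq> G 1" "G \<i> \<noteq> G (- 1)" using assms(2) m by (meson inj_onD)+
  then show False using *[OF m(1,2,3)] *[OF m(1,3,2)] *[OF m(2,1,3)] *[OF m(2,3,1)] *[OF m(3,1,2)] *[OF m(3,2,1)] by linarith
qed

text \<open>If \<open>p\<close> were missed, the circle cut open at \<open>p\<close> would have the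
  angle as an injective real coordinate, and a circle does not embed in the line. The factor
  \<open>- 1 / p\<close> moves the missed point onto the branch cut of \<open>Arg\<close>.\<close>

lemma circle_self_embedding_surj:
  fixes \<phi> :: "complex \<Rightarrow> complex"
  assumes "continuous_on (sphere 0 1) \<phi>" "inj_on \<phi> (sphere 0 1)" "\<phi> ` sphere 0 1 \<subseteq> sphere (0::complex) 1"
  shows "\<phi> ` sphere 0 1 = sphere (0::complex) 1"
proof (rule ccontr)
  assume "\<not> ?thesis"
  then obtain p where p: "p \<in> sphere 0 1" "p \<notin> \<phi> ` sphere 0 1" using assms(3) by blast
  have np: "p \<noteq> 0" "cmod p = 1" using p by auto
  have notneg: "- \<phi> z / p \<notin> \<real>\<^sub>\<le>\<^sub>0" if z: "z \<in> sphere 0 1" for z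
  proof
    assume "- \<phi> z / p \<in> \<real>\<^sub>\<le>\<^sub>0"
    then obtain r where r: "- \<phi> z / p = of_real r" "r \<le> 0" by (rule nonpos_Reals_cases)
    have "\<phi> z \<in> sphere 0 1" using assms(3) z by blast
    then have "cmod (\<phi> z) = 1" by simp
    then have "cmod (- \<phi> z / p) = 1" using np by (simp add: norm_divide)
    then have "r = - 1" using r(2) unfolding r(1) norm_of_real by linarith
    then have "\<phi> z = p" using r(1) np by (simp add: field_simps)
    then show False using p(2) z by blast
  qed
  define G where "G z = Arg (- \<phi> z / p)" for z
  have "continuous_on (sphere 0 1) G" unfolding G_def
    using notneg np by (intro continuous_on_Arg' continuous_intros assms(1)) auto
  moreover have "inj_on G (sphere 0 1)"
  proof (rule inj_onI)
    fix x y assume xy: "x \<in> sphere 0 1" "y \<in> sphere 0 1" "G x = G y"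
    have "\<phi> x \<in> sphere 0 1" "\<phi> y \<in> sphere 0 1" using assms(3) xy by blast+
    then have n: "cmod (- \<phi> x / p) = 1" "cmod (- \<phi> y / p) = 1" using np by (auto simp: norm_divide)
    then have nz: "- \<phi> x / p \<noteq> 0" "- \<phi> y / p \<noteq> 0" by auto
    have "- \<phi> x / p = - \<phi> y / p" using Arg_eq[OF nz(1)] Arg_eq[OF nz(2)] n xy(3) unfolding G_def by simp
    then have "\<phi> x = \<phi> y" using np by simp
    then show "x = y" using inj_onD[OF assms(2) _ xy(1,2)] by blast
  qed
  ultimately show False by (rule circle_not_in_real)
qed

section \<open>Injectivity of the drawing, and its boundary\<close>

context arc_tree
begin

text \<open>The angle of a point drawn on the boundary circle. For inner points of chords the value
  does not describe their position.\<close>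

fun ang :: "'a point \<Rightarrow> real" where
  "ang (Vtx v) = pos v"
| "ang (Inn p) = p (lv (nd {z. p z > 0})) * lo (nd {z. p z > 0}) + (1 - p (lv (nd {z. p z > 0}))) * hi (nd {z. p z > 0})"
| "ang (End \<omega>) = epos \<omega>"

fun outer :: "'a point \<Rightarrow> bool" where
  "outer (Vtx v) = True"
| "outer (Inn p) = (ws (nd {z. p z > 0}) = {})"
| "outer (End \<omega>) = True"

text \<open>Assigns a boundary point to the node of a level whose arc, closed on the left and open
  on the right, contains its angle. A vertex therefore belongs to the node that it starts.\<close>

fun place :: "'a node \<Rightarrow> 'a point \<Rightarrow> bool" where
  "place t (Vtx v) = (lv t = v)"
| "place t (Inn p) = (t = nd {z. p z > 0})"
| "place t (End \<omega>) = lives \<omega> (ws t)"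

lemma emb_outer: "outer x \<Longrightarrow> emb x = cis (ang x)"
  by (cases x) (auto simp: emb.simps(2) ec_def)

lemma Inn_topspace:
  assumes "Inn p \<in> topspace X"
  obtains e n where "e \<in> E" "p \<in> inner_pts e" "{z. p z > 0} = e" "nd e \<in> L n" "e = {lv (nd e), rv (nd e)}"
    "0 < p (lv (nd e))" "p (lv (nd e)) < 1" "lv (nd e) \<noteq> rv (nd e)"
proof -
  obtain e where e: "e \<in> E" "p \<in> inner_pts e" using assms unfolding topspace_X by blast
  obtain n where n: "nd e \<in> L n" "e = {lv (nd e), rv (nd e)}" using nd_node[OF e(1)] by blast
  have ne: "lv (nd e) \<noteq> rv (nd e)" using L_sepD(3)[OF n(1)] .
  have "p (lv (nd e)) + p (rv (nd e)) = 1" using inner_pts_sum[of p "lv (nd e)" "rv (nd e)"] e(2) n(2) ne by simp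
  moreover have "lv (nd e) \<in> e" "rv (nd e) \<in> e" using n(2) by blast+
  then have "0 < p (lv (nd e))" "0 < p (rv (nd e))" using edge_le_1[OF e] by auto
  ultimately show thesis using that[OF e _ n] inner_pts_support[OF e(2)] ne by auto
qed

lemma emb_not_outer:
  assumes "x \<in> topspace X" "\<not> outer x"
  shows "cmod (emb x) < 1"
proof -
  obtain p where x: "x = Inn p" using assms(2) by (cases x) auto
  obtain e n where e: "p \<in> inner_pts e" "{z. p z > 0} = e" "nd e \<in> L n"
    "0 < p (lv (nd e))" "p (lv (nd e)) < 1" using Inn_topspace assms(1) x by blast
  have "ws (nd e) \<noteq> {}" using assms(2) x e(2) by simp
  then show ?thesis unfolding x emb_Inn[OF e(1)] ec_def using norm_chord_less_1[OF cis_lo_hi[OF e(3)] e(4,5)] by simp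
qed

lemma place_ex:
  assumes "x \<in> topspace X" "outer x"
  shows "\<exists>N. \<forall>n\<ge>N. \<exists>t\<in>L n. place t x"
proof (cases x)
  case (Vtx v)
  then have "v \<in> V" using assms(1) by (auto simp: topspace_X)
  then show ?thesis using vertex_node_ge Vtx by simp
next
  case (Inn p)
  then obtain e n where e: "{z. p z > 0} = e" "nd e \<in> L n" using Inn_topspace assms(1) by metis
  have "ws (nd e) = {}" using assms(2) Inn e by simp
  then have "nd e \<in> L m" if "m \<ge> n" for m using L_leaf_persist[OF e(2) _ that] by blast
  then show ?thesis using Inn e(1) by auto
next
  case (End \<omega>)
  then have "\<omega> \<in> ends V E" using assms(1) by (auto simp: topspace_X)
  then show ?thesis using end_node End by auto
qed

lemma place_ang:
  assumes "x \<in> topspace X" "t \<in> L n" "place t x"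
  shows "lo t \<le> ang x" "ang x < hi t" "ang x = lo t \<longleftrightarrow> (\<exists>v. x = Vtx v)"
proof -
  have "lo t \<le> ang x \<and> ang x < hi t \<and> (ang x = lo t \<longleftrightarrow> (\<exists>v. x = Vtx v))"
  proof (cases x)
    case (Vtx v) then show ?thesis using assms pos_lv[OF assms(2)] L_bounds[OF assms(2)] by auto
  next
    case (Inn p)
    then obtain e m where e: "{z. p z > 0} = e" "0 < p (lv (nd e))" "p (lv (nd e)) < 1" using Inn_topspace assms(1) by metis
    have t: "t = nd e" using assms(3) Inn e by simp
    define s where "s = p (lv t)"
    have a: "ang x = lo t + (1 - s) * (hi t - lo t)" unfolding Inn s_def using e t by (simp add: algebra_simps)
    have b: "0 < (1 - s) * (hi t - lo t)" using e L_bounds[OF assms(2)] by (simp add: s_def t)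
    have "(1 - s) * (hi t - lo t) < 1 * (hi t - lo t)" using e L_bounds[OF assms(2)]
      by (intro mult_strict_right_mono) (simp_all add: s_def t)
    then show ?thesis using a b Inn by auto
  next
    case (End \<omega>)
    then have "\<omega> \<in> ends V E" using assms(1) by (auto simp: topspace_X)
    then show ?thesis using epos[OF _ assms(2)] assms(3) End by force
  qed
  then show "lo t \<le> ang x" "ang x < hi t" "ang x = lo t \<longleftrightarrow> (\<exists>v. x = Vtx v)" by auto
qed

text \<open>Points of equal angle share their node on every deep level. A vertex is recognised by
  sitting at the left bound; an inner point requires a finished node and an end an unfinished one;
  two ends sharing all nodes agree by \<open>chain_end_unique\<close>.\<close>

lemma outer_inj:
  assumes x: "x \<in> topspace X" "outer x" and y: "y \<in> topspace X" "outer y" and eq: "emb x = emb y"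
  shows "x = y"
proof -
  obtain N M where N: "\<And>n. n \<ge> N \<Longrightarrow> \<exists>t\<in>L n. place t x" and M: "\<And>n. n \<ge> M \<Longrightarrow> \<exists>t\<in>L n. place t y"
    using place_ex[OF x] place_ex[OF y] by blast
  have rng: "0 \<le> ang x \<and> ang x < 2 * pi" if x: "x \<in> topspace X" "outer x" for x
  proof -
    obtain n t where t: "t \<in> L n" "place t x" using place_ex[OF x] by blast
    show ?thesis using place_ang(1,2)[OF x(1) t] L_bounds[OF t(1)] by linarith
  qed
  have "cis (ang x) = cis (ang y)" using emb_outer x y eq by simp
  then have a: "ang x = ang y" by (rule cis_inj_0_2pi) (use rng x y in auto)
  have common: "\<exists>t\<in>L n. place t x \<and> place t y" if n: "n \<ge> max N M" for n
  proof -
    obtain t t' where t: "t \<in> L n" "place t x" "t' \<in> L n" "place t' y" using N M n by (meson max.boundedE)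
    have "t = t'" by (rule node_angle_unique[OF t(1,3), of "ang x"])
        (use place_ang(1,2)[OF x(1) t(1,2)] place_ang(1,2)[OF y(1) t(3,4)] a in auto)
    then show ?thesis using t by blast
  qed
  then obtain t where t: "t \<in> L (max N M)" "place t x" "place t y" by blast
  have vv: "(\<exists>v. x = Vtx v) \<longleftrightarrow> (\<exists>v. y = Vtx v)"
    using place_ang(3)[OF x(1) t(1,2)] place_ang(3)[OF y(1) t(1,3)] a by simp
  have inn_end: False if xy: "x = Inn p" "y = End \<omega>" "place t x" "place t y" "outer x" "y \<in> topspace X" for x y p \<omega> t
  proof -
    have "\<omega> \<in> ends V E" using xy by (auto simp: topspace_X)
    then show False using lives_disjoint[of \<omega> "ws t" "ws t"] xy by auto
  qed
  show ?thesis
  proof (cases x)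
    case (Vtx v)
    then obtain w where "y = Vtx w" using vv by blast
    then show ?thesis using t Vtx by simp
  next
    case (Inn p)
    then consider q where "y = Inn q" | \<omega> where "y = End \<omega>" using vv by (cases y) auto
    then show ?thesis
    proof cases
      case 1
      obtain e n where e: "p \<in> inner_pts e" "{z. p z > 0} = e" "nd e \<in> L n" "e = {lv (nd e), rv (nd e)}" "lv (nd e) \<noteq> rv (nd e)"
        using Inn_topspace x(1) Inn by metis
      obtain e' n' where e': "q \<in> inner_pts e'" "{z. q z > 0} = e'" "e' = {lv (nd e'), rv (nd e')}"
        using Inn_topspace y(1) 1 by metis
      have tt: "t = nd e" "t = nd e'" using t Inn 1 e(2) e'(2) by auto
      then have ee: "e = e'" using e(4) e'(3) by metis
      define s where "s = p (lv t)"
      define s' where "s' = q (lv t)"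
      have "s * lo t + (1 - s) * hi t = s' * lo t + (1 - s') * hi t"
        using a Inn 1 e(2) e'(2) tt ee by (simp add: s_def s'_def)
      then have "(s - s') * (lo t - hi t) = 0" by (simp add: algebra_simps)
      then have "s = s'" using L_bounds[OF t(1)] by auto
      then have "p = q" using inner_pts_eqI[of p "lv t" "rv t" q] e e' ee tt unfolding s_def s'_def by metis
      then show ?thesis using Inn 1 by simp
    next
      case 2 then show ?thesis using inn_end[OF Inn 2 t(2,3) x(2) y(1)] by blast
    qed
  next
    case (End \<omega>)
    then consider q where "y = Inn q" | \<omega>' where "y = End \<omega>'" using vv by (cases y) auto
    then show ?thesis
    proof cases
      case 1 then show ?thesis using inn_end[OF 1 End t(3,2) y(2) x(1)] by blast
    next
      case 2
      have \<omega>: "\<omega> \<in> ends V E" "\<omega>' \<in> ends V E" using End 2 x y by (auto simp: topspace_X)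
      obtain c where c: "is_chain c" "\<And>n. lives \<omega> (ws (c n))" using end_chain[OF \<omega>(1)] by blast
      have "lives \<omega>' (ws (c n))" for n
      proof -
        define m where "m = max n (max N M)"
        obtain s where s: "s \<in> L m" "lives \<omega> (ws s)" "lives \<omega>' (ws s)" using common[of m] End 2 by (auto simp: m_def)
        have "c m \<in> L m" using c by (auto simp: is_chain_def)
        then have "s = c m" using end_node_unique[OF \<omega>(1) s(1) _ s(2) c(2)] by blast
        then have "lives \<omega>' (ws (c m))" using s by simp
        then show ?thesis using chain_mono'(1)[OF c(1), of n m] by (rule lives_mono) (simp add: m_def)
      qed
      then have "\<omega> = \<omega>'" using chain_end_unique[OF \<omega> c] by blast
      then show ?thesis using End 2 by simp
    qed
  qed
qed

text \<open>Arcs of two nodes are nested or have disjoint interiors, so their chords do not cross; a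
  common point inside a chord forces the pairs of ends to agree.\<close>

lemma chord_chord:
  assumes t: "t \<in> L n" "ws t \<noteq> {}" and t': "t' \<in> L m" "ws t' \<noteq> {}" and nm: "n \<le> m"
    and s': "0 < s'" "s' < 1" and eq: "ec t s = ec t' s'"
  shows "{lv t', rv t'} = {lv t, rv t}"
proof -
  obtain r where r: "r \<in> L n" "lo r \<le> lo t'" "hi t' \<le> hi r" using L_ancestor[OF t'(1) nm] by blast
  note b = L_bounds[OF t(1)] L_bounds[OF t'(1)] L_bounds[OF r(1)]
  have side: "(lo t \<le> lo t' \<and> lo t' \<le> hi t \<and> lo t \<le> hi t' \<and> hi t' \<le> hi t) \<or> (lo t' \<le> lo t \<and> hi t' \<le> lo t) \<or> (hi t \<le> lo t' \<and> hi t \<le> hi t')"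
  proof (cases "r = t")
    case True then show ?thesis using r b by auto
  next
    case False
    then have "hi r \<le> lo t \<or> hi t \<le> lo r" using L_disjoint[OF r(1) t(1)] by blast
    then show ?thesis using r b by linarith
  qed
  have eq': "of_real s * cis (lo t) + of_real (1 - s) * cis (hi t) = of_real s' * cis (lo t') + of_real (1 - s') * cis (hi t')"
    using eq t(2) t'(2) by (simp add: ec_def)
  have "cis (lo t') \<in> {cis (lo t), cis (hi t)}" "cis (hi t') \<in> {cis (lo t), cis (hi t)}"
    using chords_disjoint[OF _ _ _ _ _ _ _ side eq' s'] b by linarith+
  then have "cis (pos (lv t')) \<in> {cis (pos (lv t)), cis (pos (rv t))}" "cis (pos (rv t')) \<in> {cis (pos (lv t)), cis (pos (rv t))}"
    using pos_lv[OF t(1)] pos_rv[OF t(1)] pos_lv[OF t'(1)] pos_rv[OF t'(1)] by simp_all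
  then have "lv t' \<in> {lv t, rv t}" "rv t' \<in> {lv t, rv t}"
    using cis_pos_inj L_sepD(1,2)[OF t(1)] L_sepD(1,2)[OF t'(1)] by auto
  then show ?thesis using L_sepD(3)[OF t'(1)] by auto
qed

lemma emb_inj: "inj_on emb (topspace X)"
proof (rule inj_onI)
  fix x y assume x: "x \<in> topspace X" and y: "y \<in> topspace X" and eq: "emb x = emb y"
  show "x = y"
  proof (cases "outer x")
    case True
    then have "cmod (emb x) = 1" using emb_outer by simp
    then have "outer y" using emb_not_outer[OF y] eq by auto
    then show ?thesis using outer_inj[OF x True y _ eq] by blast
  next
    case False
    then have "cmod (emb y) < 1" using emb_not_outer[OF x False] eq by simp
    then have no: "\<not> outer y" using emb_outer by auto
    obtain p where p: "x = Inn p" using False by (cases x) auto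
    obtain q where q: "y = Inn q" using no by (cases y) auto
    obtain e n where e: "p \<in> inner_pts e" "{z. p z > 0} = e" "nd e \<in> L n" "e = {lv (nd e), rv (nd e)}"
      "0 < p (lv (nd e))" "p (lv (nd e)) < 1" "lv (nd e) \<noteq> rv (nd e)" using Inn_topspace x p by metis
    obtain e' m where e': "q \<in> inner_pts e'" "{z. q z > 0} = e'" "nd e' \<in> L m" "e' = {lv (nd e'), rv (nd e')}"
      "0 < q (lv (nd e'))" "q (lv (nd e')) < 1" "lv (nd e') \<noteq> rv (nd e')" using Inn_topspace y q by metis
    have w: "ws (nd e) \<noteq> {}" "ws (nd e') \<noteq> {}" using False no p q e(2) e'(2) by auto
    have ec: "ec (nd e) (p (lv (nd e))) = ec (nd e') (q (lv (nd e')))" using eq p q emb_Inn[OF e(1)] emb_Inn[OF e'(1)] by simp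
    have ee: "e = e'"
    proof (cases "n \<le> m")
      case True
      show ?thesis using chord_chord[OF e(3) w(1) e'(3) w(2) True e'(5,6) ec] e(4) e'(4) by simp
    next
      case False
      then show ?thesis using chord_chord[OF e'(3) w(2) e(3) w(1) _ e(5,6) ec[symmetric]] e(4) e'(4) by simp
    qed
    define t where "t = nd e"
    have "of_real (p (lv t) - q (lv t)) * (cis (lo t) - cis (hi t)) = 0"
      using ec w(1) ee unfolding ec_def t_def by (simp add: algebra_simps)
    then have "p (lv t) = q (lv t)" using cis_lo_hi[OF e(3)] by (simp add: t_def)
    then have "p = q" using inner_pts_eqI[of p "lv t" "rv t" q] e e' ee unfolding t_def by metis
    then show ?thesis using p q by simp
  qed
qed

lemma emb_embedding: "embedding_map X (top_of_set (cball 0 1)) emb"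
  by (intro injective_closed_imp_embedding_map emb_continuous emb_inj T1_Spaces.continuous_imp_closed_map compact_X)
    (simp add: Hausdorff_space_subtopology)

lemma L_angle_cover: "0 \<le> \<theta> \<Longrightarrow> \<theta> < 2 * pi \<Longrightarrow> \<exists>t\<in>L n. lo t \<le> \<theta> \<and> \<theta> < hi t"
proof (induction n)
  case 0 then show ?case by (cases "\<theta> < pi") auto
next
  case (Suc n)
  then obtain s where s: "s \<in> L n" "lo s \<le> \<theta>" "\<theta> < hi s" by blast
  show ?case
  proof (cases "ws s = {}")
    case True then show ?thesis using s by (auto simp: ch_def intro!: bexI[of _ s])
  next
    case False
    then have c: "lch s \<in> L (Suc n)" "rch s \<in> L (Suc n)" using s(1) by (auto simp: ch_def)
    show ?thesis
    proof (cases "\<theta> < mid s")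
      case True then show ?thesis using s c(1) by (intro bexI[of _ "lch s"]) (simp_all del: L.simps)
    next
      case False then show ?thesis using s c(2) by (intro bexI[of _ "rch s"]) (simp_all del: L.simps)
    qed
  qed
qed

text \<open>An angle in a finished arc is hit by the edge drawn there or by its left vertex. Any
  other angle lies in unfinished arcs of arbitrarily small length, hence is a limit of vertices, and
  the image is compact.\<close>

lemma sphere_subset: "sphere 0 1 \<subseteq> emb ` topspace X"
proof
  fix z :: complex assume "z \<in> sphere 0 1"
  then obtain \<theta> where \<theta>: "0 \<le> \<theta>" "\<theta> < 2 * pi" "z = cis \<theta>" using circle_cis[of z 0] by auto
  have VX: "Vtx v \<in> topspace X" if "v \<in> V" for v using that by (auto simp: topspace_X)
  show "z \<in> emb ` topspace X"
  proof (cases "\<exists>n. \<exists>t\<in>L n. ws t = {} \<and> lo t \<le> \<theta> \<and> \<theta> < hi t")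
    case True
    then obtain n t where t: "t \<in> L n" "ws t = {}" "lo t \<le> \<theta>" "\<theta> < hi t" by blast
    show ?thesis
    proof (cases "\<theta> = lo t")
      case True
      then have "z = emb (Vtx (lv t))" using emb_lv[OF t(1)] \<theta> by simp
      then show ?thesis using VX L_sepD(1)[OF t(1)] by blast
    next
      case False
      have E: "{lv t, rv t} \<in> E" using L_half[OF t(1)] t(2) by (simp add: half_def)
      define s where "s = (\<theta> - lo t) / (hi t - lo t)"
      have lh: "hi t - lo t > 0" using t by linarith
      have s: "0 < s" "s < 1" using t False lh by (auto simp: s_def field_simps)
      define p where "p = bary (lv t) (rv t) s"
      have p: "p \<in> inner_pts {lv t, rv t}" unfolding inner_pts_pair[OF L_sepD(3)[OF t(1)]] p_def using s by blast
      have "emb (Inn p) = ec t (1 - s)" using emb_Inn[OF p] nd_leaf[OF t(1,2)] by (simp add: p_def bary_def)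
      also have "\<dots> = cis ((1 - s) * lo t + s * hi t)" using t(2) by (simp add: ec_def)
      also have "(1 - s) * lo t + s * hi t = lo t + s * (hi t - lo t)" by (simp add: algebra_simps)
      also have "\<dots> = \<theta>" using lh by (simp add: s_def)
      finally have "z = emb (Inn p)" using \<theta> by simp
      moreover have "Inn p \<in> topspace X" using p E unfolding topspace_X by blast
      ultimately show ?thesis by blast
    qed
  next
    case False
    have "compact (emb ` topspace X)"
      using image_compactin[OF _ emb_continuous] compact_X unfolding compact_space_def
      by (metis compactin_euclidean_iff compactin_subtopology)
    then have cl: "closed (emb ` topspace X)" by (rule compact_imp_closed)
    have "\<exists>y\<in>emb ` topspace X. dist y z < \<epsilon>" if \<epsilon>: "\<epsilon> > 0" for \<epsilon>
    proof -
      obtain n where n: "(1 / 2) ^ n < \<epsilon> / pi" using real_arch_pow_inv[of "\<epsilon> / pi" "1 / 2"] \<epsilon> by auto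
      obtain t where t: "t \<in> L n" "lo t \<le> \<theta>" "\<theta> < hi t" using L_angle_cover[OF \<theta>(1,2)] by blast
      then have ne: "ws t \<noteq> {}" using False by blast
      have "dist (emb (Vtx (lv t))) z \<le> \<bar>lo t - \<theta>\<bar>" unfolding emb_lv[OF t(1)] \<theta>(3) dist_norm by (rule norm_cis_diff)
      also have "\<dots> \<le> hi t - lo t" using t by linarith
      also have "\<dots> = pi * (1 / 2) ^ n" using L_length[OF t(1) ne] by (simp add: power_one_over)
      also have "\<dots> < pi * (\<epsilon> / pi)" by (rule mult_strict_left_mono[OF n]) simp
      also have "\<dots> = \<epsilon>" by simp
      finally show ?thesis using VX[OF L_sepD(1)[OF t(1)]] by blast
    qed
    then have "z \<in> closure (emb ` topspace X)" unfolding closure_approachable by blast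
    then show ?thesis using cl by simp
  qed
qed

section \<open>The boundary circle as the only Hamilton circle\<close>

definition rim :: "'a point set" where
  "rim = {x \<in> topspace X. emb x \<in> sphere 0 1}"

lemma emb_rim: "emb ` rim = sphere 0 1"
  using sphere_subset unfolding rim_def by blast

lemma rim_hamilton: "hamilton_circle V E rim"
proof -
  have "homeomorphic_map X (subtopology (top_of_set (cball 0 1)) (emb ` topspace X)) emb"
    using emb_embedding by (simp add: embedding_map_def)
  then have "homeomorphic_map (subtopology X rim) (subtopology (subtopology (top_of_set (cball 0 1)) (emb ` topspace X)) (sphere 0 1)) emb"
    by (rule homeomorphic_map_subtopologies) (use emb_rim sphere_subset in \<open>auto simp: rim_def\<close>)
  moreover have "subtopology (subtopology (top_of_set (cball 0 1)) (emb ` topspace X)) (sphere 0 1) = top_of_set (sphere (0::complex) 1)"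
    unfolding subtopology_subtopology using sphere_subset by (intro arg_cong[of _ _ "subtopology euclidean"]) auto
  ultimately have "homeomorphic_map (subtopology X rim) (top_of_set (sphere (0::complex) 1)) emb" by simp
  then have "top_of_set (sphere (0::complex) 1) homeomorphic_space subtopology X rim"
    using homeomorphic_map_imp_homeomorphic_space homeomorphic_space_sym by blast
  then show ?thesis unfolding hamilton_circle_def is_circle_def by (auto simp: rim_def topspace_X)
qed

text \<open>If nothing lay beyond the chord, the next node of the level would be finished and join
  the same two vertices; \<open>nd\<close> would then have chosen that node for the edge.\<close>

lemma chord_separates:
  assumes t: "t \<in> L n" "t = nd e" "e = {lv t, rv t}" and ne: "ws t \<noteq> {}"
  shows "V - {lv t, rv t} - ws t \<noteq> {}"
proof
  assume B: "V - {lv t, rv t} - ws t = {}"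
  obtain s where s: "s \<in> L n" "lv s = rv t" using L_next[OF t(1)] by blast
  have "s \<noteq> t" using s L_sepD(3)[OF t(1)] by auto
  then have "ws s \<inter> ws t = {}" using L_disjoint[OF s(1) t(1)] by blast
  moreover have "lv t \<notin> ws s" "rv t \<notin> ws s" using L_endpoints[OF t(1) s(1)] by auto
  ultimately have leaf: "ws s = {}" using B L_sepD(4)[OF s(1)] by blast
  have "rv s \<notin> ws t" using L_endpoints[OF s(1) t(1)] by simp
  then have "rv s \<in> {lv t, rv t}" using B L_sepD(2)[OF s(1)] by blast
  then have "rv s = lv t" using s L_sepD(3)[OF s(1)] by auto
  then have "e = {lv s, rv s}" using t(3) s(2) by auto
  then have "nd e = s" using nd_leaf[OF s(1) leaf] by simp
  with t(2) \<open>s \<noteq> t\<close> show False by simp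
qed

text \<open>Suppose the circle contains an inner point \<open>x\<close> of a chord. Without the two
  ends of the chord it is a union of two connected pieces. The piece through \<open>x\<close> stays
  in the open edge, which open sets separate from both sides. So the other piece carries vertices of
  both sides, although these are separated from each other as well.\<close>

lemma hamilton_subset_rim:
  assumes D: "hamilton_circle V E D"
  shows "D \<subseteq> rim"
proof
  fix x assume xD: "x \<in> D"
  have circ: "is_circle X D" and VD: "Vtx ` V \<subseteq> D" using D by (auto simp: hamilton_circle_def)
  then have DX: "D \<subseteq> topspace X" by (simp add: is_circle_def)
  show "x \<in> rim"
  proof (rule ccontr)
    assume "x \<notin> rim"
    then have nx: "emb x \<notin> sphere 0 1" using xD DX by (auto simp: rim_def)
    then have no: "\<not> outer x" using emb_outer by auto
    then obtain p where p: "x = Inn p" by (cases x) auto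
    have "Inn p \<in> topspace X" using xD DX p by blast
    then obtain e n where e: "e \<in> E" "p \<in> inner_pts e" "{z. p z > 0} = e" "nd e \<in> L n" "e = {lv (nd e), rv (nd e)}"
      by (rule Inn_topspace)
    define t where "t = nd e"
    have t: "t \<in> L n" "e = {lv t, rv t}" using e by (auto simp: t_def)
    have ne: "ws t \<noteq> {}" using no p e by (simp add: t_def)
    define S where "S = {lv t, rv t}"
    define A where "A = ws t"
    define B where "B = V - S - A"
    define F where "F = {Inn p | p e. e \<in> E \<and> e \<subseteq> S \<and> p \<in> inner_pts e}"
    have lr: "lv t \<in> V" "rv t \<in> V" "lv t \<noteq> rv t" using L_sepD(1-3)[OF t(1)] by auto
    have S: "finite S" "S \<subseteq> V" using lr by (auto simp: S_def)
    have A: "A \<subseteq> V - S" using L_sepD(4-6)[OF t(1)] by (auto simp: A_def S_def)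
    have clA: "nb E x \<subseteq> A \<union> S" if "x \<in> A" for x using L_sepD(7)[OF t(1)] that by (simp add: A_def S_def)
    have Bne: "B \<noteq> {}" using chord_separates[OF t(1) t_def t(2) ne] by (simp add: A_def B_def S_def)
    have oA: "openin X (region S A)" by (rule region_open[OF S]) (use A in blast)
    have oB: "openin X (region S B)" by (rule region_open[OF S]) (auto simp: B_def)
    have F: "F = Inn ` inner_pts e"
    proof -
      have "e' = e" if e': "e' \<in> E" "e' \<subseteq> S" for e'
      proof -
        obtain a b where "e' = {a, b}" "a \<noteq> b" by (rule edge_obtain[OF e'(1)])
        then show ?thesis using e'(2) t(2) by (auto simp: S_def)
      qed
      then show ?thesis unfolding F_def using e(1) t(2) by (auto simp: S_def)
    qed
    have oF: "openin X F" unfolding F by (rule open_edge[OF e(1)])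
    have cov: "topspace X \<subseteq> Vtx ` S \<union> region S A \<union> region S B \<union> F"
      unfolding B_def F_def by (rule region_cover[OF S(1) A clA])
    have dAB: "region S A \<inter> region S B = {}" unfolding B_def by (rule region_disjoint[OF S(1) A clA])
    have dAF: "region S A \<inter> F = {}" unfolding F_def by (rule region_disjoint_edges) (use A in blast)
    have dBF: "region S B \<inter> F = {}" unfolding F_def by (rule region_disjoint_edges) (auto simp: B_def)
    obtain D1 D2 where D12: "connectedin X D1" "connectedin X D2" "D - {Vtx (lv t), Vtx (rv t)} = D1 \<union> D2"
      by (rule is_circle_minus_two[OF circ, of "Vtx (lv t)" "Vtx (rv t)"]) (use VD lr in auto)
    have Dcov: "D1 \<union> D2 \<subseteq> region S A \<union> region S B \<union> F"
      using D12(3) DX cov by (auto simp: S_def)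
    have main: False if K: "connectedin X K" "connectedin X K'" "D - {Vtx (lv t), Vtx (rv t)} = K \<union> K'" "x \<in> K" for K K'
    proof -
      have Kc: "K \<subseteq> region S A \<union> region S B \<union> F" "K' \<subseteq> region S A \<union> region S B \<union> F"
        using Dcov K(3) D12(3) by auto
      have xF: "x \<in> F" unfolding F p using e(2) by blast
      have K1: "(region S A \<union> region S B) \<inter> K = {}"
        using connectedinD[OF K(1) openin_Un[OF oA oB] oF] Kc(1) dAF dBF xF K(4) by blast
      obtain a b where ab: "a \<in> A" "b \<in> B" using ne Bne by (auto simp: A_def)
      have "Vtx a \<in> D" "Vtx b \<in> D" using VD ab A by (auto simp: B_def)
      then have "Vtx a \<in> K \<union> K'" "Vtx b \<in> K \<union> K'" using K(3) ab A by (auto simp: B_def S_def)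
      moreover have ra: "Vtx a \<in> region S A" "Vtx b \<in> region S B" using ab by (auto simp: region_def)
      ultimately have "Vtx a \<in> K'" "Vtx b \<in> K'" using K1 by blast+
      then show False using connectedinD[OF K(2) oA openin_Un[OF oB oF]] Kc(2) dAF dAB ra by blast
    qed
    have "x \<in> D1 \<union> D2" using D12(3) xD p by auto
    then show False
    proof
      assume "x \<in> D1" then show False using main[OF D12] by blast
    next
      assume "x \<in> D2" then show False using main[OF D12(2,1)] D12(3) by (simp add: Un_commute)
    qed
  qed
qed

text \<open>Inclusion suffices: the drawing makes a circle inside the boundary circle an injective
  continuous self-map of the unit circle, which is onto.\<close>

lemma hamilton_eq_rim:
  assumes D: "hamilton_circle V E D"
  shows "D = rim"
proof -
  have sub: "D \<subseteq> rim" by (rule hamilton_subset_rim[OF D])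
  have circ: "is_circle X D" using D by (simp add: hamilton_circle_def)
  obtain h where h: "continuous_map (top_of_set (sphere (0::complex) 1)) X h" "inj_on h (sphere 0 1)" "h ` sphere 0 1 = D"
    by (rule is_circle_obtain[OF circ])
  have DX: "D \<subseteq> topspace X" using circ by (simp add: is_circle_def)
  have "continuous_map (top_of_set (sphere 0 1)) (top_of_set (cball 0 1)) (emb \<circ> h)"
    by (rule continuous_map_compose[OF h(1) emb_continuous])
  then have "continuous_on (sphere 0 1) (emb \<circ> h)" by (simp add: continuous_map_in_subtopology)
  moreover have "inj_on (emb \<circ> h) (sphere 0 1)" using h(2,3) emb_inj DX by (intro comp_inj_on) (auto intro: inj_on_subset)
  moreover have im: "(emb \<circ> h) ` sphere 0 1 = emb ` D" unfolding h(3)[symmetric] by (rule image_comp[symmetric])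
  moreover have "emb ` D \<subseteq> sphere 0 1" using sub by (auto simp: rim_def)
  ultimately have "emb ` D = emb ` rim" using circle_self_embedding_surj[of "emb \<circ> h"] emb_rim by simp
  then show ?thesis using inj_on_image_eq_iff[OF emb_inj DX, of rim] by (auto simp: rim_def)
qed

end

context outerplanar
begin

lemma unique_hamilton_circle:
  "\<exists>C. hamilton_circle V E C \<and> (\<exists>f. embedding_map (freudenthal V E) (top_of_set (cball (0::complex) 1)) f \<and> f ` C = sphere 0 1) \<and>
     (\<forall>D. hamilton_circle V E D \<longrightarrow> D = C)"
proof -
  obtain u0 v0 W0 R0 where root: "V = insert u0 (insert v0 (W0 \<union> R0))" "W0 \<inter> R0 = {}" "half u0 v0 W0" "half v0 u0 R0"
    by (rule half_root)
  \<comment> \<open>One function on triples chooses the cut vertex and both parts together.\<close>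
  have "\<exists>c. \<forall>x. case x of (a, b, W) \<Rightarrow> half a b W \<longrightarrow> W \<noteq> {} \<longrightarrow> (case c x of (w, W1, W2) \<Rightarrow>
      W = insert w (W1 \<union> W2) \<and> w \<notin> W1 \<and> w \<notin> W2 \<and> W1 \<inter> W2 = {} \<and> half a w W1 \<and> half w b W2)"
  proof (rule choice, rule allI)
    fix x :: "'a \<times> 'a \<times> 'a set"
    obtain a b W where x: "x = (a, b, W)" by (cases x)
    show "\<exists>y. case x of (a, b, W) \<Rightarrow> half a b W \<longrightarrow> W \<noteq> {} \<longrightarrow> (case y of (w, W1, W2) \<Rightarrow>
      W = insert w (W1 \<union> W2) \<and> w \<notin> W1 \<and> w \<notin> W2 \<and> W1 \<inter> W2 = {} \<and> half a w W1 \<and> half w b W2)"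
    proof (cases "half a b W \<and> W \<noteq> {}")
      case True
      then obtain w W1 W2 where "W = insert w (W1 \<union> W2)" "w \<notin> W1" "w \<notin> W2" "W1 \<inter> W2 = {}" "half a w W1" "half w b W2"
        using half_split[of a b W] by metis
      then show ?thesis unfolding x by (intro exI[of _ "(w, W1, W2)"]) simp
    qed (simp add: x)
  qed
  then obtain c where c0: "\<forall>x. case x of (a, b, W) \<Rightarrow> half a b W \<longrightarrow> W \<noteq> {} \<longrightarrow> (case c x of (w, W1, W2) \<Rightarrow>
      W = insert w (W1 \<union> W2) \<and> w \<notin> W1 \<and> w \<notin> W2 \<and> W1 \<inter> W2 = {} \<and> half a w W1 \<and> half w b W2)" ..
  have c: "W = insert (fst (c (a, b, W))) (fst (snd (c (a, b, W))) \<union> snd (snd (c (a, b, W)))) \<and>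
      fst (c (a, b, W)) \<notin> fst (snd (c (a, b, W))) \<and> fst (c (a, b, W)) \<notin> snd (snd (c (a, b, W))) \<and>
      fst (snd (c (a, b, W))) \<inter> snd (snd (c (a, b, W))) = {} \<and>
      half a (fst (c (a, b, W))) (fst (snd (c (a, b, W)))) \<and> half (fst (c (a, b, W))) b (snd (snd (c (a, b, W))))"
    if "half a b W" "W \<noteq> {}" for a b W
    using c0[THEN spec, of "(a, b, W)"] that unfolding case_prod_beta fst_conv snd_conv by iprover
  interpret arc_tree V E u0 v0 W0 R0 "\<lambda>a b W. fst (c (a, b, W))" "\<lambda>a b W. fst (snd (c (a, b, W)))" "\<lambda>a b W. snd (snd (c (a, b, W)))"
    by unfold_locales (fact root | rule c; assumption)+
  show ?thesis using rim_hamilton emb_embedding emb_rim hamilton_eq_rim by blast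
qed

end


section \<open>Planarity obstructions\<close>

text \<open>For \<open>p\<close> on the unit circle, the Moebius map of the disk to the upper
  half-plane with pole \<open>p\<close>; the circle without \<open>p\<close> goes to the real
  line.\<close>

definition cayley :: "complex \<Rightarrow> complex \<Rightarrow> complex" where
  "cayley p z = \<i> * (p + z) / (p - z)"

lemma cayley_inj:
  assumes "p \<noteq> 0" "z \<noteq> p" "w \<noteq> p" "cayley p z = cayley p w"
  shows "z = w"
proof -
  have "\<i> * ((p + z) / (p - z)) = \<i> * ((p + w) / (p - w))" using assms(4) by (simp add: cayley_def)
  then have "(p + z) / (p - z) = (p + w) / (p - w)" unfolding mult_cancel_left by simp
  then have "(p + z) * (p - w) = (p + w) * (p - z)" using assms(2,3) by (simp add: frac_eq_eq)
  then have "2 * p * (z - w) = 0" by (simp add: algebra_simps)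
  then show ?thesis using assms(1) by simp
qed

text \<open>The imaginary part is the Poisson kernel \<open>(1 - |z|^2) / |p - z|^2\<close>.\<close>

lemma cayley_Im:
  assumes "cmod p = 1" "cmod z \<le> 1" "z \<noteq> p"
  shows "Im (cayley p z) \<ge> 0"
proof -
  have "Im (cayley p z) = Re ((p + z) / (p - z))" by (simp add: cayley_def Im_i_times flip: times_divide_eq_right)
  also have "\<dots> = ((Re p)\<^sup>2 + (Im p)\<^sup>2 - ((Re z)\<^sup>2 + (Im z)\<^sup>2)) / (cmod (p - z))\<^sup>2"
    unfolding Re_divide cmod_power2 by (simp add: power2_eq_square algebra_simps)
  also have "\<dots> = ((cmod p)\<^sup>2 - (cmod z)\<^sup>2) / (cmod (p - z))\<^sup>2" by (simp add: cmod_power2)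
  also have "\<dots> \<ge> 0" using assms(1,2) by (simp add: power_le_one)
  finally show ?thesis .
qed

text \<open>With \<open>\<phi>\<close> half the angle from the pole, the image is minus the
  cotangent of \<open>\<phi>\<close>. This increases between 0 and \<open>pi\<close>, so the order
  of angles becomes the order on the line.\<close>

lemma cayley_cis:
  assumes "sin \<phi> \<noteq> 0"
  shows "cayley (cis t) (cis (t + 2 * \<phi>)) = of_real (- cos \<phi> / sin \<phi>)"
proof -
  have c2: "cis (2 * \<phi>) = cis \<phi> * cis \<phi>" by (simp add: cis_mult)
  have e: "cis \<phi> = of_real (cos \<phi>) + \<i> * of_real (sin \<phi>)" by (simp add: complex_eq_iff)
  have one: "(of_real (cos \<phi>))\<^sup>2 + (of_real (sin \<phi>))\<^sup>2 = (1::complex)" by (simp flip: of_real_power of_real_add)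
  have p: "1 + cis (2 * \<phi>) = 2 * of_real (cos \<phi>) * cis \<phi>"
    unfolding c2 e one[symmetric] by (simp add: algebra_simps power2_eq_square)
  have m: "1 - cis (2 * \<phi>) = - 2 * \<i> * of_real (sin \<phi>) * cis \<phi>"
    unfolding c2 e one[symmetric] by (simp add: algebra_simps power2_eq_square)
  have "cayley (cis t) (cis (t + 2 * \<phi>)) = \<i> * (cis t * (1 + cis (2 * \<phi>))) / (cis t * (1 - cis (2 * \<phi>)))"
    by (simp add: cayley_def cis_mult[symmetric] algebra_simps)
  also have "\<dots> = \<i> * (1 + cis (2 * \<phi>)) / (1 - cis (2 * \<phi>))" by simp
  also have "\<dots> = of_real (- cos \<phi> / sin \<phi>)" unfolding p m using assms by (simp add: field_simps)
  finally show ?thesis .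
qed

lemma neg_cot_strict_mono:
  assumes "0 < x" "x < y" "y < pi"
  shows "- cos x / sin x < - cos y / sin (y::real)"
proof -
  have s: "sin x > 0" "sin y > 0" using assms by (auto intro: sin_gt_zero)
  have "sin (y - x) > 0" using assms by (intro sin_gt_zero) auto
  then have "cos y * sin x < cos x * sin y" by (simp add: sin_diff mult.commute)
  then show ?thesis using s by (simp add: field_simps)
qed

text \<open>The pole \<open>cis t\<close> is off both paths and precedes all four end points. In the
  half-plane the end points alternate on the bottom side of a box containing both paths, which is
  the situation of the interlacing form of the Fashoda theorem.\<close>

lemma crossing_cut:
  assumes ord: "t < a" "a < b" "b < c" "c < d" "d < t + 2 * pi"
    and g: "path g" "path_image g \<subseteq> cball 0 1" "pathstart g = cis a" "pathfinish g = cis c"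
    and h: "path h" "path_image h \<subseteq> cball 0 1" "pathstart h = cis b" "pathfinish h = cis d"
    and p: "cis t \<notin> path_image g" "cis t \<notin> path_image h" and dis: "path_image g \<inter> path_image h = {}"
  shows False
proof -
  define p where "p = cis t"
  define T :: "complex \<Rightarrow> real^2" where "T z = vector [Re (cayley p z), Im (cayley p z)]" for z
  have T1: "T z $ 1 = Re (cayley p z)" "T z $ 2 = Im (cayley p z)" for z by (simp_all add: T_def)
  have cont: "continuous_on S T" if "p \<notin> S" for S
  proof -
    have cc: "continuous_on S (cayley p)" unfolding cayley_def using that by (intro continuous_intros) auto
    show ?thesis
    proof (rule continuous_on_vec_lambda[of S "\<lambda>i z. T z $ i", unfolded vec_nth_inverse])
      fix i :: 2
      have "i = 1 \<or> i = 2" using exhaust_2 by blast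
      then show "continuous_on S (\<lambda>z. T z $ i)" using cc by (auto simp: T1 intro: continuous_intros)
    qed
  qed
  have Tcis: "T (cis \<theta>) $ 1 = - cos ((\<theta> - t) / 2) / sin ((\<theta> - t) / 2)" "T (cis \<theta>) $ 2 = 0"
    if "t < \<theta>" "\<theta> < t + 2 * pi" for \<theta>
  proof -
    have [simp]: "2 * ((\<theta> - t) / 2) = \<theta> - t" by simp
    have "sin ((\<theta> - t) / 2) > 0" using that by (intro sin_gt_zero) auto
    then have "cayley p (cis \<theta>) = of_real (- cos ((\<theta> - t) / 2) / sin ((\<theta> - t) / 2))"
      using cayley_cis[of "(\<theta> - t) / 2" t] unfolding p_def by (simp del: times_divide_eq_right)
    then show "T (cis \<theta>) $ 1 = - cos ((\<theta> - t) / 2) / sin ((\<theta> - t) / 2)" "T (cis \<theta>) $ 2 = 0" by (simp_all add: T1)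
  qed
  have Tmono: "T (cis x) $ 1 < T (cis y) $ 1" if "t < x" "x < y" "y < t + 2 * pi" for x y
  proof -
    have "- cos ((x - t) / 2) / sin ((x - t) / 2) < - cos ((y - t) / 2) / sin ((y - t) / 2)"
      by (rule neg_cot_strict_mono) (use that in auto)
    then show ?thesis using Tcis(1)[of x] Tcis(1)[of y] that by simp
  qed
  have cg: "continuous_on (path_image g) T" "continuous_on (path_image h) T" using cont p by (auto simp: p_def)
  have pg: "path (T \<circ> g)" "path (T \<circ> h)" using path_continuous_image g(1) h(1) cg by blast+
  have "compact (path_image (T \<circ> g) \<union> path_image (T \<circ> h))" using pg compact_path_image by blast
  then have "bounded (path_image (T \<circ> g) \<union> path_image (T \<circ> h))" by (rule compact_imp_bounded)
  then obtain M where M: "\<And>y. y \<in> path_image (T \<circ> g) \<union> path_image (T \<circ> h) \<Longrightarrow> norm y \<le> M" unfolding bounded_iff by blast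
  \<comment> \<open>Height 0 is the image of the circle; \<open>M\<close> bounds both compact
    paths.\<close>
  define lo' hi' :: "real^2" where "lo' = vector [- M, 0]" and "hi' = vector [M, M]"
  have box: "T z \<in> cbox lo' hi'" if z: "z \<in> path_image g \<union> path_image h" for z
  proof -
    have "T z \<in> path_image (T \<circ> g) \<union> path_image (T \<circ> h)" using z by (auto simp: path_image_compose)
    then have "norm (T z) \<le> M" by (rule M)
    then have n: "\<bar>T z $ 1\<bar> \<le> M" "\<bar>T z $ 2\<bar> \<le> M" using component_le_norm_cart[of "T z"] order_trans by blast+
    have "cmod z \<le> 1" using z g(2) h(2) by auto
    moreover have "z \<noteq> p" using z p by (auto simp: p_def)
    ultimately have "T z $ 2 \<ge> 0" unfolding T1 by (intro cayley_Im) (auto simp: p_def)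
    then show ?thesis using n by (auto simp: mem_box_cart lo'_def hi'_def forall_2)
  qed
  have comp: "pathstart (T \<circ> g) = T (cis a)" "pathfinish (T \<circ> g) = T (cis c)" "pathstart (T \<circ> h) = T (cis b)" "pathfinish (T \<circ> h) = T (cis d)"
    using g(3,4) h(3,4) by (simp_all add: pathstart_compose pathfinish_compose)
  obtain z where z: "z \<in> path_image (T \<circ> g)" "z \<in> path_image (T \<circ> h)"
  proof (rule fashoda_interlace[OF pg])
    show "path_image (T \<circ> g) \<subseteq> cbox lo' hi'" "path_image (T \<circ> h) \<subseteq> cbox lo' hi'" using box by (auto simp: path_image_compose)
    show "pathstart (T \<circ> g) $ 2 = lo' $ 2" "pathfinish (T \<circ> g) $ 2 = lo' $ 2" "pathstart (T \<circ> h) $ 2 = lo' $ 2" "pathfinish (T \<circ> h) $ 2 = lo' $ 2"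
      unfolding comp using ord by (simp_all add: Tcis(2) lo'_def)
    show "pathstart (T \<circ> g) $ 1 < pathstart (T \<circ> h) $ 1" "pathstart (T \<circ> h) $ 1 < pathfinish (T \<circ> g) $ 1" "pathfinish (T \<circ> g) $ 1 < pathfinish (T \<circ> h) $ 1"
      unfolding comp using ord by (auto intro!: Tmono)
  qed
  then obtain x y where xy: "x \<in> path_image g" "y \<in> path_image h" "T x = T y" by (auto simp: path_image_compose)
  have "cayley p x = cayley p y" using xy(3) T1 by (metis complex_eq_iff)
  moreover have "x \<noteq> p" "y \<noteq> p" using xy(1,2) p by (metis p_def)+
  moreover have "p \<noteq> 0" by (simp add: p_def)
  ultimately have "x = y" using cayley_inj by blast
  then show False using xy dis by blast
qed

text \<open>A pole off both paths exists, because the connected circle is not covered by two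
  disjoint closed sets that both meet it. In whichever of the four gaps it lies, a shift of angles
  by \<open>2 * pi\<close> and the reversal of paths restore the required linear order.\<close>

lemma crossing_paths:
  assumes ord: "a < b" "b < c" "c < d" "d < a + 2 * pi"
    and g: "path g" "path_image g \<subseteq> cball 0 1" "pathstart g = cis a" "pathfinish g = cis c"
    and h: "path h" "path_image h \<subseteq> cball 0 1" "pathstart h = cis b" "pathfinish h = cis d"
    and dis: "path_image g \<inter> path_image h = {}"
  shows False
proof -
  have "\<exists>p\<in>sphere 0 1. p \<notin> path_image g \<and> p \<notin> path_image h"
  proof (rule ccontr)
    assume "\<not> ?thesis"
    then have cov: "sphere 0 1 \<subseteq> path_image g \<union> path_image h" by blast
    have cl: "closed (path_image g)" "closed (path_image h)" using g(1) h(1) closed_path_image by blast+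
    have "cis a \<in> path_image g" "cis b \<in> path_image h" using g(3) h(3) pathstart_in_path_image by metis+
    moreover have "cis a \<in> sphere 0 1" "cis b \<in> sphere 0 1" by auto
    ultimately have "path_image g \<inter> sphere 0 1 \<noteq> {}" "path_image h \<inter> sphere 0 1 \<noteq> {}" by blast+
    moreover have "connected (sphere (0::complex) 1)" by (rule connected_sphere) simp
    ultimately show False using cl cov dis unfolding connected_closed by blast
  qed
  then obtain p where p: "p \<in> sphere 0 1" "p \<notin> path_image g" "p \<notin> path_image h" by blast
  obtain t where t: "a \<le> t" "t < a + 2 * pi" "p = cis t" by (rule circle_cis[OF p(1), of a])
  have im: "cis a \<in> path_image g" "cis c \<in> path_image g" "cis b \<in> path_image h" "cis d \<in> path_image h"
    using g(3,4) h(3,4) pathstart_in_path_image pathfinish_in_path_image by metis+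
  then have "t \<noteq> a" "t \<noteq> b" "t \<noteq> c" "t \<noteq> d" using p(2,3) t(3) by metis+
  then have cases: "(a < t \<and> t < b) \<or> (b < t \<and> t < c) \<or> (c < t \<and> t < d) \<or> d < t" using t by linarith
  have sh: "cis (z + 2 * pi) = cis z" for z by (simp add: cis_mult[symmetric])
  have rg: "path (reversepath g)" "path_image (reversepath g) \<subseteq> cball 0 1" "pathstart (reversepath g) = cis (c + 2 * pi)"
    "pathfinish (reversepath g) = cis (a + 2 * pi)" "pathstart (reversepath g) = cis c" using g unfolding sh by simp_all
  have rh: "path (reversepath h)" "path_image (reversepath h) \<subseteq> cball 0 1" "pathstart (reversepath h) = cis d"
    "pathfinish (reversepath h) = cis (b + 2 * pi)" using h unfolding sh by simp_all
  have g': "pathstart g = cis (a + 2 * pi)" "pathfinish g = cis (c + 2 * pi)" using g unfolding sh by simp_all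
  have pp: "cis t \<notin> path_image g" "cis t \<notin> path_image h" "cis t \<notin> path_image (reversepath g)" "cis t \<notin> path_image (reversepath h)"
    using p t(3) by simp_all
  have dd: "path_image h \<inter> path_image (reversepath g) = {}" "path_image (reversepath g) \<inter> path_image (reversepath h) = {}"
    "path_image (reversepath h) \<inter> path_image g = {}" using dis by (simp_all add: Int_commute)
  consider "a < t" "t < b" | "b < t" "t < c" | "c < t" "t < d" | "d < t" using cases by blast
  then show False
  proof cases
    case 1
    have "t < b" "b < c" "c < d" "d < a + 2 * pi" "a + 2 * pi < t + 2 * pi" using 1 ord by simp_all
    then show False by (rule crossing_cut[OF _ _ _ _ _ h rg(1,2,5,4) pp(2,3) dd(1)])
  next
    case 2
    have "t < c" "c < d" "d < a + 2 * pi" "a + 2 * pi < b + 2 * pi" "b + 2 * pi < t + 2 * pi" using 2 ord by simp_all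
    then show False by (rule crossing_cut[OF _ _ _ _ _ rg(1,2,5,4) rh pp(3,4) dd(2)])
  next
    case 3
    have "t < d" "d < a + 2 * pi" "a + 2 * pi < b + 2 * pi" "b + 2 * pi < c + 2 * pi" "c + 2 * pi < t + 2 * pi" using 3 ord by simp_all
    then show False by (rule crossing_cut[OF _ _ _ _ _ rh g(1,2) g' pp(4,1) dd(3)])
  next
    case 4
    have st: "cis (t - 2 * pi) = cis t" using sh[of "t - 2 * pi"] by simp
    have "t - 2 * pi < a" "a < b" "b < c" "c < d" "d < t - 2 * pi + 2 * pi" using 4 ord t by simp_all
    then show False by (rule crossing_cut[OF _ _ _ _ _ g h pp(1,2)[folded st] dis])
  qed
qed

lemma four_sorted:
  fixes x :: "nat \<Rightarrow> real"
  assumes "inj_on x {0..<4}"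
  shows "\<exists>i j k l. {i, j, k, l} = {0..<4} \<and> distinct [i, j, k, l] \<and> x i < x j \<and> x j < x k \<and> x k < x l"
proof -
  define xs where "xs = sort_key x [0..<4]"
  have len: "length xs = 4" and st: "set xs = {0..<4}" and d: "distinct xs" and so: "sorted (map x xs)"
    by (simp_all add: xs_def)
  obtain i j k l where xs: "xs = [i, j, k, l]" using len by (auto simp: numeral_eq_Suc length_Suc_conv)
  have S: "{i, j, k, l} = {0..<4}" using st xs by simp
  have m: "i \<in> {0..<4}" "j \<in> {0..<4}" "k \<in> {0..<4}" "l \<in> {0..<4}" unfolding S[symmetric] by auto
  have dd: "i \<noteq> j" "j \<noteq> k" "k \<noteq> l" using d xs by auto
  have ne: "x i \<noteq> x j" "x j \<noteq> x k" "x k \<noteq> x l" using inj_onD[OF assms _ m(1,2)] inj_onD[OF assms _ m(2,3)] inj_onD[OF assms _ m(3,4)] dd by blast+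
  have le: "x i \<le> x j" "x j \<le> x k" "x k \<le> x l" using so xs by auto
  show ?thesis
    by (rule exI[of _ i], rule exI[of _ j], rule exI[of _ k], rule exI[of _ l])
      (intro conjI S d[unfolded xs]; use ne le in linarith)
qed

text \<open>\<open>A\<close> and \<open>B\<close> are the hubs, the other three the spokes. The
  forbidden patterns are orders in which a hub with one spoke alternates with the other hub and
  another spoke. They allow at most one spoke in each of the two arcs between the hubs, but there
  are three.\<close>

lemma interlacing_hub_spokes:
  fixes A B :: real and s1 s2 s3 :: real
  assumes d: "A \<noteq> s1" "A \<noteq> s2" "A \<noteq> s3" "B \<noteq> s1" "B \<noteq> s2" "B \<noteq> s3" "s1 \<noteq> s2" "s1 \<noteq> s3" "s2 \<noteq> s3" "A < B"
    and k: "\<And>u w. u \<in> {s1, s2, s3} \<Longrightarrow> w \<in> {s1, s2, s3} \<Longrightarrow> u \<noteq> w \<Longrightarrow>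
      \<not> (A < B \<and> B < u \<and> u < w) \<and> \<not> (u < w \<and> w < A \<and> A < B) \<and> \<not> (A < u \<and> u < w \<and> w < B) \<and> \<not> (u < A \<and> A < B \<and> B < w)"
  shows False
proof -
  have K: "\<not> (B < u \<and> B < w)" "\<not> (u < A \<and> w < A)" "\<not> (A < u \<and> u < B \<and> A < w \<and> w < B)" "\<not> (u < A \<and> B < w)"
    if "u \<in> {s1, s2, s3}" "w \<in> {s1, s2, s3}" "u \<noteq> w" for u w
  proof -
    have "u < w \<or> w < u" using that(3) by linarith
    then show "\<not> (B < u \<and> B < w)" "\<not> (u < A \<and> w < A)" "\<not> (A < u \<and> u < B \<and> A < w \<and> w < B)" "\<not> (u < A \<and> B < w)"
      using k[OF that] k[OF that(2,1) that(3)[symmetric]] d(10) by argo+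
  qed
  have r: "u < A \<or> (A < u \<and> u < B) \<or> B < u" if "u \<in> {s1, s2, s3}" for u
  proof -
    have "A \<noteq> u" "B \<noteq> u" using that d(1-6) by blast+
    then show ?thesis by linarith
  qed
  have m: "s1 \<in> {s1, s2, s3}" "s2 \<in> {s1, s2, s3}" "s3 \<in> {s1, s2, s3}" by auto
  show False
    using r[OF m(1)] r[OF m(2)] r[OF m(3)] K[OF m(1,2) d(7)] K[OF m(1,3) d(8)] K[OF m(2,3) d(9)]
      K(4)[OF m(2,1) d(7)[symmetric]] K(4)[OF m(3,1) d(8)[symmetric]] K(4)[OF m(3,2) d(9)[symmetric]] by argo
qed

section \<open>Minors excluded by an embedding in the disk\<close>

context sgraph
begin

text \<open>The induced subgraph on \<open>B\<close> as a part of the 1-complex. Ends are left out,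
  since walks are finite.\<close>

definition real_of :: "'a set \<Rightarrow> 'a point set" where
  "real_of B = Vtx ` B \<union> {Inn p | p e. e \<in> E \<and> e \<subseteq> B \<and> p \<in> inner_pts e}"

lemma real_of_topspace: "B \<subseteq> V \<Longrightarrow> real_of B \<subseteq> topspace X"
  unfolding real_of_def topspace_X by blast

lemma real_of_disjoint:
  assumes "P \<inter> Q = {}"
  shows "real_of P \<inter> real_of Q = {}"
proof -
  have "False" if e: "e \<in> E" "e \<subseteq> P" "p \<in> inner_pts e" "e' \<subseteq> Q" "p \<in> inner_pts e'" for p e e'
  proof -
    obtain a b where "e = {a, b}" by (rule edge_obtain[OF e(1)])
    moreover have "e' = e" using inner_pts_unique e by blast
    ultimately show False using e assms by blast
  qed
  then show ?thesis using assms unfolding real_of_def by blast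
qed

context
  fixes f :: "'a point \<Rightarrow> complex"
  assumes f: "continuous_map X (top_of_set (cball 0 1)) f"
begin

lemma reach_path_component:
  assumes B: "B \<subseteq> V" and r: "reach E B x y" "x \<in> B"
  shows "path_component (f ` real_of B) (f (Vtx x)) (f (Vtx y))"
  using r(1)
proof (induction rule: reach_induct)
  case refl
  then show ?case using r(2) by (intro path_component_refl) (auto simp: real_of_def)
next
  case (step y z)
  have "continuous_map (top_of_set {0..1}) (top_of_set (cball 0 1)) (f \<circ> epath y z)"
    by (rule continuous_map_compose[OF epath_continuous[OF step(4)] f])
  then have "path (f \<circ> epath y z)" by (simp add: path_def continuous_map_in_subtopology)
  moreover have "path_image (f \<circ> epath y z) \<subseteq> f ` real_of B"
  proof -
    have "epath y z ` {0..1} \<subseteq> real_of B"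
      unfolding epath_image[OF edge_in(3)[OF step(4)]] real_of_def using step by blast
    then show ?thesis by (auto simp: path_image_def)
  qed
  moreover have "pathstart (f \<circ> epath y z) = f (Vtx y)" "pathfinish (f \<circ> epath y z) = f (Vtx z)"
    by (auto simp: pathstart_def pathfinish_def epath_def)
  ultimately have "path_component (f ` real_of B) (f (Vtx y)) (f (Vtx z))" unfolding path_component_def by blast
  with step show ?case by (blast intro: path_component_trans)
qed

context
  fixes \<theta> :: "'a \<Rightarrow> real"
  assumes inj: "inj_on f (topspace X)"
    and \<theta>: "\<And>v. v \<in> V \<Longrightarrow> f (Vtx v) = cis (\<theta> v) \<and> 0 \<le> \<theta> v \<and> \<theta> v < 2 * pi"
begin

text \<open>Paths in the disk follow walks in the two induced subgraphs, whose images are disjoint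
  by injectivity of \<open>f\<close>.\<close>

lemma no_crossing:
  assumes P: "P \<subseteq> V" "connected_on E P" "p1 \<in> P" "p2 \<in> P" and Q: "Q \<subseteq> V" "connected_on E Q" "q1 \<in> Q" "q2 \<in> Q"
    and dis: "P \<inter> Q = {}" and ord: "\<theta> p1 < \<theta> q1" "\<theta> q1 < \<theta> p2" "\<theta> p2 < \<theta> q2"
  shows False
proof -
  have "path_component (f ` real_of P) (f (Vtx p1)) (f (Vtx p2))"
    by (rule reach_path_component[OF P(1) connected_on_reach[OF P(2-4)] P(3)])
  then obtain g where g: "path g" "path_image g \<subseteq> f ` real_of P" "pathstart g = f (Vtx p1)" "pathfinish g = f (Vtx p2)"
    unfolding path_component_def by blast
  have "path_component (f ` real_of Q) (f (Vtx q1)) (f (Vtx q2))"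
    by (rule reach_path_component[OF Q(1) connected_on_reach[OF Q(2-4)] Q(3)])
  then obtain h where h: "path h" "path_image h \<subseteq> f ` real_of Q" "pathstart h = f (Vtx q1)" "pathfinish h = f (Vtx q2)"
    unfolding path_component_def by blast
  have "f ` topspace X \<subseteq> cball 0 1" using f by (auto simp: continuous_map_in_subtopology)
  then have cb: "path_image g \<subseteq> cball 0 1" "path_image h \<subseteq> cball 0 1"
    using g(2) h(2) real_of_topspace[OF P(1)] real_of_topspace[OF Q(1)] by blast+
  have "f ` real_of P \<inter> f ` real_of Q = {}"
    using real_of_disjoint[OF dis] inj_on_image_Int[OF inj real_of_topspace[OF P(1)] real_of_topspace[OF Q(1)]] by simp
  then have d: "path_image g \<inter> path_image h = {}" using g(2) h(2) by blast
  have "p1 \<in> V" "q2 \<in> V" using P(1,3) Q(1,4) by auto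
  then have "\<theta> q2 < \<theta> p1 + 2 * pi" using \<theta>[of q2] \<theta>[of p1] by linarith
  then show False
    using crossing_paths[OF ord _ g(1) cb(1) _ _ h(1) cb(2) _ _ d] g(3,4) h(3,4) \<theta> P(1,3,4) Q(1,3,4) by (metis subsetD)
qed

lemma \<theta>_inj: "v \<in> V \<Longrightarrow> w \<in> V \<Longrightarrow> \<theta> v = \<theta> w \<Longrightarrow> v = w"
  using inj_onD[OF inj, of "Vtx v" "Vtx w"] \<theta>[of v] \<theta>[of w] by (auto simp: topspace_X)

text \<open>Order one representative of each branch set around the circle and join opposite ones,
  first with third and second with fourth. In \<open>K4\<close> both joins exist, and they would
  have to cross.\<close>

lemma no_K4_minor: "\<not> has_minor V E K4_V K4_E"
proof
  assume "has_minor V E K4_V K4_E"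
  then obtain B :: "nat \<Rightarrow> 'a set" where B: "\<forall>x\<in>K4_V. B x \<subseteq> V \<and> connected_on E (B x)"
    "\<forall>x\<in>K4_V. \<forall>y\<in>K4_V. x \<noteq> y \<longrightarrow> B x \<inter> B y = {}"
    "\<forall>x\<in>K4_V. \<forall>y\<in>K4_V. {x, y} \<in> K4_E \<longrightarrow> (\<exists>u\<in>B x. \<exists>w\<in>B y. {u, w} \<in> E)"
    unfolding has_minor_def by blast
  have "\<forall>x\<in>K4_V. \<exists>v. v \<in> B x" using B(1) by (auto simp: connected_on_def)
  then obtain b where b: "\<And>x. x \<in> K4_V \<Longrightarrow> b x \<in> B x" by metis
  have bV: "b x \<in> V" if "x \<in> K4_V" for x using b B(1) that by blast
  have "inj_on (\<lambda>x. \<theta> (b x)) {0..<4}"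
  proof (rule inj_onI)
    fix x y assume xy: "x \<in> {0..<4::nat}" "y \<in> {0..<4}" "\<theta> (b x) = \<theta> (b y)"
    then have "b x = b y" using \<theta>_inj bV by (auto simp: K4_V_def)
    then show "x = y" using B(2) b[of x] b[of y] xy unfolding K4_V_def by (metis IntI empty_iff)
  qed
  from four_sorted[OF this] obtain i j k l where o: "{i, j, k, l} = {0..<4}" "distinct [i, j, k, l]"
    "\<theta> (b i) < \<theta> (b j)" "\<theta> (b j) < \<theta> (b k)" "\<theta> (b k) < \<theta> (b l)" by (elim exE conjE)
  have m: "i \<in> K4_V" "j \<in> K4_V" "k \<in> K4_V" "l \<in> K4_V" using o(1) by (auto simp: K4_V_def)
  have con: "connected_on E (B x \<union> B y)" if xy: "x \<in> K4_V" "y \<in> K4_V" "x \<noteq> y" for x y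
  proof -
    have "{x, y} \<in> K4_E" using xy by (auto simp: K4_E_def K4_V_def)
    then obtain u w where "u \<in> B x" "w \<in> B y" "{u, w} \<in> E" using B(3) xy by blast
    then show ?thesis using connected_on_Un_edge[of E "B x" "B y" u w] B(1) xy by blast
  qed
  show False
  proof (rule no_crossing[of "B i \<union> B k" "b i" "b k" "B j \<union> B l" "b j" "b l"])
    show "connected_on E (B i \<union> B k)" "connected_on E (B j \<union> B l)" using con m o(2) by auto
    show "B i \<union> B k \<subseteq> V" "B j \<union> B l \<subseteq> V" using B(1) m by blast+
    have "B i \<inter> B j = {}" "B i \<inter> B l = {}" "B k \<inter> B j = {}" "B k \<inter> B l = {}" using B(2) m o(2) by auto
    then show "(B i \<union> B k) \<inter> (B j \<union> B l) = {}" by blast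
  qed (use b m o in auto)
qed

text \<open>A hub joined with one spoke is disjoint from the other hub joined with another spoke, so
  such pairs may not interlace; \<open>interlacing_hub_spokes\<close> shows that three spokes are
  too many.\<close>

lemma no_K23_minor: "\<not> has_minor V E K23_V K23_E"
proof
  assume "has_minor V E K23_V K23_E"
  then obtain B :: "nat \<Rightarrow> 'a set" where B: "\<forall>x\<in>K23_V. B x \<subseteq> V \<and> connected_on E (B x)"
    "\<forall>x\<in>K23_V. \<forall>y\<in>K23_V. x \<noteq> y \<longrightarrow> B x \<inter> B y = {}"
    "\<forall>x\<in>K23_V. \<forall>y\<in>K23_V. {x, y} \<in> K23_E \<longrightarrow> (\<exists>u\<in>B x. \<exists>w\<in>B y. {u, w} \<in> E)"
    unfolding has_minor_def by blast
  have "\<forall>x\<in>K23_V. \<exists>v. v \<in> B x" using B(1) by (auto simp: connected_on_def)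
  then obtain b where b: "\<And>x. x \<in> K23_V \<Longrightarrow> b x \<in> B x" by metis
  have bV: "b x \<in> V" if "x \<in> K23_V" for x using b B(1) that by blast
  define x where "x i = \<theta> (b i)" for i
  have xinj: "x i \<noteq> x j" if ij: "i \<in> K23_V" "j \<in> K23_V" "i \<noteq> j" for i j
  proof
    assume "x i = x j"
    then have "b i = b j" using \<theta>_inj bV ij by (auto simp: x_def)
    then show False using B(2) b[of i] b[of j] ij by (metis IntI empty_iff)
  qed
  have con: "connected_on E (B h \<union> B u)" if hu: "h \<in> {0, 1}" "u \<in> {2, 3, 4}" for h u
  proof -
    have m: "h \<in> K23_V" "u \<in> K23_V" using hu by (auto simp: K23_V_def)
    have "h < 2" "2 \<le> u" "u < 5" using hu by auto
    then have "{h, u} \<in> K23_E" unfolding K23_E_def by blast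
    then obtain y w where "y \<in> B h" "w \<in> B u" "{y, w} \<in> E" using B(3) m by blast
    then show ?thesis using connected_on_Un_edge[of E "B h" "B u" y w] B(1) m by blast
  qed
  have key: "\<not> (x p1 < x q1 \<and> x q1 < x p2 \<and> x p2 < x q2)"
    if hu: "h \<in> {0, 1}" "h' \<in> {0, 1}" "h \<noteq> h'" "u \<in> {2, 3, 4}" "w \<in> {2, 3, 4}" "u \<noteq> w"
      and pq: "p1 \<in> {h, u}" "p2 \<in> {h, u}" "q1 \<in> {h', w}" "q2 \<in> {h', w}" for h h' u w p1 p2 q1 q2
  proof
    assume ord: "x p1 < x q1 \<and> x q1 < x p2 \<and> x p2 < x q2"
    have sub: "{0, 1} \<subseteq> K23_V" "{2, 3, 4} \<subseteq> K23_V" "{0, 1} \<inter> {2, 3, 4::nat} = {}" by (auto simp: K23_V_def)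
    have m: "h \<in> K23_V" "u \<in> K23_V" "h' \<in> K23_V" "w \<in> K23_V" using hu(1,2,4,5) sub(1,2) by blast+
    have ne: "h \<noteq> w" "u \<noteq> h'" using hu(1,2,4,5) sub(3) by blast+
    show False
    proof (rule no_crossing[of "B h \<union> B u" "b p1" "b p2" "B h' \<union> B w" "b q1" "b q2"])
      show "connected_on E (B h \<union> B u)" "connected_on E (B h' \<union> B w)" using con hu by blast+
      show "B h \<union> B u \<subseteq> V" "B h' \<union> B w \<subseteq> V" using B(1) m by blast+
      have "B h \<inter> B h' = {}" "B h \<inter> B w = {}" "B u \<inter> B h' = {}" "B u \<inter> B w = {}" using B(2) m ne hu(3,6) by auto
      then show "(B h \<union> B u) \<inter> (B h' \<union> B w) = {}" by blast
      show "b p1 \<in> B h \<union> B u" "b p2 \<in> B h \<union> B u" "b q1 \<in> B h' \<union> B w" "b q2 \<in> B h' \<union> B w" using b m pq by blast+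
    qed (use ord in \<open>auto simp: x_def\<close>)
  qed
  have main: False if h: "h \<in> {0, 1}" "h' \<in> {0, 1}" "h \<noteq> h'" "x h < x h'" for h h'
  proof (rule interlacing_hub_spokes[of "x h" "x 2" "x 3" "x 4" "x h'"])
    show "x h \<noteq> x 2" "x h \<noteq> x 3" "x h \<noteq> x 4" "x h' \<noteq> x 2" "x h' \<noteq> x 3" "x h' \<noteq> x 4" "x 2 \<noteq> x 3" "x 2 \<noteq> x 4" "x 3 \<noteq> x 4"
      by (rule xinj; use h in \<open>auto simp: K23_V_def\<close>)+
    fix u w assume uw: "u \<in> {x 2, x 3, x 4}" "w \<in> {x 2, x 3, x 4}" "u \<noteq> w"
    obtain i where i: "u = x i" "i \<in> {2, 3, 4}" using uw(1) by auto
    obtain j where j: "w = x j" "j \<in> {2, 3, 4}" using uw(2) by auto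
    have ij: "i \<noteq> j" using i j uw(3) by auto
    show "\<not> (x h < x h' \<and> x h' < u \<and> u < w) \<and> \<not> (u < w \<and> w < x h \<and> x h < x h') \<and>
        \<not> (x h < u \<and> u < w \<and> w < x h') \<and> \<not> (u < x h \<and> x h < x h' \<and> x h' < w)"
      unfolding i(1) j(1)
      using key[OF h(1,2,3) i(2) j(2) ij, of h i h' j] key[OF h(1,2,3) i(2) j(2) ij, of i h j h']
        key[OF h(1,2,3) j(2) i(2) ij[symmetric], of h j i h'] key[OF h(2,1) h(3)[symmetric] i(2) j(2) ij, of i h' h j]
      by blast
  qed (use h in auto)
  have "x 0 \<noteq> x 1" by (rule xinj) (auto simp: K23_V_def)
  then have "x 0 < x 1 \<or> x 1 < x 0" by linarith
  then show False using main[of 0 1] main[of 1 0] zero_neq_one by blast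
qed

end

end

text \<open>With at most two vertices there are no ends and at most one edge, whereas a circle is
  infinite and so contains an inner point \<open>q\<close> of that edge. Removing \<open>q\<close>
  would separate the two vertices on the circle.\<close>

lemma hamilton_circle_card:
  assumes "graph_connected V E" "hamilton_circle V E C"
  shows "infinite V \<or> card V > 2"
proof (rule ccontr)
  assume "\<not> ?thesis"
  then have V: "finite V" "card V \<le> 2" by auto
  have circ: "is_circle X C" and VC: "Vtx ` V \<subseteq> C" using assms(2) by (auto simp: hamilton_circle_def)
  then have CX: "C \<subseteq> topspace X" by (simp add: is_circle_def)
  have "ends V E = {}"
  proof (rule ccontr)
    assume "ends V E \<noteq> {}"
    then obtain r where r: "is_ray E r" by (auto simp: ends_def)
    then have "range r \<subseteq> V" using ray_in_V by blast
    then have "finite (range r)" using V(1) finite_subset by blast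
    moreover have "inj r" using r by (simp add: is_ray_def)
    ultimately show False using finite_imageD[of r UNIV] by auto
  qed
  then have topX: "topspace X = Vtx ` V \<union> Inn ` (\<Union>e\<in>E. inner_pts e)" by (simp add: topspace_X)
  obtain h where h: "continuous_map (top_of_set (sphere (0::complex) 1)) X h" "inj_on h (sphere 0 1)" "h ` sphere 0 1 = C"
    by (rule is_circle_obtain[OF circ])
  have "infinite (sphere (0::complex) 1)"
  proof
    assume fin: "finite (sphere (0::complex) 1)"
    have "inj_on cis {0..<2 * pi}" by (rule inj_onI) (auto intro: cis_inj_0_2pi)
    moreover have "cis ` {0..<2 * pi} \<subseteq> sphere 0 1" by auto
    ultimately have "finite {0..<2 * pi}" using fin by (meson finite_imageD finite_subset)
    then show False by (simp add: infinite_Ico)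
  qed
  then have "infinite C" using h(2,3) finite_imageD by blast
  then have "\<not> C \<subseteq> Vtx ` V" using V(1) finite_subset by blast
  then obtain c where "c \<in> C" "c \<notin> Vtx ` V" by blast
  then obtain q e where q: "Inn q \<in> C" "e \<in> E" "q \<in> inner_pts e" using CX topX by blast
  obtain x y where xy: "e = {x, y}" "x \<noteq> y" "x \<in> V" "y \<in> V" by (rule edge_obtain[OF q(2)])
  have "card {x, y} = 2" using xy by simp
  then have Vxy: "V = {x, y}" using V xy card_seteq[of V "{x, y}"] by auto
  have Ee: "e' = e" if e': "e' \<in> E" for e'
  proof -
    obtain a b where "e' = {a, b}" "a \<noteq> b" "a \<in> V" "b \<in> V" by (rule edge_obtain[OF e'])
    then show ?thesis using Vxy xy by auto
  qed
  have EE: "E = {e}" using Ee q(2) by blast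
  have qs: "q x + q y = 1" "q x > 0" "q y > 0" using inner_pts_sum[of q x y] q xy by (auto simp: inner_pts_def)
  \<comment> \<open>The radius \<open>1 - q v\<close> makes the star at \<open>v\<close> stop just
    before \<open>q\<close>.\<close>
  define U where "U v = insert (Vtx v) {Inn p | p e. e \<in> E \<and> v \<in> e \<and> p \<in> inner_pts e \<and> p v > 1 - (1 - q v)}" for v
  have oU: "openin X (U x)" "openin X (U y)" unfolding U_def by (rule open_star; use xy qs in linarith)+
  have mem: "Inn p \<in> U v \<longleftrightarrow> p \<in> inner_pts e \<and> p v > q v" if "v \<in> e" for p v
    unfolding U_def EE using that by auto
  have con: "connectedin X (C - {Inn q})" by (rule is_circle_minus_one[OF circ q(1)])
  have cov: "C - {Inn q} \<subseteq> U x \<union> U y"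
  proof
    fix z assume z: "z \<in> C - {Inn q}"
    then consider v where "z = Vtx v" "v \<in> V" | p where "z = Inn p" "p \<in> inner_pts e" using CX[unfolded topX] EE by blast
    then show "z \<in> U x \<union> U y"
    proof cases
      case 1 then show ?thesis using Vxy by (auto simp: U_def)
    next
      case 2
      have ps: "p x + p y = 1" using inner_pts_sum[of p x y] 2 xy by auto
      have "p x \<noteq> q x" using inner_pts_eqI[of p x y q] 2 q xy z by auto
      then have "p x > q x \<or> p y > q y" using ps qs by linarith
      then show ?thesis using 2 mem[of x p] mem[of y p] xy by auto
    qed
  qed
  have dis: "U x \<inter> U y = {}"
  proof (rule ccontr)
    assume "U x \<inter> U y \<noteq> {}"
    then obtain z where z: "z \<in> U x" "z \<in> U y" by blast
    then obtain p where p: "z = Inn p" using xy by (auto simp: U_def)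
    have "p \<in> inner_pts e" "p x > q x" "p y > q y" using z p mem[of x p] mem[of y p] xy by auto
    then show False using inner_pts_sum[of p x y] xy qs by auto
  qed
  have "Vtx x \<in> U x \<inter> (C - {Inn q})" "Vtx y \<in> U y \<inter> (C - {Inn q})" using VC xy by (auto simp: U_def)
  then show False using connectedinD[OF con oU cov] dis by blast
qed

text \<open>If \<open>x\<close> separated \<open>a\<close> from \<open>b\<close>, the region of the
  component of \<open>a\<close> and the region of the rest would be open, disjoint and cover the
  circle without \<open>Vtx x\<close>.\<close>

lemma hamilton_circle_two_connected:
  assumes "graph_connected V E" "hamilton_circle V E C"
  shows "two_connected V E"
  unfolding two_connected_def
proof (intro conjI ballI)
  show inf: "infinite V \<or> card V > 2" by (rule hamilton_circle_card[OF assms])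
  show "graph_connected V E" by fact
  have circ: "is_circle X C" and VC: "Vtx ` V \<subseteq> C" using assms(2) by (auto simp: hamilton_circle_def)
  then have CX: "C \<subseteq> topspace X" by (simp add: is_circle_def)
  fix x assume x: "x \<in> V"
  have "V \<noteq> {x}" using inf by auto
  then obtain a where a: "a \<in> V - {x}" using x by blast
  show "connected_on E (V - {x})"
  proof (rule connected_onI[OF a], rule ccontr)
    fix b assume b: "b \<in> V - {x}" "\<not> reach E (V - {x}) a b"
    define S where "S = {x}"
    define A where "A = {y. reach E (V - S) a y}"
    have S: "finite S" "S \<subseteq> V" using x by (auto simp: S_def)
    have A: "A \<subseteq> V - S"
    proof
      fix y assume "y \<in> A"
      then have "reach E (V - S) a y" by (simp add: A_def)
      then show "y \<in> V - S" by (rule reach_in) (use a in \<open>simp add: S_def\<close>)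
    qed
    have clA: "nb E y \<subseteq> A \<union> S" if y: "y \<in> A" for y
    proof
      fix z assume z: "z \<in> nb E y"
      show "z \<in> A \<union> S"
      proof (cases "z \<in> S")
        case False
        have "z \<in> V" using z nb_subset by blast
        then have "reach E (V - S) y z" using z y A False by (intro reach_edge) (auto simp: nb_def)
        then show ?thesis using y unfolding A_def by (auto intro: reach_trans)
      qed simp
    qed
    define B where "B = V - S - A"
    have oA: "openin X (region S A)" by (rule region_open[OF S]) (use A in blast)
    have oB: "openin X (region S B)" by (rule region_open[OF S]) (auto simp: B_def)
    have no: "\<not> e \<subseteq> S" if e: "e \<in> E" for e
    proof -
      obtain c d where "e = {c, d}" "c \<noteq> d" by (rule edge_obtain[OF e])
      then show ?thesis by (auto simp: S_def)
    qed
    have "topspace X \<subseteq> Vtx ` S \<union> region S A \<union> region S B"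
      using region_cover[OF S(1) A clA] no unfolding B_def by blast
    then have cov: "C - {Vtx x} \<subseteq> region S A \<union> region S B" using CX by (auto simp: S_def)
    have dAB: "region S A \<inter> region S B = {}" unfolding B_def by (rule region_disjoint[OF S(1) A clA])
    have con: "connectedin X (C - {Vtx x})" by (rule is_circle_minus_one[OF circ]) (use VC x in blast)
    have "Vtx a \<in> region S A \<inter> (C - {Vtx x})" using VC a by (auto simp: region_def A_def)
    moreover have "Vtx b \<in> region S B \<inter> (C - {Vtx x})" using VC b by (auto simp: region_def A_def B_def S_def)
    ultimately show False using connectedinD[OF con oA oB cov] dAB by blast
  qed
qed

lemma disk_embedding_excludes_minors:
  assumes C: "hamilton_circle V E C" and emb: "embedding_map X (top_of_set (cball (0::complex) 1)) f" and fC: "f ` C = sphere 0 1"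
  shows "\<not> has_minor V E K4_V K4_E" "\<not> has_minor V E K23_V K23_E"
proof -
  have hom: "homeomorphic_map X (subtopology (top_of_set (cball 0 1)) (f ` topspace X)) f" using emb by (simp add: embedding_map_def)
  have cont: "continuous_map X (top_of_set (cball 0 1)) f"
    using homeomorphic_imp_continuous_map[OF hom] by (simp add: continuous_map_in_subtopology)
  have inj: "inj_on f (topspace X)" by (rule homeomorphic_imp_injective_map[OF hom])
  have "\<exists>t. f (Vtx v) = cis t \<and> 0 \<le> t \<and> t < 2 * pi" if v: "v \<in> V" for v
  proof -
    have "Vtx v \<in> C" using C v by (auto simp: hamilton_circle_def)
    then have "f (Vtx v) \<in> sphere 0 1" using fC by blast
    then obtain t where "0 \<le> t" "t < 0 + 2 * pi" "f (Vtx v) = cis t" by (rule circle_cis)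
    then show ?thesis by auto
  qed
  then obtain \<theta> where \<theta>: "\<And>v. v \<in> V \<Longrightarrow> f (Vtx v) = cis (\<theta> v) \<and> 0 \<le> \<theta> v \<and> \<theta> v < 2 * pi" by metis
  show "\<not> has_minor V E K4_V K4_E" by (rule no_K4_minor[OF cont inj \<theta>])
  show "\<not> has_minor V E K23_V K23_E" by (rule no_K23_minor[OF cont inj \<theta>])
qed

end

theorem theorem1p8:
  fixes V :: "'a set" and E :: "'a set set"
  assumes "simple_graph V E" and "locally_finite V E" and "graph_connected V E"
  shows "((two_connected V E \<and> \<not> has_minor V E K4_V K4_E \<and> \<not> has_minor V E K23_V K23_E)
     \<longleftrightarrow> (\<exists>C. hamilton_circle V E C \<and>
            (\<exists>f. embedding_map (freudenthal V E) (top_of_set (cball (0::complex) 1)) f \<and>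
                 f ` C = sphere 0 1)))
    \<and> ((two_connected V E \<and> \<not> has_minor V E K4_V K4_E \<and> \<not> has_minor V E K23_V K23_E) \<and>
         (\<exists>C. hamilton_circle V E C \<and>
            (\<exists>f. embedding_map (freudenthal V E) (top_of_set (cball (0::complex) 1)) f \<and>
                 f ` C = sphere 0 1))
         \<longrightarrow> (\<exists>!C. hamilton_circle V E C))"
proof -
  interpret sgraph V E by unfold_locales (rule assms(1))
  have 1: "\<exists>C. hamilton_circle V E C \<and>
      (\<exists>f. embedding_map (freudenthal V E) (top_of_set (cball (0::complex) 1)) f \<and> f ` C = sphere 0 1) \<and>
      (\<forall>D. hamilton_circle V E D \<longrightarrow> D = C)"
    if i: "two_connected V E" "\<not> has_minor V E K4_V K4_E" "\<not> has_minor V E K23_V K23_E"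
  proof -
    interpret outerplanar V E by unfold_locales (fact assms i)+
    show ?thesis by (rule unique_hamilton_circle)
  qed
  have 2: "two_connected V E \<and> \<not> has_minor V E K4_V K4_E \<and> \<not> has_minor V E K23_V K23_E"
    if "hamilton_circle V E C" "embedding_map X (top_of_set (cball (0::complex) 1)) f" "f ` C = sphere 0 1" for C f
    using hamilton_circle_two_connected[OF assms(3) that(1)] disk_embedding_excludes_minors[OF that] by blast
  show ?thesis
  proof (intro conjI iffI impI)
    assume "two_connected V E \<and> \<not> has_minor V E K4_V K4_E \<and> \<not> has_minor V E K23_V K23_E"
    then show "\<exists>C. hamilton_circle V E C \<and>
        (\<exists>f. embedding_map (freudenthal V E) (top_of_set (cball (0::complex) 1)) f \<and> f ` C = sphere 0 1)"
      using 1 by blast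
  next
    assume "\<exists>C. hamilton_circle V E C \<and>
        (\<exists>f. embedding_map (freudenthal V E) (top_of_set (cball (0::complex) 1)) f \<and> f ` C = sphere 0 1)"
    then obtain C f where C: "hamilton_circle V E C" "embedding_map X (top_of_set (cball (0::complex) 1)) f" "f ` C = sphere 0 1"
      by blast
    note 2[OF C]
    then show "two_connected V E" "\<not> has_minor V E K4_V K4_E" "\<not> has_minor V E K23_V K23_E" by auto
  next
    assume "(two_connected V E \<and> \<not> has_minor V E K4_V K4_E \<and> \<not> has_minor V E K23_V K23_E) \<and>
         (\<exists>C. hamilton_circle V E C \<and>
            (\<exists>f. embedding_map (freudenthal V E) (top_of_set (cball (0::complex) 1)) f \<and> f ` C = sphere 0 1))"
    then show "\<exists>!C. hamilton_circle V E C" using 1 by blast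
  qed
qed

end
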